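(* Let $X$ be a UMD Banach space. Then $X$ has the decoupling property for tangent martingale difference sequences; that is, for every $p\in[1,\infty)$ there exists a constant $C_p$ such that for every martingale difference sequence $(d_n)_{n\geq 1}$ in $L^p(\Omega;X)$ and its decoupled tangent sequence $(e_n)_{n\geq 1}$ one has $$\Big(\mathbb{E}\Big\|\sum_{n=1}^N d_n\Big\|^p\Big)^{1/p}\leq C_p\Big(\mathbb{E}\Big\|\sum_{n=1}^N e_n\Big\|^p\Big)^{1/p},\qquad N\geq 1.$$
   Context: Throughout, $(\Omega,\mathcal{A},\mathbb{P})$ is a complete probability space with a filtration $(\mathcal{F}_n)_{n\geq 0}$, and $L^p(\Omega;X)$ is the Bochner space. Martingales start at zero, so a martingale difference sequence is an $(\mathcal{F}_n)_{n\ge1}$-adapted sequence $(d_n)_{n\geq 1}$ of integrable random variables with $\mathbb{E}(d_n|\mathcal{F}_{n-1})=0$ for all $n\ge 1$. Tangent: two $(\mathcal{F}_n)_{n\geq 1}$-adapted sequences $(d_n)_{n\geq1}$, $(e_n)_{n\geq 1}$ of random variables with values in a Banach space $X$ are tangent if for every $n\geq 1$ and every Borel set $A\subset X$, $\mathbb{E}(1_{\{d_n\in A\}}|\mathcal{F}_{n-1})=\mathbb{E}(1_{\{e_n\in A\}}|\mathcal{F}_{n-1})$. (CI) condition: an $(\mathcal{F}_n)_{n\geq 1}$-adapted sequence $(e_n)_{n\geq1}$ of $X$-valued random variables satisfies the (CI) condition if there is a $\sigma$-field $\mathcal{G}\subset\sigma(\bigcup_{n\geq 0}\mathcal{F}_n)$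 such that for every $n\ge1$ and every Borel set $A\subset X$, $\mathbb{E}(1_{\{e_n\in A\}}|\mathcal{F}_{n-1})=\mathbb{E}(1_{\{e_n\in A\}}|\mathcal{G})$, and $(e_n)_{n\geq1}$ is $\mathcal{G}$-conditionally independent, i.e. for all $n\ge 1$ and Borel sets $A_1,\ldots,A_n\subset X$, $\mathbb{E}(1_{\{e_1\in A_1\}}\cdots 1_{\{e_n\in A_n\}}|\mathcal{G})=\prod_{k=1}^n\mathbb{E}(1_{\{e_k\in A_k\}}|\mathcal{G})$. Decoupled tangent sequence: for every $(\mathcal{F}_n)_{n\ge1}$-adapted sequence $(d_n)_{n\geq 1}$ there exists, on a possibly enlarged probability space (with filtration), a sequence $(e_n)_{n\geq1}$ that is tangent to $(d_n)_{n\ge1}$ and satisfies the (CI) condition; it is unique in law and is called the decoupled tangent sequence of $(d_n)_{n\geq 1}$. The constant $C_p$ depends only on $p$ and the Banach space: the inequality is required for all complete probability spaces with filtrations, all martingale difference sequences $(d_n)_{n\ge1}$ in $L^p(\Omega;X)$ on them, their decoupled tangent sequences, and all $N\geq 1$. UMD: a Banach space $X$ is a UMD space if for some (equivalently, for all) $p\in(1,\infty)$ there is a constant $\beta_{p,X}\geq 1$ such that for every martingale difference sequence $(d_n)_{n\geq1}$ in $L^p(\Omega;X)$ and every $\{-1,1\}$-valued sequence $(\varepsilon_n)_{n\geq 1}$, $(\mathbb{E}\|\sum_{n=1}^N\varepsilon_n d_n\|^p)^{1/p}\leq\beta_{p,X}(\mathbb{E}\|\sum_{n=1}^N d_n\|^p)^{1/p}$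 for all $N\geq 1$. *)

theory Defs
  imports "HOL-Probability.Probability"
begin

(* The library's Bochner integral asks for a second countable range. Here the Banach space is
   arbitrary, so a random variable is a pointwise limit of simple functions, and the integral is the
   library's definition with this notion in place of Borel measurability. *)
definition strongly_measurable :: "'w measure \<Rightarrow> ('w \<Rightarrow> 'x::banach) \<Rightarrow> bool" where
  "strongly_measurable M f \<longleftrightarrow>
    (\<exists>s. (\<forall>i. simple_function M (s i)) \<and> (\<forall>\<omega>\<in>space M. (\<lambda>i::nat. s i \<omega>) \<longlonglongrightarrow> f \<omega>))"

definition has_strong_integral :: "'w measure \<Rightarrow> ('w \<Rightarrow> 'x::banach) \<Rightarrow> 'x \<Rightarrow> bool" where
  "has_strong_integral M f x \<longleftrightarrow> strongly_measurable M f \<and>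
    (\<exists>s. (\<forall>i. Bochner_Integration.simple_bochner_integrable M (s i)) \<and>
         (\<lambda>i::nat. \<integral>\<^sup>+ \<omega>. norm (f \<omega> - s i \<omega>) \<partial>M) \<longlonglongrightarrow> 0 \<and>
         (\<lambda>i. Bochner_Integration.simple_bochner_integral M (s i)) \<longlonglongrightarrow> x)"

lemma strongly_measurable_iff_borel:
  fixes f :: "'w \<Rightarrow> 'x::{banach, second_countable_topology}"
  shows "strongly_measurable M f \<longleftrightarrow> f \<in> borel_measurable M"
proof
  assume "strongly_measurable M f"
  then obtain s where "\<And>i. simple_function M (s i)" "\<And>\<omega>. \<omega> \<in> space M \<Longrightarrow> (\<lambda>i::nat. s i \<omega>) \<longlonglongrightarrow> f \<omega>"
    unfolding strongly_measurable_def by blast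
  then show "f \<in> borel_measurable M"
    by (blast intro: borel_measurable_LIMSEQ_metric borel_measurable_simple_function)
next
  assume "f \<in> borel_measurable M"
  from borel_measurable_implies_sequence_metric[OF this, of 0]
  show "strongly_measurable M f"
    unfolding strongly_measurable_def by blast
qed

lemma has_strong_integral_iff_has_bochner_integral:
  fixes f :: "'w \<Rightarrow> 'x::{banach, second_countable_topology}"
  shows "has_strong_integral M f x \<longleftrightarrow> has_bochner_integral M f x"
  unfolding has_strong_integral_def strongly_measurable_iff_borel has_bochner_integral.simps
  by blast

definition strongly_integrable :: "'w measure \<Rightarrow> ('w \<Rightarrow> 'x::banach) \<Rightarrow> bool" where
  "strongly_integrable M f \<longleftrightarrow> (\<exists>x. has_strong_integral M f x)"

definition bochner_Lp :: "'w measure \<Rightarrow> real \<Rightarrow> ('w \<Rightarrow> 'x::banach) \<Rightarrow> bool" where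
  "bochner_Lp M p f \<longleftrightarrow> strongly_measurable M f \<and> integrable M (\<lambda>\<omega>. norm (f \<omega>) powr p)"

definition Lp_norm :: "'w measure \<Rightarrow> real \<Rightarrow> ('w \<Rightarrow> 'x::banach) \<Rightarrow> real" where
  "Lp_norm M p f = (\<integral>\<omega>. norm (f \<omega>) powr p \<partial>M) powr (1 / p)"

definition is_cond_exp ::
    "'w measure \<Rightarrow> 'w measure \<Rightarrow> ('w \<Rightarrow> 'x::banach) \<Rightarrow> ('w \<Rightarrow> 'x) \<Rightarrow> bool" where
  "is_cond_exp M H f g \<longleftrightarrow>
    strongly_integrable M f \<and> strongly_integrable M g \<and> strongly_measurable H g \<and>
    (\<forall>A\<in>sets H. \<exists>x. has_strong_integral M (\<lambda>\<omega>. indicator A \<omega> *\<^sub>R f \<omega>) x \<and>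
                     has_strong_integral M (\<lambda>\<omega>. indicator A \<omega> *\<^sub>R g \<omega>) x)"

definition stochastic_basis :: "'w measure \<Rightarrow> (nat \<Rightarrow> 'w measure) \<Rightarrow> bool" where
  "stochastic_basis M F \<longleftrightarrow> prob_space M \<and> complete_measure M \<and>
    filtration (space M) F \<and> (\<forall>n. subalgebra M (F n))"

(* Sequences are indexed from 1: the values d 0, e 0 never matter. *)
definition adapted_seq :: "(nat \<Rightarrow> 'w measure) \<Rightarrow> (nat \<Rightarrow> 'w \<Rightarrow> 'x::banach) \<Rightarrow> bool" where
  "adapted_seq F d \<longleftrightarrow> (\<forall>n\<ge>1. strongly_measurable (F n) (d n))"

definition martingale_difference ::
    "'w measure \<Rightarrow> (nat \<Rightarrow> 'w measure) \<Rightarrow> (nat \<Rightarrow> 'w \<Rightarrow> 'x::banach) \<Rightarrow> bool" where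
  "martingale_difference M F d \<longleftrightarrow> adapted_seq F d \<and>
    (\<forall>n\<ge>1. strongly_integrable M (d n) \<and> is_cond_exp M (F (n - 1)) (d n) (\<lambda>\<omega>. 0))"

definition cond_prob_in ::
    "'w measure \<Rightarrow> 'w measure \<Rightarrow> ('w \<Rightarrow> 'x::banach) \<Rightarrow> 'x set \<Rightarrow> 'w \<Rightarrow> real" where
  "cond_prob_in M H f A = real_cond_exp M H (indicator (f -` A \<inter> space M))"

definition tangent ::
    "'w measure \<Rightarrow> (nat \<Rightarrow> 'w measure) \<Rightarrow> (nat \<Rightarrow> 'w \<Rightarrow> 'x::banach) \<Rightarrow> (nat \<Rightarrow> 'w \<Rightarrow> 'x) \<Rightarrow> bool" where
  "tangent M F d e \<longleftrightarrow> adapted_seq F d \<and> adapted_seq F e \<and>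
    (\<forall>n\<ge>1. \<forall>A\<in>sets borel. AE \<omega> in M.
       cond_prob_in M (F (n - 1)) (d n) A \<omega> = cond_prob_in M (F (n - 1)) (e n) A \<omega>)"

definition CI_condition ::
    "'w measure \<Rightarrow> (nat \<Rightarrow> 'w measure) \<Rightarrow> (nat \<Rightarrow> 'w \<Rightarrow> 'x::banach) \<Rightarrow> bool" where
  "CI_condition M F e \<longleftrightarrow> adapted_seq F e \<and>
    (\<exists>G. subalgebra (sigma (space M) (\<Union>n. sets (F n))) G \<and>
      (\<forall>n\<ge>1. \<forall>A\<in>sets borel. AE \<omega> in M.
         cond_prob_in M (F (n - 1)) (e n) A \<omega> = cond_prob_in M G (e n) A \<omega>) \<and>
      (\<forall>n\<ge>1. \<forall>A. (\<forall>k\<in>{1..n}. A k \<in> sets borel) \<longrightarrow>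
         (AE \<omega> in M.
            real_cond_exp M G (\<lambda>\<omega>'. \<Prod>k=1..n. indicator (e k -` A k \<inter> space M) \<omega>') \<omega> =
            (\<Prod>k=1..n. cond_prob_in M G (e k) (A k) \<omega>))))"

(* The map f exhibits (M', F') as an enlargement of (M, F): variables on M are lifted by composition
   with f. The last clause says that the enlarged filtration reveals nothing about the future of F
   beyond what F itself reveals, so conditional laws (and hence the martingale difference property)
   survive the lifting. *)
definition enlargement ::
    "'w measure \<Rightarrow> (nat \<Rightarrow> 'w measure) \<Rightarrow> 'v measure \<Rightarrow> (nat \<Rightarrow> 'v measure) \<Rightarrow> ('v \<Rightarrow> 'w) \<Rightarrow> bool" where
  "enlargement M F M' F' f \<longleftrightarrow> stochastic_basis M F \<and> stochastic_basis M' F' \<and>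
    f \<in> measurable M' M \<and> distr M' M f = M \<and> (\<forall>n. f \<in> measurable (F' n) (F n)) \<and>
    (\<forall>n. \<forall>B\<in>sets (F (Suc n)). AE \<omega> in M'.
       real_cond_exp M' (F' n) (indicator (f -` B \<inter> space M')) \<omega> =
       real_cond_exp M (F n) (indicator B) (f \<omega>))"

lemma enlargement_refl:
  assumes "stochastic_basis M F"
  shows "enlargement M F M F (\<lambda>\<omega>. \<omega>)"
proof -
  have "B \<inter> space M = B" if "B \<in> sets (F (Suc n))" for n B
    using that assms sets.sets_into_space[OF that]
    unfolding stochastic_basis_def subalgebra_def by auto
  then show ?thesis
    using assms unfolding enlargement_def by (auto simp: distr_id2)
qed

definition decoupled_tangent ::
    "'v measure \<Rightarrow> (nat \<Rightarrow> 'v measure) \<Rightarrow> (nat \<Rightarrow> 'v \<Rightarrow> 'x::banach) \<Rightarrow> (nat \<Rightarrow> 'v \<Rightarrow> 'x) \<Rightarrow> bool" where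
  "decoupled_tangent M F d e \<longleftrightarrow> tangent M F d e \<and> CI_condition M F e"

definition umd_bound :: "'w itself \<Rightarrow> 'x::banach itself \<Rightarrow> real \<Rightarrow> real \<Rightarrow> bool" where
  "umd_bound W X p \<beta> \<longleftrightarrow>
    (\<forall>(M :: 'w measure) F (d :: nat \<Rightarrow> 'w \<Rightarrow> 'x) (\<epsilon> :: nat \<Rightarrow> real).
       stochastic_basis M F \<longrightarrow> martingale_difference M F d \<longrightarrow> (\<forall>n\<ge>1. bochner_Lp M p (d n)) \<longrightarrow>
       (\<forall>n\<ge>1. \<epsilon> n \<in> {-1, 1}) \<longrightarrow>
       (\<forall>N\<ge>1. Lp_norm M p (\<lambda>\<omega>. \<Sum>n=1..N. \<epsilon> n *\<^sub>R d n \<omega>)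
              \<le> \<beta> * Lp_norm M p (\<lambda>\<omega>. \<Sum>n=1..N. d n \<omega>)))"

(* HOL cannot quantify over the carrier type of the probability spaces inside a formula. The spaces
   here are all the complete probability spaces (with any sigma-algebra) on the type real: this
   gives the same class of Banach spaces as arbitrary carriers, because a sequence of random
   variables with separable ranges is modelled on a standard Borel space. *)
definition umd :: "'x::banach itself \<Rightarrow> bool" where
  "umd X \<longleftrightarrow> (\<exists>p>1. \<exists>\<beta>\<ge>1. umd_bound TYPE(real) X p \<beta>)"

(* C is an admissible constant for all probability spaces with carrier type 'w and all enlargements
   of them with carrier type 'v. *)
definition decoupling_bound ::
    "'w itself \<Rightarrow> 'v itself \<Rightarrow> 'x::banach itself \<Rightarrow> real \<Rightarrow> real \<Rightarrow> bool" where
  "decoupling_bound W V X p C \<longleftrightarrow>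
    (\<forall>(M :: 'w measure) F (d :: nat \<Rightarrow> 'w \<Rightarrow> 'x) (M' :: 'v measure) F' f e.
       stochastic_basis M F \<longrightarrow> martingale_difference M F d \<longrightarrow> (\<forall>n\<ge>1. bochner_Lp M p (d n)) \<longrightarrow>
       enlargement M F M' F' f \<longrightarrow> decoupled_tangent M' F' (\<lambda>n \<omega>. d n (f \<omega>)) e \<longrightarrow>
       (\<forall>N\<ge>1. Lp_norm M p (\<lambda>\<omega>. \<Sum>n=1..N. d n \<omega>) \<le> C * Lp_norm M' p (\<lambda>\<omega>. \<Sum>n=1..N. e n \<omega>)))"

(* A constant C that serves every choice of the carrier types 'w and 'v cannot be asserted as
   "EX C. decoupling_bound TYPE('w) TYPE('v) X p C", where C may vary with 'w and 'v. It is asserted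
   by "EX C. decoupling_bound TYPE(real) TYPE(real) X p C" together with, for every C,
   "decoupling_bound TYPE(real) TYPE(real) X p C --> decoupling_bound TYPE('w) TYPE('v) X p C":
   the first formula yields C without reference to 'w and 'v. *)

end

(* Everything is reduced to finite trees. A path x of a tree is drawn letter by letter, and the
   letters y_n are, given x, independent copies of x_n given x_1, ..., x_(n-1), so that
   d_n = v(x_1, ..., x_(n-1), x_n) and e_n = v(x_1, ..., x_(n-1), y_n). Revealing first the
   unordered pair {x_n, y_n} and then its order makes (e_n + d_n)/2, (e_n - d_n)/2 a martingale
   difference sequence whose sum is the sum of the e_n, and whose alternating sum is that of the d_n:
   decoupling is a UMD inequality. It is needed for all p >= 1 but given for one q > 1. Davis'
   decomposition and a good-lambda inequality extend it, for maximal functions; the maximal function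
   on the right is removed by tangency (for the jumps d_n) and by Ottaviani's inequality (for the
   partial sums of the e_n, conditionally on x).

   Conversely a general decoupled pair is approximated by trees: the values of d_n are rounded to
   finitely many points and the conditional probabilities of these values to multiples of 1/K. The
   law of the e_n only enters through P(e_1 in A_1, ..., e_N in A_N) = E prod_n P(d_n in A_n | F_(n-1)),
   which is what tangency and the (CI) condition say. Since a tree is a stochastic basis on the real
   line, the best constant there serves for all carrier types. *)

theory Submission
  imports Defs
begin

section \<open>Extrapolation of the UMD inequality on finite filtrations\<close>

text \<open>At p = 1 a martingale does not control its maximal function, so the extrapolated
  inequality, which compares maxima, cannot be brought back to final sums by Doob's inequality; this
  takes the special structure of the \<open>e_n\<close>. The good-lambda argument stops a martingale
  by a rule known one step in advance and overshoots by one jump, so jumps need predictable bounds;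
  this is what the decomposition into small and large jumps provides.

  The tree sees only its own letters, a far smaller filtration than the given one. The conditional
  law of the next value given the letters could differ from that given \<open>F (n - 1)\<close>, and
  the decoupled sum of the tree would have the wrong law. Therefore a letter also carries the
  rounded conditional law of the next value; and the values are recentred, because rounding destroys
  their mean zero property.

  A constant valid on the real line must be inherited unchanged. So in the approximation the main
  term is split off at the cost of a factor \<open>(1 - t) powr (1 - p)\<close>, and the limits are
  taken in the order \<open>K\<close>, \<open>\<eta>\<close>, \<open>t\<close>.\<close>

lemma has_integral_powr_indicator:
  fixes p t L :: real
  assumes "1 \<le> p" "0 \<le> t" "t \<le> L"
  shows "((\<lambda>x. of_bool (x < t) * (p * x powr (p - 1))) has_integral t powr p) {0..L}"
proof -
  have "((\<lambda>x. p * x powr (p - 1)) has_integral (t powr p - 0 powr p)) {0..t}"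
  proof (rule fundamental_theorem_of_calculus_interior)
    show "continuous_on {0..t} (\<lambda>x. x powr p)"
      using assms by (intro continuous_on_powr' continuous_intros) auto
    show "((\<lambda>x. x powr p) has_vector_derivative p * x powr (p - 1)) (at x)" if "x \<in> {0<..<t}" for x
      using that by (auto intro!: derivative_eq_intros
          simp flip: has_real_derivative_iff_has_vector_derivative)
  qed (use assms in auto)
  then have "((\<lambda>x. p * x powr (p - 1)) has_integral t powr p) {0..t}"
    using assms by simp
  then have "((\<lambda>x. if x \<in> {0..t} then p * x powr (p - 1) else 0) has_integral t powr p) {0..L}"
    using assms by (subst has_integral_restrict) auto
  then show ?thesis
    by (rule has_integral_spike_finite[of "{t}", rotated 2]) auto
qed

text \<open>A tail inequality is integrated against \<open>p * x powr (p - 1)\<close>. The common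
  bound \<open>L\<close> of all values turns the integral over the half-line into one over
  \<open>{0..L}\<close>, so no integrability question arises.\<close>

lemma layer_cake_sum:
  fixes P \<phi> \<psi> \<theta> :: "'c \<Rightarrow> real"
  assumes fin: "finite \<Omega>" and p: "1 \<le> p"
    and nn: "\<And>\<omega>. \<omega> \<in> \<Omega> \<Longrightarrow> 0 \<le> \<phi> \<omega>" "\<And>\<omega>. \<omega> \<in> \<Omega> \<Longrightarrow> 0 \<le> \<psi> \<omega>" "\<And>\<omega>. \<omega> \<in> \<Omega> \<Longrightarrow> 0 \<le> \<theta> \<omega>"
    and le: "\<And>x. 0 < x \<Longrightarrow> (\<Sum>\<omega>\<in>\<Omega>. P \<omega> * of_bool (x < \<phi> \<omega>)) \<le>
        b * (\<Sum>\<omega>\<in>\<Omega>. P \<omega> * of_bool (x < \<psi> \<omega>)) + c * (\<Sum>\<omega>\<in>\<Omega>. P \<omega> * of_bool (x < \<theta> \<omega>))"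
  shows "(\<Sum>\<omega>\<in>\<Omega>. P \<omega> * \<phi> \<omega> powr p) \<le>
        b * (\<Sum>\<omega>\<in>\<Omega>. P \<omega> * \<psi> \<omega> powr p) + c * (\<Sum>\<omega>\<in>\<Omega>. P \<omega> * \<theta> \<omega> powr p)"
proof -
  define L where "L = (\<Sum>\<omega>\<in>\<Omega>. \<phi> \<omega> + \<psi> \<omega> + \<theta> \<omega>)"
  have L: "\<phi> \<omega> \<le> L" "\<psi> \<omega> \<le> L" "\<theta> \<omega> \<le> L" if "\<omega> \<in> \<Omega>" for \<omega>
  proof -
    have "\<phi> \<omega> + \<psi> \<omega> + \<theta> \<omega> \<le> L"
      unfolding L_def using nn that fin by (intro member_le_sum) (auto intro!: add_nonneg_nonneg)
    then show "\<phi> \<omega> \<le> L" "\<psi> \<omega> \<le> L" "\<theta> \<omega> \<le> L" using nn[OF that] by linarith+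
  qed
  let ?g = "\<lambda>f x. (\<Sum>\<omega>\<in>\<Omega>. P \<omega> * (of_bool (x < f \<omega>) * (p * x powr (p - 1))))"
  have I: "(?g f has_integral (\<Sum>\<omega>\<in>\<Omega>. P \<omega> * f \<omega> powr p)) {0..L}"
    if "\<And>\<omega>. \<omega> \<in> \<Omega> \<Longrightarrow> 0 \<le> f \<omega>" "\<And>\<omega>. \<omega> \<in> \<Omega> \<Longrightarrow> f \<omega> \<le> L" for f
    using that p fin
    by (intro has_integral_sum has_integral_mult_right has_integral_powr_indicator) auto
  have R: "((\<lambda>x. b * ?g \<psi> x + c * ?g \<theta> x) has_integral
      (b * (\<Sum>\<omega>\<in>\<Omega>. P \<omega> * \<psi> \<omega> powr p) + c * (\<Sum>\<omega>\<in>\<Omega>. P \<omega> * \<theta> \<omega> powr p))) {0..L}"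
    using nn L by (intro has_integral_add has_integral_mult_right I) auto
  show ?thesis
  proof (rule has_integral_le[OF I[of \<phi>] R])
    fix x :: real assume x: "x \<in> {0..L}"
    have e: "?g f x = (\<Sum>\<omega>\<in>\<Omega>. P \<omega> * of_bool (x < f \<omega>)) * (p * x powr (p - 1))" for f
      by (simp add: sum_distrib_right mult.assoc)
    show "?g \<phi> x \<le> b * ?g \<psi> x + c * ?g \<theta> x"
    \<comment> \<open>The tail hypothesis covers positive \<open>x\<close> only; at \<open>0\<close>
      both sides vanish, since \<open>0 powr (p - 1) = 0\<close> even for
      \<open>p = 1\<close>.\<close>
    proof (cases "x = 0")
      case False
      then have "(\<Sum>\<omega>\<in>\<Omega>. P \<omega> * of_bool (x < \<phi> \<omega>)) * (p * x powr (p - 1)) \<le>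
        (b * (\<Sum>\<omega>\<in>\<Omega>. P \<omega> * of_bool (x < \<psi> \<omega>)) + c * (\<Sum>\<omega>\<in>\<Omega>. P \<omega> * of_bool (x < \<theta> \<omega>)))
          * (p * x powr (p - 1))"
        using x p le[of x] by (intro mult_right_mono) auto
      then show ?thesis unfolding e by (simp add: algebra_simps)
    qed simp
  qed (use nn L in auto)
qed

section \<open>Inequalities for powers and the maximal norm\<close>

lemma powr_add_le:
  fixes a b p :: real
  assumes "0 \<le> a" "0 \<le> b" "1 \<le> p"
  shows "(a + b) powr p \<le> 2 powr p * (a powr p + b powr p)"
proof -
  have "(a + b) powr p \<le> (2 * max a b) powr p"
    using assms by (intro powr_mono2) auto
  also have "\<dots> = 2 powr p * max a b powr p"
    using assms by (subst powr_mult) auto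
  also have "\<dots> \<le> 2 powr p * (a powr p + b powr p)"
    by (intro mult_left_mono) (auto simp: max_def)
  finally show ?thesis .
qed

lemma powr_diff_le:
  fixes a b p :: real
  assumes "0 \<le> a" "a \<le> b" "1 \<le> p"
  shows "b powr p - a powr p \<le> p * b powr (p - 1) * (b - a)"
proof (cases "a = 0 \<or> a = b")
  case True
  then show ?thesis
  proof
    assume "a = 0"
    have "b powr p = b * b powr (p - 1)"
      using powr_mult_base[of b "p - 1"] assms by simp
    also have "\<dots> \<le> p * (b * b powr (p - 1))"
      using assms mult_right_mono[of 1 p "b * b powr (p - 1)"] by simp
    also have "\<dots> = p * b powr (p - 1) * (b - a)"
      using \<open>a = 0\<close> by simp
    finally show ?thesis
      using \<open>a = 0\<close> by simp
  qed simp
next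
  case False
  then have ab: "0 < a" "a < b" using assms by auto
  have "\<exists>z. a < z \<and> z < b \<and> b powr p - a powr p = (b - a) * (p * z powr (p - 1))"
    using ab by (intro MVT2) (auto intro!: derivative_eq_intros)
  then obtain z where z: "a < z" "z < b" "b powr p - a powr p = (b - a) * (p * z powr (p - 1))"
    by auto
  have "z powr (p - 1) \<le> b powr (p - 1)"
    using z ab assms by (intro powr_mono2) auto
  then have "(b - a) * (p * z powr (p - 1)) \<le> (b - a) * (p * b powr (p - 1))"
    using ab assms by (intro mult_left_mono) auto
  then show ?thesis using z by (simp add: mult_ac)
qed

definition max_norm :: "(nat \<Rightarrow> 'x::real_normed_vector) \<Rightarrow> nat \<Rightarrow> real" where
  "max_norm f n = Max ((\<lambda>k. norm (f k)) ` {..n})"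

lemma max_norm_ge: "k \<le> n \<Longrightarrow> norm (f k) \<le> max_norm f n"
  unfolding max_norm_def by (rule Max_ge) auto

lemma max_norm_le_iff: "max_norm f n \<le> c \<longleftrightarrow> (\<forall>k\<le>n. norm (f k) \<le> c)"
  unfolding max_norm_def by (subst Max_le_iff) auto

lemma less_max_norm_iff: "c < max_norm f n \<longleftrightarrow> (\<exists>k\<le>n. c < norm (f k))"
  using max_norm_le_iff[of f n c] by (auto simp: not_le[symmetric])

lemma max_norm_nonneg: "0 \<le> max_norm f n"
  using max_norm_ge[of 0 n f] norm_ge_zero[of "f 0"] by linarith

section \<open>Finite probability spaces filtered by partitions\<close>

locale finite_filtration =
  fixes \<Omega> :: "'c set" and P :: "'c \<Rightarrow> real" and \<pi> :: "nat \<Rightarrow> 'c \<Rightarrow> 'h"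
  assumes finite_space: "finite \<Omega>"
    and weight_nonneg: "\<omega> \<in> \<Omega> \<Longrightarrow> 0 \<le> P \<omega>"
    and weight_sum: "sum P \<Omega> = 1"
    and refine: "\<lbrakk>\<omega> \<in> \<Omega>; \<omega>' \<in> \<Omega>; \<pi> (Suc n) \<omega> = \<pi> (Suc n) \<omega>'\<rbrakk> \<Longrightarrow> \<pi> n \<omega> = \<pi> n \<omega>'"
begin

definition E :: "('c \<Rightarrow> real) \<Rightarrow> real" where
  "E Z = (\<Sum>\<omega>\<in>\<Omega>. P \<omega> * Z \<omega>)"

text \<open>The events of time \<open>n\<close> are the unions of fibres of \<open>\<pi> n\<close>,
  and \<open>refine\<close> makes these partitions increasingly fine. Points and cells of weight
  zero are allowed.\<close>

definition meas :: "nat \<Rightarrow> ('c \<Rightarrow> 'b) \<Rightarrow> bool" where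
  "meas n Z \<longleftrightarrow> (\<forall>\<omega>\<in>\<Omega>. \<forall>\<omega>'\<in>\<Omega>. \<pi> n \<omega> = \<pi> n \<omega>' \<longrightarrow> Z \<omega> = Z \<omega>')"

definition cell :: "nat \<Rightarrow> 'c \<Rightarrow> 'c set" where
  "cell n \<omega> = {\<omega>'\<in>\<Omega>. \<pi> n \<omega>' = \<pi> n \<omega>}"

text \<open>On a cell of mass zero the value is \<open>0\<close>. The averaging identities survive
  because all points of such a cell have weight zero, and \<open>ce_le\<close> survives because its
  bound is nonnegative.\<close>

definition ce :: "nat \<Rightarrow> ('c \<Rightarrow> 'b::real_vector) \<Rightarrow> 'c \<Rightarrow> 'b" where
  "ce n Z \<omega> = (\<Sum>\<omega>'\<in>cell n \<omega>. P \<omega>' *\<^sub>R Z \<omega>') /\<^sub>R sum P (cell n \<omega>)"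

text \<open>Differences are counted from \<open>0\<close>: \<open>D n\<close> becomes known at time
  \<open>n + 1\<close> and is centred on the cells of time \<open>n\<close>. Centring is stated as a
  weighted sum, so that null cells impose nothing.\<close>

definition mds :: "(nat \<Rightarrow> 'c \<Rightarrow> 'b::real_vector) \<Rightarrow> bool" where
  "mds D \<longleftrightarrow> (\<forall>n. meas (Suc n) (D n) \<and> (\<forall>\<omega>\<in>\<Omega>. (\<Sum>\<omega>'\<in>cell n \<omega>. P \<omega>' *\<^sub>R D n \<omega>') = 0))"

lemma finite_cell [simp]: "finite (cell n \<omega>)"
  unfolding cell_def using finite_space by simp

lemma cell_nonneg: "\<omega>' \<in> cell n \<omega> \<Longrightarrow> 0 \<le> P \<omega>'"
  unfolding cell_def using weight_nonneg by simp

lemma cell_eq: "\<pi> n \<omega> = \<pi> n \<omega>' \<Longrightarrow> cell n \<omega> = cell n \<omega>'"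
  unfolding cell_def by simp

lemma meas_ce: "meas n (ce n Z)"
  unfolding meas_def ce_def
proof (intro ballI impI)
  fix \<omega> \<omega>' assume "\<pi> n \<omega> = \<pi> n \<omega>'"
  then have "cell n \<omega> = cell n \<omega>'" by (rule cell_eq)
  then show "(\<Sum>\<omega>'\<in>cell n \<omega>. P \<omega>' *\<^sub>R Z \<omega>') /\<^sub>R sum P (cell n \<omega>) =
      (\<Sum>\<omega>'\<in>cell n \<omega>'. P \<omega>' *\<^sub>R Z \<omega>') /\<^sub>R sum P (cell n \<omega>')" by simp
qed

lemma refine_le:
  assumes "m \<le> n" "\<omega> \<in> \<Omega>" "\<omega>' \<in> \<Omega>" "\<pi> n \<omega> = \<pi> n \<omega>'"
  shows "\<pi> m \<omega> = \<pi> m \<omega>'"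
  using assms(1,4)
proof (induction n rule: dec_induct)
  case (step n)
  show ?case by (rule step.IH, rule refine[OF assms(2,3)], rule step.prems)
qed

lemma measD: "meas n Z \<Longrightarrow> \<omega> \<in> \<Omega> \<Longrightarrow> \<omega>' \<in> \<Omega> \<Longrightarrow> \<pi> n \<omega> = \<pi> n \<omega>' \<Longrightarrow> Z \<omega> = Z \<omega>'"
  unfolding meas_def by blast

lemma measI: "(\<And>\<omega> \<omega>'. \<omega> \<in> \<Omega> \<Longrightarrow> \<omega>' \<in> \<Omega> \<Longrightarrow> \<pi> n \<omega> = \<pi> n \<omega>' \<Longrightarrow> Z \<omega> = Z \<omega>') \<Longrightarrow> meas n Z"
  unfolding meas_def by blast

lemma meas_mono: "meas m Z \<Longrightarrow> m \<le> n \<Longrightarrow> meas n Z"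
  by (rule measI, rule measD[of m Z]) (assumption | rule refine_le[of m n])+

lemma meas_const [simp]: "meas n (\<lambda>\<omega>. c)"
  by (rule measI) (rule refl)

lemma meas_comp: "meas n Z \<Longrightarrow> meas n (\<lambda>\<omega>. f (Z \<omega>))"
  by (rule measI) (rule arg_cong[where f = f], rule measD)

lemma meas_comp2: "meas n Z \<Longrightarrow> meas n Y \<Longrightarrow> meas n (\<lambda>\<omega>. f (Z \<omega>) (Y \<omega>))"
  by (rule measI) (rule arg_cong2[where f = f]; rule measD)

lemma meas_sum: "(\<And>k. k \<in> I \<Longrightarrow> meas n (Z k)) \<Longrightarrow> meas n (\<lambda>\<omega>. \<Sum>k\<in>I. Z k \<omega>)"
  by (rule measI, rule sum.cong[OF refl], rule measD)

lemma meas_all: "(\<And>k. k \<in> I \<Longrightarrow> meas n (Z k)) \<Longrightarrow> meas n (\<lambda>\<omega>. \<forall>k\<in>I. Z k \<omega>)"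
  by (rule measI, rule ball_cong[OF refl], rule measD)

lemma meas_ex: "(\<And>k. k \<in> I \<Longrightarrow> meas n (Z k)) \<Longrightarrow> meas n (\<lambda>\<omega>. \<exists>k\<in>I. Z k \<omega>)"
  by (rule measI, rule bex_cong[OF refl], rule measD)

lemma sum_cells: "(\<Sum>\<omega>\<in>\<Omega>. g \<omega>) = (\<Sum>c\<in>\<pi> n ` \<Omega>. \<Sum>\<omega>\<in>{\<omega>\<in>\<Omega>. \<pi> n \<omega> = c}. g \<omega>)"
  for g :: "'c \<Rightarrow> 'b::comm_monoid_add"
  using finite_space by (intro sum.group[symmetric]) auto

lemma sum_cells_eqI:
  fixes f g :: "'c \<Rightarrow> 'b::comm_monoid_add"
  assumes "\<And>\<omega>. \<omega> \<in> \<Omega> \<Longrightarrow> (\<Sum>\<omega>'\<in>cell n \<omega>. f \<omega>') = (\<Sum>\<omega>'\<in>cell n \<omega>. g \<omega>')"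
  shows "(\<Sum>\<omega>\<in>\<Omega>. f \<omega>) = (\<Sum>\<omega>\<in>\<Omega>. g \<omega>)"
  unfolding sum_cells[where n = n]
proof (rule sum.cong[OF refl])
  fix c assume "c \<in> \<pi> n ` \<Omega>"
  then obtain \<omega> where "\<omega> \<in> \<Omega>" "c = \<pi> n \<omega>" by blast
  then show "(\<Sum>\<omega>\<in>{\<omega>\<in>\<Omega>. \<pi> n \<omega> = c}. f \<omega>) = (\<Sum>\<omega>\<in>{\<omega>\<in>\<Omega>. \<pi> n \<omega> = c}. g \<omega>)"
    using assms[of \<omega>] unfolding cell_def by blast
qed

lemma sum_cell_ce:
  "(\<Sum>\<omega>'\<in>cell n \<omega>. P \<omega>' *\<^sub>R ce n Z \<omega>') = (\<Sum>\<omega>'\<in>cell n \<omega>. P \<omega>' *\<^sub>R Z \<omega>')"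
proof -
  have "(\<Sum>\<omega>'\<in>cell n \<omega>. P \<omega>' *\<^sub>R ce n Z \<omega>') = (\<Sum>\<omega>'\<in>cell n \<omega>. P \<omega>' *\<^sub>R ce n Z \<omega>)"
    unfolding ce_def by (intro sum.cong refl) (simp add: cell_def)
  also have "\<dots> = sum P (cell n \<omega>) *\<^sub>R ce n Z \<omega>"
    by (simp add: scaleR_sum_left)
  also have "\<dots> = (\<Sum>\<omega>'\<in>cell n \<omega>. P \<omega>' *\<^sub>R Z \<omega>')"
  proof (cases "sum P (cell n \<omega>) = 0")
    case True
    then have "\<forall>\<omega>'\<in>cell n \<omega>. P \<omega>' = 0"
      using sum_nonneg_eq_0_iff[of "cell n \<omega>" P] cell_nonneg by auto
    then show ?thesis using True by simp
  qed (simp add: ce_def)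
  finally show ?thesis .
qed

lemma E_mult_ce:
  assumes "meas n k"
  shows "E (\<lambda>\<omega>. k \<omega> * ce n Z \<omega>) = E (\<lambda>\<omega>. k \<omega> * Z \<omega>)"
  unfolding E_def
proof (rule sum_cells_eqI[where n = n])
  fix \<omega> assume w: "\<omega> \<in> \<Omega>"
  have k: "k \<omega>' = k \<omega>" if "\<omega>' \<in> cell n \<omega>" for \<omega>'
    using assms w that unfolding meas_def cell_def by blast
  have a: "(\<Sum>\<omega>'\<in>cell n \<omega>. P \<omega>' * (k \<omega>' * Y \<omega>')) = k \<omega> * (\<Sum>\<omega>'\<in>cell n \<omega>. P \<omega>' * Y \<omega>')"
    for Y :: "'c \<Rightarrow> real"
    unfolding sum_distrib_left by (intro sum.cong) (auto simp: k)
  show "(\<Sum>\<omega>'\<in>cell n \<omega>. P \<omega>' * (k \<omega>' * ce n Z \<omega>')) = (\<Sum>\<omega>'\<in>cell n \<omega>. P \<omega>' * (k \<omega>' * Z \<omega>'))"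
    unfolding a using sum_cell_ce[where n = n and \<omega> = \<omega> and Z = Z] by simp
qed

lemma norm_ce_le: "norm (ce n Z \<omega>) \<le> ce n (\<lambda>\<omega>. norm (Z \<omega>)) \<omega>"
proof -
  have "norm (\<Sum>\<omega>'\<in>cell n \<omega>. P \<omega>' *\<^sub>R Z \<omega>') \<le> (\<Sum>\<omega>'\<in>cell n \<omega>. P \<omega>' * norm (Z \<omega>'))"
    by (rule sum_norm_le) (simp add: cell_nonneg)
  moreover have "0 \<le> sum P (cell n \<omega>)" by (intro sum_nonneg cell_nonneg)
  ultimately show ?thesis
    unfolding ce_def by (simp add: abs_of_nonneg mult_left_mono)
qed

lemma ce_le:
  fixes Z :: "'c \<Rightarrow> real"
  assumes "\<And>\<omega>'. \<omega>' \<in> cell n \<omega> \<Longrightarrow> Z \<omega>' \<le> c" "0 \<le> c"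
  shows "ce n Z \<omega> \<le> c"
proof -
  have "(\<Sum>\<omega>'\<in>cell n \<omega>. P \<omega>' * Z \<omega>') \<le> sum P (cell n \<omega>) * c"
    unfolding sum_distrib_right by (intro sum_mono mult_left_mono assms cell_nonneg)
  moreover have "0 \<le> sum P (cell n \<omega>)" by (intro sum_nonneg cell_nonneg)
  ultimately show ?thesis
    unfolding ce_def using assms(2)
    by (cases "sum P (cell n \<omega>) = 0") (auto simp: field_simps)
qed

lemma ce_nonneg: "(\<And>\<omega>'. \<omega>' \<in> \<Omega> \<Longrightarrow> (0::real) \<le> Z \<omega>') \<Longrightarrow> 0 \<le> ce n Z \<omega>"
proof -
  assume Z: "\<And>\<omega>'. \<omega>' \<in> \<Omega> \<Longrightarrow> 0 \<le> Z \<omega>'"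
  have "0 \<le> (\<Sum>\<omega>'\<in>cell n \<omega>. P \<omega>' * Z \<omega>')"
    by (intro sum_nonneg mult_nonneg_nonneg cell_nonneg Z) (auto simp: cell_def)
  moreover have "0 \<le> sum P (cell n \<omega>)" by (intro sum_nonneg cell_nonneg)
  ultimately show ?thesis unfolding ce_def by simp
qed

lemma E_mono: "(\<And>\<omega>. \<omega> \<in> \<Omega> \<Longrightarrow> Y \<omega> \<le> Z \<omega>) \<Longrightarrow> E Y \<le> E Z"
  unfolding E_def by (intro sum_mono mult_left_mono weight_nonneg)

lemma E_nonneg: "(\<And>\<omega>. \<omega> \<in> \<Omega> \<Longrightarrow> 0 \<le> Z \<omega>) \<Longrightarrow> 0 \<le> E Z"
  unfolding E_def by (intro sum_nonneg mult_nonneg_nonneg weight_nonneg)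

lemma E_add: "E (\<lambda>\<omega>. Y \<omega> + Z \<omega>) = E Y + E Z"
  unfolding E_def by (simp add: algebra_simps sum.distrib)

lemma E_cmult: "E (\<lambda>\<omega>. c * Z \<omega>) = c * E Z"
  unfolding E_def by (simp add: sum_distrib_left mult_ac)

lemma E_sum: "E (\<lambda>\<omega>. \<Sum>k\<in>I. Z k \<omega>) = (\<Sum>k\<in>I. E (Z k))"
  unfolding E_def sum_distrib_left by (rule sum.swap)

lemma E_cong: "(\<And>\<omega>. \<omega> \<in> \<Omega> \<Longrightarrow> Y \<omega> = Z \<omega>) \<Longrightarrow> E Y = E Z"
  unfolding E_def by (intro sum.cong) auto

lemma mds_meas: "mds D \<Longrightarrow> k < n \<Longrightarrow> meas n (D k)"
  unfolding mds_def using meas_mono[of "Suc k" "D k" n] by (meson Suc_leI)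

lemma mds_scale:
  assumes D: "mds D" and k: "\<And>n. meas n (k n)"
  shows "mds (\<lambda>n \<omega>. k n \<omega> *\<^sub>R D n \<omega>)"
  unfolding mds_def
proof (intro allI conjI ballI)
  fix n
  show "meas (Suc n) (\<lambda>\<omega>. k n \<omega> *\<^sub>R D n \<omega>)"
    by (rule meas_comp2) (rule meas_mono[OF k[of n]], simp, rule mds_meas[OF D], simp)
  fix \<omega> assume w: "\<omega> \<in> \<Omega>"
  have kk: "k n \<omega>' = k n \<omega>" if "\<omega>' \<in> cell n \<omega>" for \<omega>'
    using k[of n] w that unfolding meas_def cell_def by blast
  have "(\<Sum>\<omega>'\<in>cell n \<omega>. P \<omega>' *\<^sub>R k n \<omega>' *\<^sub>R D n \<omega>') = k n \<omega> *\<^sub>R (\<Sum>\<omega>'\<in>cell n \<omega>. P \<omega>' *\<^sub>R D n \<omega>')"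
    unfolding scaleR_sum_right by (intro sum.cong) (auto simp: kk)
  then show "(\<Sum>\<omega>'\<in>cell n \<omega>. P \<omega>' *\<^sub>R k n \<omega>' *\<^sub>R D n \<omega>') = 0"
    using D w unfolding mds_def by simp
qed

text \<open>The sum \<open>V (Suc k)\<close> of compensators is already known at time
  \<open>k\<close>. Hence in the telescoped bound of \<open>V N powr p\<close> by the terms
  \<open>p * V (Suc k) powr (p - 1) * ce k (z k)\<close>, every \<open>ce k (z k)\<close> may be
  replaced by \<open>z k\<close> under the expectation; the rest is Young's inequality with
  absorption.\<close>

lemma dual_doob:
  fixes z :: "nat \<Rightarrow> 'c \<Rightarrow> real"
  assumes z: "\<And>n \<omega>. \<omega> \<in> \<Omega> \<Longrightarrow> 0 \<le> z n \<omega>" and p: "1 \<le> p"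
  shows "E (\<lambda>\<omega>. (\<Sum>n<N. ce n (z n) \<omega>) powr p) \<le> 2 * (2 * p) powr p * E (\<lambda>\<omega>. (\<Sum>n<N. z n \<omega>) powr p)"
proof -
  define V where "V n \<omega> = (\<Sum>k<n. ce k (z k) \<omega>)" for n \<omega>
  have ce0: "0 \<le> ce n (z n) \<omega>" for n \<omega> using z by (rule ce_nonneg)
  have V0: "0 \<le> V n \<omega>" for n \<omega> unfolding V_def by (intro sum_nonneg ce0)
  have Vmono: "V m \<omega> \<le> V n \<omega>" if "m \<le> n" for m n \<omega>
    unfolding V_def using that by (intro sum_mono2) (auto simp: ce0)
  have V_meas: "meas n (V (Suc n))" for n
    unfolding V_def by (intro meas_sum) (auto intro!: meas_mono[OF meas_ce])
  define s where "s \<omega> = (\<Sum>n<N. z n \<omega>)" for \<omega>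
  have s0: "0 \<le> s \<omega>" if "\<omega> \<in> \<Omega>" for \<omega> unfolding s_def using z that by (intro sum_nonneg) auto
  have tel: "V n \<omega> powr p \<le> (\<Sum>k<n. p * (V (Suc k) \<omega> powr (p - 1) * ce k (z k) \<omega>))" for n \<omega>
  proof (induction n)
    case 0
    then show ?case by (simp add: V_def)
  next
    case (Suc n)
    have "V (Suc n) \<omega> powr p - V n \<omega> powr p \<le> p * V (Suc n) \<omega> powr (p - 1) * (V (Suc n) \<omega> - V n \<omega>)"
      by (intro powr_diff_le V0 Vmono p) simp
    then show ?case using Suc by (simp add: V_def mult_ac)
  qed
  have "E (\<lambda>\<omega>. V N \<omega> powr p) \<le> (\<Sum>k<N. p * E (\<lambda>\<omega>. V (Suc k) \<omega> powr (p - 1) * ce k (z k) \<omega>))"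
    using E_mono[of "\<lambda>\<omega>. V N \<omega> powr p", OF tel] by (simp add: E_sum E_cmult)
  also have "\<dots> = (\<Sum>k<N. p * E (\<lambda>\<omega>. V (Suc k) \<omega> powr (p - 1) * z k \<omega>))"
    by (intro sum.cong refl arg_cong2[where f = "(*)"] E_mult_ce meas_comp[OF V_meas])
  also have "\<dots> \<le> (\<Sum>k<N. p * E (\<lambda>\<omega>. V N \<omega> powr (p - 1) * z k \<omega>))"
    using p by (intro sum_mono mult_left_mono E_mono mult_right_mono powr_mono2 z V0 Vmono) auto
  also have "\<dots> = E (\<lambda>\<omega>. p * (V N \<omega> powr (p - 1) * s \<omega>))"
    by (simp add: s_def sum_distrib_left E_sum E_cmult)
  also have "\<dots> \<le> E (\<lambda>\<omega>. 1/2 * V N \<omega> powr p + (2 * p) powr p * s \<omega> powr p)"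
  proof (rule E_mono)
    fix \<omega> assume w: "\<omega> \<in> \<Omega>"
    let ?v = "V N \<omega>" and ?s = "s \<omega>"
    show "p * (?v powr (p - 1) * ?s) \<le> 1/2 * ?v powr p + (2 * p) powr p * ?s powr p"
    \<comment> \<open>If \<open>?v\<close> is at least \<open>2 * p * ?s\<close>, half of
      \<open>?v powr p\<close> suffices, and it is absorbed on the left at the end; otherwise
      \<open>?v\<close> is itself controlled by \<open>?s\<close>. The threshold
      \<open>2 * p\<close> is the origin of \<open>(2 * p) powr p\<close>.\<close>
    proof (cases "2 * p * ?s \<le> ?v")
      case True
      have "p * (?v powr (p - 1) * ?s) = ?v powr (p - 1) * (p * ?s)" by simp
      also have "\<dots> \<le> ?v powr (p - 1) * (1/2 * ?v)"
        using True by (intro mult_left_mono) auto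
      also have "\<dots> = 1/2 * ?v powr p"
        using powr_mult_base[OF V0, of N \<omega> "p - 1"] by (simp add: mult.commute)
      finally show ?thesis using s0[OF w] by (simp add: add_increasing2)
    next
      case False
      have "?v powr (p - 1) * (p * ?s) \<le> (2 * p * ?s) powr (p - 1) * (2 * p * ?s)"
        using False p s0[OF w] V0[of N \<omega>] by (intro mult_mono powr_mono2) auto
      also have "\<dots> = (2 * p * ?s) powr p"
        using powr_mult_base[of "2 * p * ?s" "p - 1"] p s0[OF w] by (simp add: mult_ac)
      also have "\<dots> = (2 * p) powr p * ?s powr p"
        using p s0[OF w] by (intro powr_mult) 
      finally show ?thesis by (simp add: mult_ac add_increasing)
    qed
  qed
  also have "\<dots> = 1/2 * E (\<lambda>\<omega>. V N \<omega> powr p) + (2 * p) powr p * E (\<lambda>\<omega>. s \<omega> powr p)"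
    by (simp only: E_add E_cmult)
  finally show ?thesis unfolding V_def s_def by simp
qed

end

text \<open>The coefficients \<open>c\<close> are \<open>1\<close> exactly from \<open>\<mu>\<close>
  until the first bad index, and vanish throughout if a bad index occurs up to \<open>\<mu>\<close>.
  Hence both sums telescope to increments between \<open>\<mu>\<close> and a common index
  \<open>\<sigma>\<close>, with \<open>\<sigma> = \<mu>\<close> for the empty sum.\<close>

lemma stopped_sums:
  fixes A :: "nat \<Rightarrow> 'x::real_vector" and h f :: "nat \<Rightarrow> 'x"
  assumes h: "\<And>n. h n = (\<Sum>k<n. A k)" and f: "\<And>n. f n = (\<Sum>k<n. \<epsilon> k *\<^sub>R A k)"
    and c: "\<And>n. c n = of_bool (\<mu> \<le> n \<and> (\<forall>j\<le>n. good j))"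
  shows "\<exists>\<sigma>. \<mu> \<le> \<sigma> \<and> (\<sigma> = \<mu> \<or> (\<forall>j<\<sigma>. good j)) \<and> \<sigma> \<le> max \<mu> m \<and>
    (\<mu> \<le> m \<and> (\<forall>j<m. good j) \<longrightarrow> \<sigma> = m) \<and>
    (\<Sum>k<m. c k *\<^sub>R A k) = h \<sigma> - h \<mu> \<and> (\<Sum>k<m. \<epsilon> k *\<^sub>R c k *\<^sub>R A k) = f \<sigma> - f \<mu>"
proof (induction m)
  case 0
  then show ?case by (intro exI[of _ \<mu>]) auto
next
  case (Suc m)
  then obtain \<sigma> where s: "\<mu> \<le> \<sigma>" "\<sigma> = \<mu> \<or> (\<forall>j<\<sigma>. good j)" "\<sigma> \<le> max \<mu> m"
    "\<mu> \<le> m \<and> (\<forall>j<m. good j) \<longrightarrow> \<sigma> = m"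
    "(\<Sum>k<m. c k *\<^sub>R A k) = h \<sigma> - h \<mu>" "(\<Sum>k<m. \<epsilon> k *\<^sub>R c k *\<^sub>R A k) = f \<sigma> - f \<mu>"
    by blast
  show ?case
  proof (cases "\<mu> \<le> m \<and> (\<forall>j\<le>m. good j)")
    case True
    then have "\<sigma> = m" using s by auto
    moreover have "c m = 1" using True c by simp
    ultimately show ?thesis
      using s True by (intro exI[of _ "Suc m"]) (auto simp: h f less_Suc_eq_le)
  next
    case False
    then have "c m = 0" using c by simp
    then show ?thesis
      using s False by (intro exI[of _ \<sigma>]) (auto simp: less_Suc_eq_le)
  qed
qed

section \<open>The good-lambda inequality for martingale transforms\<close>

context finite_filtration
begin

text \<open>The martingale is started when the transform \<open>f\<close> first exceeds
  \<open>x\<close> and stopped once \<open>h\<close>, the bound \<open>w\<close> of the next jump,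
  or \<open>f\<close> becomes too large. The stopped martingale has norm at most
  \<open>3 * \<delta> * x\<close> and vanishes outside the event \<open>x < F\<close>; where
  \<open>F\<close> passes \<open>2 * x\<close> while \<open>\<psi>\<close> stays small, its
  transform has norm at least \<open>x / 2\<close>. The inequality for the exponent \<open>q\<close>
  and Chebyshev's inequality give the factor \<open>B * (6 * \<delta>) powr q\<close>.\<close>

lemma good_lambda:
  fixes A :: "nat \<Rightarrow> 'c \<Rightarrow> 'x::real_normed_vector"
  assumes umd: "\<And>D :: nat \<Rightarrow> 'c \<Rightarrow> 'x. mds D \<Longrightarrow>
      E (\<lambda>\<omega>. norm (\<Sum>k<N. \<epsilon> k *\<^sub>R D k \<omega>) powr q) \<le> B * E (\<lambda>\<omega>. norm (\<Sum>k<N. D k \<omega>) powr q)"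
    and q: "1 \<le> q" and B: "0 \<le> B"
    and \<epsilon>: "\<And>k. \<epsilon> k \<in> {-1, 1}"
    and A: "mds A"
    and w: "\<And>n. meas n (w n)" "\<And>n \<omega>. \<omega> \<in> \<Omega> \<Longrightarrow> norm (A n \<omega>) \<le> w n \<omega>"
    and \<psi>: "\<And>n \<omega>. \<omega> \<in> \<Omega> \<Longrightarrow> n < N \<Longrightarrow> w n \<omega> \<le> \<psi> \<omega>"
      "\<And>\<omega>. \<omega> \<in> \<Omega> \<Longrightarrow> max_norm (\<lambda>n. \<Sum>k<n. A k \<omega>) N \<le> \<psi> \<omega>"
    and \<delta>: "0 < \<delta>" "\<delta> \<le> 1/2" and x: "0 < x"
  defines "F \<equiv> \<lambda>\<omega>. max_norm (\<lambda>n. \<Sum>k<n. \<epsilon> k *\<^sub>R A k \<omega>) N"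
  shows "E (\<lambda>\<omega>. of_bool (2 * x < F \<omega>)) \<le>
    E (\<lambda>\<omega>. of_bool (\<delta> * x < \<psi> \<omega>)) + B * (6 * \<delta>) powr q * E (\<lambda>\<omega>. of_bool (x < F \<omega>))"
proof -
  define h where "h \<omega> n = (\<Sum>k<n. A k \<omega>)" for n \<omega>
  define f where "f \<omega> n = (\<Sum>k<n. \<epsilon> k *\<^sub>R A k \<omega>)" for n \<omega>
  \<comment> \<open>\<open>w j\<close> is known at time \<open>j\<close> and bounds the increment
    \<open>A j\<close> that comes next; including it in the stopping rule controls the
    overshoot.\<close>
  define good where "good \<omega> j \<longleftrightarrow> norm (h \<omega> j) \<le> \<delta> * x \<and> w j \<omega> \<le> \<delta> * x \<and> norm (f \<omega> j) \<le> 2 * x" for \<omega> j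
  define c :: "nat \<Rightarrow> 'c \<Rightarrow> real" where
    "c n \<omega> = of_bool ((\<exists>j\<in>{..n}. x < norm (f \<omega> j)) \<and> (\<forall>j\<in>{..n}. good \<omega> j))" for n \<omega>
  have meas_h: "meas n (\<lambda>\<omega>. h \<omega> j)" if "j \<le> n" for n j
    unfolding h_def by (rule meas_sum) (rule mds_meas[OF A], use that in auto)
  have meas_f: "meas n (\<lambda>\<omega>. f \<omega> j)" if "j \<le> n" for n j
    unfolding f_def by (rule meas_sum, rule meas_comp) (rule mds_meas[OF A], use that in auto)
  have meas_good: "meas n (\<lambda>\<omega>. good \<omega> j)" if "j \<le> n" for n j
    unfolding good_def
    by (intro meas_comp2[where f = "(\<and>)"] meas_comp[OF meas_h] meas_comp[OF meas_f]
        meas_comp[OF meas_mono[OF w(1)]] that)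
  have meas_c: "meas n (c n)" for n
    unfolding c_def
    by (intro meas_comp[where f = of_bool] meas_comp2[where f = "(\<and>)"] meas_ex meas_all
         meas_good meas_comp[OF meas_f]) auto
  define U where "U \<omega> = (\<Sum>k<N. c k \<omega> *\<^sub>R A k \<omega>)" for \<omega>
  define V where "V \<omega> = (\<Sum>k<N. \<epsilon> k *\<^sub>R c k \<omega> *\<^sub>R A k \<omega>)" for \<omega>
  have umdUV: "E (\<lambda>\<omega>. norm (V \<omega>) powr q) \<le> B * E (\<lambda>\<omega>. norm (U \<omega>) powr q)"
    unfolding U_def V_def by (rule umd) (rule mds_scale[OF A meas_c])
  have F: "y < F \<omega> \<longleftrightarrow> (\<exists>k\<le>N. y < norm (f \<omega> k))" for y \<omega>
    unfolding F_def f_def by (rule less_max_norm_iff)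
  have Fle: "F \<omega> \<le> y \<longleftrightarrow> (\<forall>k\<le>N. norm (f \<omega> k) \<le> y)" for y \<omega>
    unfolding F_def f_def by (rule max_norm_le_iff)
  have main: "norm (U \<omega>) powr q \<le> (3 * \<delta> * x) powr q * of_bool (x < F \<omega>) \<and>
     of_bool (2 * x < F \<omega>) \<le> of_bool (\<delta> * x < \<psi> \<omega>) + (2 / x) powr q * norm (V \<omega>) powr q"
    if om: "\<omega> \<in> \<Omega>" for \<omega>
  proof (cases "x < F \<omega>")
    case False
    then have "norm (f \<omega> k) \<le> x" if "k \<le> N" for k
      using that Fle[of \<omega> x] by auto
    then have "\<not> x < norm (f \<omega> k)" if "k \<le> N" for k
      using that by (meson not_le)
    then have "c k \<omega> = 0" if "k < N" for k
      unfolding c_def using that by auto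
    then have "U \<omega> = 0" unfolding U_def by (intro sum.neutral) auto
    then show ?thesis using False x by auto
  next
    case True
    define \<mu> where "\<mu> = (LEAST j. x < norm (f \<omega> j))"
    obtain k where k: "k \<le> N" "x < norm (f \<omega> k)" using True F by blast
    have mu: "x < norm (f \<omega> \<mu>)" unfolding \<mu>_def by (rule LeastI[of _ k]) (rule k)
    have mu_less: "norm (f \<omega> j) \<le> x" if "j < \<mu>" for j
      using not_less_Least[of j "\<lambda>j. x < norm (f \<omega> j)"] that unfolding \<mu>_def by simp
    have mu_le: "\<mu> \<le> j" if "x < norm (f \<omega> j)" for j
      unfolding \<mu>_def by (rule Least_le) (rule that)
    have c_eq: "c n \<omega> = of_bool (\<mu> \<le> n \<and> (\<forall>j\<le>n. good \<omega> j))" for n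
    proof -
      have "(\<exists>j\<in>{..n}. x < norm (f \<omega> j)) \<longleftrightarrow> \<mu> \<le> n"
        using mu mu_le order_trans by auto
      then show ?thesis unfolding c_def by auto
    qed
    have stop: "\<exists>\<sigma>. \<mu> \<le> \<sigma> \<and> (\<sigma> = \<mu> \<or> (\<forall>j<\<sigma>. good \<omega> j)) \<and> \<sigma> \<le> max \<mu> m \<and>
      (\<mu> \<le> m \<and> (\<forall>j<m. good \<omega> j) \<longrightarrow> \<sigma> = m) \<and>
      (\<Sum>k<m. c k \<omega> *\<^sub>R A k \<omega>) = h \<omega> \<sigma> - h \<omega> \<mu> \<and>
      (\<Sum>k<m. \<epsilon> k *\<^sub>R c k \<omega> *\<^sub>R A k \<omega>) = f \<omega> \<sigma> - f \<omega> \<mu>" for m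
      by (rule stopped_sums) (simp_all add: h_def f_def c_eq)
    \<comment> \<open>Three contributions of size \<open>\<delta> * x\<close>: the starting value of
      \<open>h\<close> at \<open>\<mu>\<close>, its value at the last good index
      \<open>\<tau>\<close>, and the single jump after that.\<close>
    have "norm (U \<omega>) \<le> 3 * \<delta> * x"
    proof -
      obtain \<sigma> where s: "\<mu> \<le> \<sigma>" "\<sigma> = \<mu> \<or> (\<forall>j<\<sigma>. good \<omega> j)" "U \<omega> = h \<omega> \<sigma> - h \<omega> \<mu>"
        using stop[of N] unfolding U_def by blast
      show ?thesis
      proof (cases "\<sigma> = \<mu>")
        case True
        then show ?thesis using s \<delta> x by simp
      next
        case False
        then have g: "\<forall>j<\<sigma>. good \<omega> j" and lt: "\<mu> < \<sigma>" using s by auto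
        then obtain \<tau> where t: "\<sigma> = Suc \<tau>" by (cases \<sigma>) auto
        have "norm (h \<omega> \<mu>) \<le> \<delta> * x" "norm (h \<omega> \<tau>) \<le> \<delta> * x" "w \<tau> \<omega> \<le> \<delta> * x"
          using g lt t unfolding good_def by auto
        moreover have "norm (h \<omega> \<sigma>) \<le> norm (h \<omega> \<tau>) + norm (A \<tau> \<omega>)"
          unfolding t h_def by (simp add: norm_triangle_ineq)
        moreover have "norm (A \<tau> \<omega>) \<le> w \<tau> \<omega>" using w om by simp
        moreover have "norm (U \<omega>) \<le> norm (h \<omega> \<sigma>) + norm (h \<omega> \<mu>)"
          unfolding s(3) by (rule norm_triangle_ineq4)
        ultimately show ?thesis by linarith
      qed
    qed
    then have 1: "norm (U \<omega>) powr q \<le> (3 * \<delta> * x) powr q * of_bool (x < F \<omega>)"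
      using True q by (simp add: powr_mono2)
    have 2: "1 \<le> (2 / x) powr q * norm (V \<omega>) powr q"
      if big: "2 * x < F \<omega>" and small: "\<psi> \<omega> \<le> \<delta> * x"
    proof -
      define \<rho> where "\<rho> = (LEAST j. 2 * x < norm (f \<omega> j))"
      obtain l where l: "l \<le> N" "2 * x < norm (f \<omega> l)" using big F by blast
      have rho: "2 * x < norm (f \<omega> \<rho>)" unfolding \<rho>_def by (rule LeastI[of _ l]) (rule l)
      have "\<rho> \<le> l" unfolding \<rho>_def by (rule Least_le) (rule l(2))
      then have rho_N: "\<rho> \<le> N" using l(1) by simp
      have rho_less: "norm (f \<omega> j) \<le> 2 * x" if "j < \<rho>" for j
        using not_less_Least[of j "\<lambda>j. 2 * x < norm (f \<omega> j)"] that unfolding \<rho>_def by simp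
      \<comment> \<open>Where \<open>\<psi>\<close> is small, the conditions on \<open>h\<close> and
        \<open>w\<close> hold at all times before \<open>N\<close>, so the transform can only be
        stopped by the crossing of \<open>2 * x\<close> at \<open>\<rho>\<close>.\<close>
      have good: "good \<omega> j" if "j < \<rho>" for j
      proof -
        have "norm (h \<omega> j) \<le> \<psi> \<omega>"
          using \<psi>(2)[OF om] that rho_N unfolding max_norm_le_iff h_def by auto
        moreover have "w j \<omega> \<le> \<psi> \<omega>" using \<psi>(1)[OF om] that rho_N by auto
        ultimately show ?thesis using rho_less[OF that] small unfolding good_def by auto
      qed
      have mr: "\<mu> \<le> \<rho>" using rho x by (intro mu_le) simp
      \<comment> \<open>The empty sum does not exceed \<open>x\<close>, so an index precedes
        \<open>\<mu>\<close>, and there \<open>f\<close> is at most \<open>x\<close>. The jump into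
        \<open>\<mu>\<close> is at most \<open>\<delta> * x\<close>, hence at most
        \<open>x / 2\<close>; this leaves an increment of at least \<open>x / 2\<close> between
        \<open>\<mu>\<close> and \<open>\<rho>\<close>.\<close>
      have "\<mu> \<noteq> 0" using mu x unfolding f_def by (cases \<mu>) auto
      then obtain \<nu> where n: "\<mu> = Suc \<nu>" by (cases \<mu>) auto
      have "norm (f \<omega> \<mu>) \<le> norm (f \<omega> \<nu>) + norm (\<epsilon> \<nu> *\<^sub>R A \<nu> \<omega>)"
        unfolding n f_def by (simp add: norm_triangle_ineq del: norm_scaleR)
      moreover have "norm (f \<omega> \<nu>) \<le> x" using mu_less n by simp
      moreover have "norm (\<epsilon> \<nu> *\<^sub>R A \<nu> \<omega>) \<le> \<delta> * x"
        using \<epsilon>[of \<nu>] w(2)[OF om, of \<nu>] \<psi>(1)[OF om, of \<nu>] small n mr rho_N by auto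
      moreover have "\<delta> * x \<le> 1/2 * x" using \<delta> x by (intro mult_right_mono) auto
      ultimately have fm: "norm (f \<omega> \<mu>) \<le> 3/2 * x" by simp
      have "(\<Sum>k<\<rho>. \<epsilon> k *\<^sub>R c k \<omega> *\<^sub>R A k \<omega>) = f \<omega> \<rho> - f \<omega> \<mu>"
        using stop[of \<rho>] mr good by auto
      moreover have "V \<omega> = (\<Sum>k<\<rho>. \<epsilon> k *\<^sub>R c k \<omega> *\<^sub>R A k \<omega>)"
        unfolding V_def
      proof (rule sum.mono_neutral_right)
        have "\<not> good \<omega> \<rho>" using rho unfolding good_def by simp
        then show "\<forall>k\<in>{..<N} - {..<\<rho>}. \<epsilon> k *\<^sub>R c k \<omega> *\<^sub>R A k \<omega> = 0"
          unfolding c_eq by auto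
      qed (use rho_N in auto)
      ultimately have "norm (f \<omega> \<rho>) \<le> norm (V \<omega>) + norm (f \<omega> \<mu>)"
        by (metis diff_add_cancel norm_triangle_ineq)
      then have "1/2 * x \<le> norm (V \<omega>)" using fm rho by simp
      then have "1 \<le> 2 / x * norm (V \<omega>)" using x by (simp add: field_simps)
      then have "1 \<le> (2 / x * norm (V \<omega>)) powr q" using q by (intro ge_one_powr_ge_zero) auto
      then show ?thesis using x powr_mult[of "2 / x" "norm (V \<omega>)" q] by simp
    qed
    have "of_bool (2 * x < F \<omega>) \<le> of_bool (\<delta> * x < \<psi> \<omega>) + (2 / x) powr q * norm (V \<omega>) powr q"
    proof (cases "2 * x < F \<omega> \<and> \<psi> \<omega> \<le> \<delta> * x")
      case True
      then show ?thesis using 2 by auto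
    next
      case False
      then show ?thesis by (cases "2 * x < F \<omega>") auto
    qed
    then show ?thesis using 1 by simp
  qed
  have "E (\<lambda>\<omega>. of_bool (2 * x < F \<omega>)) \<le>
      E (\<lambda>\<omega>. of_bool (\<delta> * x < \<psi> \<omega>) + (2 / x) powr q * norm (V \<omega>) powr q)"
    using main by (intro E_mono) auto
  also have "\<dots> = E (\<lambda>\<omega>. of_bool (\<delta> * x < \<psi> \<omega>)) + (2 / x) powr q * E (\<lambda>\<omega>. norm (V \<omega>) powr q)"
    by (simp only: E_add E_cmult)
  also have "E (\<lambda>\<omega>. norm (V \<omega>) powr q) \<le> B * ((3 * \<delta> * x) powr q * E (\<lambda>\<omega>. of_bool (x < F \<omega>)))"
  proof -
    have "E (\<lambda>\<omega>. norm (U \<omega>) powr q) \<le> E (\<lambda>\<omega>. (3 * \<delta> * x) powr q * of_bool (x < F \<omega>))"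
      using main by (intro E_mono) auto
    then show ?thesis using umdUV mult_left_mono[OF _ B] unfolding E_cmult by fastforce
  qed
  also have "(2 / x) powr q * (B * ((3 * \<delta> * x) powr q * E (\<lambda>\<omega>. of_bool (x < F \<omega>)))) =
      B * (6 * \<delta>) powr q * E (\<lambda>\<omega>. of_bool (x < F \<omega>))"
  proof -
    have "(2 / x) powr q * (3 * \<delta> * x) powr q = (2 / x * (3 * \<delta> * x)) powr q"
      using \<delta> x by (subst powr_mult) auto
    also have "2 / x * (3 * \<delta> * x) = 6 * \<delta>" using x by simp
    finally show ?thesis by (simp add: mult_ac)
  qed
  finally show ?thesis by (simp add: mult_left_mono)
qed

text \<open>Integrating the good-lambda inequality over \<open>x\<close> changes the exponent from
  \<open>q\<close> to \<open>p\<close>. The last condition on \<open>\<delta>\<close> gives the term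
  with \<open>F\<close> on the right a coefficient of at most one half; it can be absorbed because
  all expectations are finite sums.\<close>

lemma predictable_jumps_bound:
  fixes A :: "nat \<Rightarrow> 'c \<Rightarrow> 'x::real_normed_vector"
  assumes umd: "\<And>D :: nat \<Rightarrow> 'c \<Rightarrow> 'x. mds D \<Longrightarrow>
      E (\<lambda>\<omega>. norm (\<Sum>k<N. \<epsilon> k *\<^sub>R D k \<omega>) powr q) \<le> B * E (\<lambda>\<omega>. norm (\<Sum>k<N. D k \<omega>) powr q)"
    and q: "1 \<le> q" and B: "0 \<le> B" and p: "1 \<le> p"
    and \<epsilon>: "\<And>k. \<epsilon> k \<in> {-1, 1}"
    and A: "mds A"
    and w: "\<And>n. meas n (w n)" "\<And>n \<omega>. \<omega> \<in> \<Omega> \<Longrightarrow> norm (A n \<omega>) \<le> w n \<omega>"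
    and \<psi>: "\<And>n \<omega>. \<omega> \<in> \<Omega> \<Longrightarrow> n < N \<Longrightarrow> w n \<omega> \<le> \<psi> \<omega>"
      "\<And>\<omega>. \<omega> \<in> \<Omega> \<Longrightarrow> max_norm (\<lambda>n. \<Sum>k<n. A k \<omega>) N \<le> \<psi> \<omega>"
    and \<delta>: "0 < \<delta>" "\<delta> \<le> 1/2" "2 powr p * (B * (6 * \<delta>) powr q) \<le> 1/2"
  shows "E (\<lambda>\<omega>. max_norm (\<lambda>n. \<Sum>k<n. \<epsilon> k *\<^sub>R A k \<omega>) N powr p) \<le>
    2 * (2 / \<delta>) powr p * E (\<lambda>\<omega>. \<psi> \<omega> powr p)"
proof -
  define F where "F \<omega> = max_norm (\<lambda>n. \<Sum>k<n. \<epsilon> k *\<^sub>R A k \<omega>) N" for \<omega>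
  let ?c = "B * (6 * \<delta>) powr q"
  have F0: "0 \<le> F \<omega>" for \<omega> unfolding F_def by (rule max_norm_nonneg)
  have psi0: "0 \<le> \<psi> \<omega>" if "\<omega> \<in> \<Omega>" for \<omega>
    using \<psi>(2)[OF that] max_norm_nonneg order_trans by blast
  have "(\<Sum>\<omega>\<in>\<Omega>. P \<omega> * (F \<omega> / 2) powr p) \<le>
      1 * (\<Sum>\<omega>\<in>\<Omega>. P \<omega> * (\<psi> \<omega> / \<delta>) powr p) + ?c * (\<Sum>\<omega>\<in>\<Omega>. P \<omega> * F \<omega> powr p)"
  proof (rule layer_cake_sum[OF finite_space p])
    fix x :: real assume x: "0 < x"
    have "E (\<lambda>\<omega>. of_bool (2 * x < F \<omega>)) \<le>
        E (\<lambda>\<omega>. of_bool (\<delta> * x < \<psi> \<omega>)) + ?c * E (\<lambda>\<omega>. of_bool (x < F \<omega>))"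
      unfolding F_def by (rule good_lambda[OF umd q B \<epsilon> A w \<psi> \<delta>(1,2) x])
    moreover have "x < F \<omega> / 2 \<longleftrightarrow> 2 * x < F \<omega>" "x < \<psi> \<omega> / \<delta> \<longleftrightarrow> \<delta> * x < \<psi> \<omega>" for \<omega>
      using \<delta>(1) by (auto simp: field_simps)
    ultimately show "(\<Sum>\<omega>\<in>\<Omega>. P \<omega> * of_bool (x < F \<omega> / 2)) \<le>
        1 * (\<Sum>\<omega>\<in>\<Omega>. P \<omega> * of_bool (x < \<psi> \<omega> / \<delta>)) + ?c * (\<Sum>\<omega>\<in>\<Omega>. P \<omega> * of_bool (x < F \<omega>))"
      unfolding E_def by simp
  qed (use F0 psi0 \<delta> in auto)
  then have le: "E (\<lambda>\<omega>. (F \<omega> / 2) powr p) \<le> E (\<lambda>\<omega>. (\<psi> \<omega> / \<delta>) powr p) + ?c * E (\<lambda>\<omega>. F \<omega> powr p)"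
    unfolding E_def by simp
  have e1: "E (\<lambda>\<omega>. F \<omega> powr p) = 2 powr p * E (\<lambda>\<omega>. (F \<omega> / 2) powr p)"
    unfolding E_cmult[symmetric] by (intro E_cong) (simp add: powr_divide F0)
  have e2: "2 powr p * E (\<lambda>\<omega>. (\<psi> \<omega> / \<delta>) powr p) = (2 / \<delta>) powr p * E (\<lambda>\<omega>. \<psi> \<omega> powr p)"
    unfolding E_cmult[symmetric] using psi0 \<delta> by (intro E_cong) (simp add: powr_divide)
  have "E (\<lambda>\<omega>. F \<omega> powr p) \<le>
      2 powr p * (E (\<lambda>\<omega>. (\<psi> \<omega> / \<delta>) powr p) + ?c * E (\<lambda>\<omega>. F \<omega> powr p))"
    unfolding e1[of] using le by (intro mult_left_mono) (auto simp: e1)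
  also have "\<dots> = (2 / \<delta>) powr p * E (\<lambda>\<omega>. \<psi> \<omega> powr p) + 2 powr p * ?c * E (\<lambda>\<omega>. F \<omega> powr p)"
    using e2 by (simp add: algebra_simps)
  also have "\<dots> \<le> (2 / \<delta>) powr p * E (\<lambda>\<omega>. \<psi> \<omega> powr p) + 1/2 * E (\<lambda>\<omega>. F \<omega> powr p)"
    using \<delta>(3) by (intro add_left_mono mult_right_mono E_nonneg) auto
  finally show ?thesis unfolding F_def by simp
qed

end

section \<open>Davis' decomposition and the maximal inequality for all exponents\<close>

primrec max_jump :: "(nat \<Rightarrow> 'x::real_normed_vector) \<Rightarrow> nat \<Rightarrow> real" where
  "max_jump d 0 = 0"
| "max_jump d (Suc n) = max (max_jump d n) (norm (d n))"

lemma max_jump_nonneg: "0 \<le> max_jump d n"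
  by (induction n) auto

lemma max_jump_mono: "m \<le> n \<Longrightarrow> max_jump d m \<le> max_jump d n"
  by (induction n rule: dec_induct) auto

lemma max_jump_le: "(\<And>k. k < n \<Longrightarrow> norm (d k) \<le> c) \<Longrightarrow> 0 \<le> c \<Longrightarrow> max_jump d n \<le> c"
  by (induction n) auto

lemma max_jump_ge: "k < n \<Longrightarrow> norm (d k) \<le> max_jump d n"
  by (induction n) (auto simp: less_Suc_eq)

lemma max_jump_le_max_norm: "max_jump d N \<le> 2 * max_norm (\<lambda>n. \<Sum>k<n. d k) N"
proof (rule max_jump_le)
  fix k assume k: "k < N"
  have "norm (d k) = norm ((\<Sum>k<Suc k. d k) - (\<Sum>k<k. d k))" by simp
  also have "\<dots> \<le> norm (\<Sum>k<Suc k. d k) + norm (\<Sum>k<k. d k)" by (rule norm_triangle_ineq4)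
  also have "\<dots> \<le> 2 * max_norm (\<lambda>n. \<Sum>k<n. d k) N"
    using max_norm_ge[of "Suc k" N "\<lambda>n. \<Sum>k<n. d k"] max_norm_ge[of k N "\<lambda>n. \<Sum>k<n. d k"] k by simp
  finally show "norm (d k) \<le> 2 * max_norm (\<lambda>n. \<Sum>k<n. d k) N" .
qed (simp add: max_norm_nonneg)

text \<open>Each of the jumps that more than double the running maximum dominates the sum of the earlier ones.\<close>

lemma sum_large_jumps:
  "(\<Sum>k<n. norm (if 2 * max_jump d k < norm (d k) then d k else 0)) \<le> 2 * max_jump d n"
  using max_jump_nonneg[of d] by (induction n) (auto simp: max_def)

lemma max_norm_add_le:
  fixes a b :: "nat \<Rightarrow> 'x::real_normed_vector"
  assumes "\<And>n. n \<le> N \<Longrightarrow> f n = a n + b n" "\<And>n. n \<le> N \<Longrightarrow> norm (b n) \<le> c"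
  shows "max_norm f N \<le> max_norm a N + c"
  unfolding max_norm_le_iff
proof (intro allI impI)
  fix n assume n: "n \<le> N"
  have "norm (f n) \<le> norm (a n) + norm (b n)" using assms(1)[OF n] norm_triangle_ineq by simp
  then show "norm (f n) \<le> max_norm a N + c" using max_norm_ge[OF n, of a] assms(2)[OF n] by simp
qed

context finite_filtration
begin

text \<open>\<open>max_jump\<close> at \<open>n\<close> involves only jumps of index below
  \<open>n\<close>, all known at time \<open>n\<close>; compared with the jump \<open>D n\<close> it
  is predictable.\<close>

lemma max_jump_meas:
  assumes "mds D"
  shows "meas n (\<lambda>\<omega>. max_jump (\<lambda>k. D k \<omega>) n)"
proof -
  have "m \<le> n \<Longrightarrow> meas n (\<lambda>\<omega>. max_jump (\<lambda>k. D k \<omega>) m)" for m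
  proof (induction m)
    case (Suc m)
    then have "meas n (\<lambda>\<omega>. max_jump (\<lambda>k. D k \<omega>) m)" by simp
    moreover have "meas n (D m)" using mds_meas[OF assms] Suc.prems by simp
    ultimately show ?case by (simp add: meas_comp2[where f = "\<lambda>a b. max a (norm b)"])
  qed simp
  then show ?thesis by simp
qed

lemma mds_compensate:
  assumes "\<And>n. meas (Suc n) (Z n)"
  shows "mds (\<lambda>n \<omega>. Z n \<omega> - ce n (Z n) \<omega>)"
  unfolding mds_def
proof (intro allI conjI ballI)
  fix n \<omega>
  show "meas (Suc n) (\<lambda>\<omega>. Z n \<omega> - ce n (Z n) \<omega>)"
    by (intro meas_comp2[where f = "(-)"] assms meas_mono[OF meas_ce, of n "Suc n"]) simp
  show "(\<Sum>\<omega>'\<in>cell n \<omega>. P \<omega>' *\<^sub>R (Z n \<omega>' - ce n (Z n) \<omega>')) = 0"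
    unfolding scaleR_diff_right sum_subtractf sum_cell_ce by simp
qed

text \<open>\<open>Z\<close> collects the jumps exceeding twice the running maximum. Their absolute
  sum is dominated by the maximal function, and by \<open>dual_doob\<close> so is, in p-th moment,
  the sum of their compensators, whatever the signs \<open>\<epsilon>\<close>. The remaining
  martingale \<open>A\<close> has jumps of norm at most \<open>4 * J n\<close>, so
  \<open>predictable_jumps_bound\<close> applies to it. In \<open>K\<close>, \<open>4 powr p\<close>
  comes from \<open>s \<le> 4 * H\<close> and \<open>2 * (2 * p) powr p\<close> from
  \<open>dual_doob\<close>.\<close>

lemma maximal_transform_bound:
  fixes D :: "nat \<Rightarrow> 'c \<Rightarrow> 'x::real_normed_vector"
  assumes umd: "\<And>D :: nat \<Rightarrow> 'c \<Rightarrow> 'x. mds D \<Longrightarrow>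
      E (\<lambda>\<omega>. norm (\<Sum>k<N. \<epsilon> k *\<^sub>R D k \<omega>) powr q) \<le> B * E (\<lambda>\<omega>. norm (\<Sum>k<N. D k \<omega>) powr q)"
    and q: "1 \<le> q" and B: "0 \<le> B" and p: "1 \<le> p"
    and \<epsilon>: "\<And>k. \<epsilon> k \<in> {-1, 1}"
    and \<delta>: "0 < \<delta>" "\<delta> \<le> 1/2" "2 powr p * (B * (6 * \<delta>) powr q) \<le> 1/2"
    and D: "mds D"
    and K: "K = 2 powr p * (1 + 2 * (2 * p) powr p) * 4 powr p"
  shows "E (\<lambda>\<omega>. max_norm (\<lambda>n. \<Sum>k<n. \<epsilon> k *\<^sub>R D k \<omega>) N powr p) \<le>
    2 powr p * (2 * (2 / \<delta>) powr p * (2 powr p * (8 powr p + K)) + K) *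
    E (\<lambda>\<omega>. max_norm (\<lambda>n. \<Sum>k<n. D k \<omega>) N powr p)"
proof -
  define J where "J n \<omega> = max_jump (\<lambda>k. D k \<omega>) n" for n \<omega>
  define Z where "Z n \<omega> = (if 2 * J n \<omega> < norm (D n \<omega>) then D n \<omega> else 0)" for n \<omega>
  define A where "A n \<omega> = D n \<omega> - (Z n \<omega> - ce n (Z n) \<omega>)" for n \<omega>
  have J_meas: "meas n (J n)" for n unfolding J_def by (rule max_jump_meas[OF D])
  have J0: "0 \<le> J n \<omega>" for n \<omega> unfolding J_def by (rule max_jump_nonneg)
  have D_meas: "meas (Suc n) (D n)" for n using D unfolding mds_def by blast
  have Z_meas: "meas (Suc n) (Z n)" for n
    unfolding Z_def
    by (rule meas_comp2[where f = "\<lambda>a b. if 2 * a < norm b then b else 0"])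
      (rule meas_mono[OF J_meas], simp, rule D_meas)
  have comp: "mds (\<lambda>n \<omega>. Z n \<omega> - ce n (Z n) \<omega>)" by (rule mds_compensate) (rule Z_meas)
  have A: "mds A"
    unfolding mds_def
  proof (intro allI conjI ballI)
    fix n \<omega> assume w: "\<omega> \<in> \<Omega>"
    show "(\<Sum>\<omega>'\<in>cell n \<omega>. P \<omega>' *\<^sub>R A n \<omega>') = 0"
      unfolding A_def scaleR_diff_right[of _ "D n _"] sum_subtractf
      using D comp w unfolding mds_def by simp
  next
    fix n show "meas (Suc n) (A n)"
      unfolding A_def by (rule meas_comp2[where f = "(-)"])
        (rule D_meas, rule mds_meas[OF comp], simp)
  qed
  have A_le: "norm (A n \<omega>) \<le> 4 * J n \<omega>" if w: "\<omega> \<in> \<Omega>" for n \<omega>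
  proof -
    \<comment> \<open>Since \<open>D n\<close> is centred, the compensator of its large part is
      minus that of the small part \<open>Y\<close>, and \<open>Y\<close> is bounded by a quantity
      known at time \<open>n\<close>.\<close>
    define Y where "Y \<omega> = D n \<omega> - Z n \<omega>" for \<omega>
    have Y: "norm (Y \<omega>) \<le> 2 * J n \<omega>" for \<omega> unfolding Y_def Z_def using J0[of n \<omega>] by auto
    have "(\<Sum>\<omega>'\<in>cell n \<omega>. P \<omega>' *\<^sub>R Y \<omega>') = - (\<Sum>\<omega>'\<in>cell n \<omega>. P \<omega>' *\<^sub>R Z n \<omega>')"
      unfolding Y_def scaleR_diff_right sum_subtractf using D w unfolding mds_def by simp
    then have "ce n (Z n) \<omega> = - ce n Y \<omega>" unfolding ce_def by simp
    then have "A n \<omega> = Y \<omega> - ce n Y \<omega>" unfolding A_def Y_def by simp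
    then have "norm (A n \<omega>) \<le> norm (Y \<omega>) + norm (ce n Y \<omega>)" by (simp add: norm_triangle_ineq4)
    also have "norm (ce n Y \<omega>) \<le> 2 * J n \<omega>"
    proof (rule order_trans[OF norm_ce_le ce_le])
      fix \<omega>' assume "\<omega>' \<in> cell n \<omega>"
      then have "J n \<omega>' = J n \<omega>" using measD[OF J_meas _ w] unfolding cell_def by blast
      then show "norm (Y \<omega>') \<le> 2 * J n \<omega>" using Y[of \<omega>'] by simp
    qed (simp add: J0)
    finally show ?thesis using Y[of \<omega>] by simp
  qed
  define s where "s \<omega> = (\<Sum>k<N. norm (Z k \<omega>))" for \<omega>
  define v where "v \<omega> = (\<Sum>k<N. ce k (\<lambda>\<omega>. norm (Z k \<omega>)) \<omega>)" for \<omega>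
  have s0: "0 \<le> s \<omega>" and v0: "0 \<le> v \<omega>" for \<omega>
    unfolding s_def v_def by (intro sum_nonneg ce_nonneg norm_ge_zero)+
  define H where "H \<omega> = max_norm (\<lambda>n. \<Sum>k<n. D k \<omega>) N" for \<omega>
  have H0: "0 \<le> H \<omega>" for \<omega> unfolding H_def by (rule max_norm_nonneg)
  have JH: "J N \<omega> \<le> 2 * H \<omega>" for \<omega> unfolding J_def H_def by (rule max_jump_le_max_norm)
  have sH: "s \<omega> \<le> 4 * H \<omega>" for \<omega>
  proof -
    have "s \<omega> \<le> 2 * J N \<omega>" unfolding s_def Z_def J_def by (rule sum_large_jumps)
    then show ?thesis using JH[of \<omega>] by simp
  qed
  have bK: "E (\<lambda>\<omega>. (s \<omega> + v \<omega>) powr p) \<le> K * E (\<lambda>\<omega>. H \<omega> powr p)"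
  proof -
    have "E (\<lambda>\<omega>. (s \<omega> + v \<omega>) powr p) \<le> E (\<lambda>\<omega>. 2 powr p * (s \<omega> powr p + v \<omega> powr p))"
      by (intro E_mono powr_add_le s0 v0 p)
    also have "\<dots> = 2 powr p * (E (\<lambda>\<omega>. s \<omega> powr p) + E (\<lambda>\<omega>. v \<omega> powr p))"
      by (simp only: E_add E_cmult)
    also have "\<dots> \<le> 2 powr p * (E (\<lambda>\<omega>. s \<omega> powr p) + 2 * (2 * p) powr p * E (\<lambda>\<omega>. s \<omega> powr p))"
      unfolding s_def v_def by (intro mult_left_mono add_left_mono dual_doob p) auto
    also have "\<dots> = 2 powr p * (1 + 2 * (2 * p) powr p) * E (\<lambda>\<omega>. s \<omega> powr p)"
      by (simp add: algebra_simps)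
    also have "E (\<lambda>\<omega>. s \<omega> powr p) \<le> E (\<lambda>\<omega>. 4 powr p * H \<omega> powr p)"
    proof (rule E_mono)
      fix \<omega> have "s \<omega> powr p \<le> (4 * H \<omega>) powr p" using p by (intro powr_mono2 s0 sH) auto
      also have "\<dots> = 4 powr p * H \<omega> powr p" by (rule powr_mult)
      finally show "s \<omega> powr p \<le> 4 powr p * H \<omega> powr p" .
    qed
    finally show ?thesis unfolding K E_cmult by (simp add: mult_left_mono mult.assoc)
  qed
  have bound: "norm (\<Sum>k<n. r k *\<^sub>R (Z k \<omega> - ce k (Z k) \<omega>)) \<le> s \<omega> + v \<omega>"
    if n: "n \<le> N" and r: "\<And>k. r k \<in> {-1, 1}" for n \<omega> and r :: "nat \<Rightarrow> real"
  proof -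
    have "norm (\<Sum>k<n. r k *\<^sub>R (Z k \<omega> - ce k (Z k) \<omega>)) \<le>
        (\<Sum>k<n. norm (Z k \<omega>) + ce k (\<lambda>\<omega>. norm (Z k \<omega>)) \<omega>)"
    proof (rule sum_norm_le)
      fix k
      have "norm (r k *\<^sub>R (Z k \<omega> - ce k (Z k) \<omega>)) = norm (Z k \<omega> - ce k (Z k) \<omega>)" using r[of k] by auto
      also have "\<dots> \<le> norm (Z k \<omega>) + norm (ce k (Z k) \<omega>)" by (rule norm_triangle_ineq4)
      finally show "norm (r k *\<^sub>R (Z k \<omega> - ce k (Z k) \<omega>)) \<le>
          norm (Z k \<omega>) + ce k (\<lambda>\<omega>. norm (Z k \<omega>)) \<omega>" using norm_ce_le[of k "Z k" \<omega>] by simp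
    qed
    also have "\<dots> \<le> (\<Sum>k<N. norm (Z k \<omega>) + ce k (\<lambda>\<omega>. norm (Z k \<omega>)) \<omega>)"
      using n by (intro sum_mono2) (auto intro!: add_nonneg_nonneg ce_nonneg)
    finally show ?thesis unfolding s_def v_def by (simp add: sum.distrib)
  qed
  \<comment> \<open>\<open>\<psi>\<close> has to dominate both the jump bounds
    \<open>4 * J n\<close>, which are at most \<open>8 * H\<close>, and the partial sums of
    \<open>A\<close>, which differ from those of \<open>D\<close> by at most
    \<open>s + v\<close>.\<close>
  define \<psi> where "\<psi> \<omega> = 8 * H \<omega> + (s \<omega> + v \<omega>)" for \<omega>
  have psi1: "4 * J n \<omega> \<le> \<psi> \<omega>" if "n < N" for n \<omega>
  proof -
    have "J n \<omega> \<le> J N \<omega>" unfolding J_def using that by (intro max_jump_mono) simp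
    then show ?thesis unfolding \<psi>_def using JH[of \<omega>] s0[of \<omega>] v0[of \<omega>] by simp
  qed
  have psi2: "max_norm (\<lambda>n. \<Sum>k<n. A k \<omega>) N \<le> \<psi> \<omega>" for \<omega>
  proof -
    have "max_norm (\<lambda>n. \<Sum>k<n. A k \<omega>) N \<le> H \<omega> + (s \<omega> + v \<omega>)"
      unfolding H_def
    proof (rule max_norm_add_le)
      fix n assume n: "n \<le> N"
      show "(\<Sum>k<n. A k \<omega>) = (\<Sum>k<n. D k \<omega>) + (\<Sum>k<n. (- 1) *\<^sub>R (Z k \<omega> - ce k (Z k) \<omega>))"
        unfolding A_def by (simp add: sum_subtractf)
      show "norm (\<Sum>k<n. (- 1) *\<^sub>R (Z k \<omega> - ce k (Z k) \<omega>)) \<le> s \<omega> + v \<omega>"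
        by (rule bound[OF n]) simp
    qed
    then show ?thesis unfolding \<psi>_def using H0[of \<omega>] by simp
  qed
  define F where "F \<omega> = max_norm (\<lambda>n. \<Sum>k<n. \<epsilon> k *\<^sub>R A k \<omega>) N" for \<omega>
  have F0: "0 \<le> F \<omega>" for \<omega> unfolding F_def by (rule max_norm_nonneg)
  have FA: "E (\<lambda>\<omega>. F \<omega> powr p) \<le> 2 * (2 / \<delta>) powr p * E (\<lambda>\<omega>. \<psi> \<omega> powr p)"
    unfolding F_def
    by (rule predictable_jumps_bound[OF umd q B p \<epsilon> A meas_comp[OF J_meas] A_le psi1 psi2 \<delta>])
  have "E (\<lambda>\<omega>. \<psi> \<omega> powr p) \<le> E (\<lambda>\<omega>. 2 powr p * (8 powr p * H \<omega> powr p + (s \<omega> + v \<omega>) powr p))"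
  proof (rule E_mono)
    fix \<omega>
    have "\<psi> \<omega> powr p \<le> 2 powr p * ((8 * H \<omega>) powr p + (s \<omega> + v \<omega>) powr p)"
      unfolding \<psi>_def using H0[of \<omega>] s0[of \<omega>] v0[of \<omega>] by (intro powr_add_le p) auto
    also have "(8 * H \<omega>) powr p = 8 powr p * H \<omega> powr p" by (rule powr_mult)
    finally show "\<psi> \<omega> powr p \<le> 2 powr p * (8 powr p * H \<omega> powr p + (s \<omega> + v \<omega>) powr p)" .
  qed
  also have "\<dots> = 2 powr p * (8 powr p * E (\<lambda>\<omega>. H \<omega> powr p) + E (\<lambda>\<omega>. (s \<omega> + v \<omega>) powr p))"
    by (simp only: E_add E_cmult)
  also have "\<dots> \<le> 2 powr p * (8 powr p * E (\<lambda>\<omega>. H \<omega> powr p) + K * E (\<lambda>\<omega>. H \<omega> powr p))"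
    by (intro mult_left_mono add_left_mono bK) auto
  also have "\<dots> = 2 powr p * (8 powr p + K) * E (\<lambda>\<omega>. H \<omega> powr p)" by (simp add: algebra_simps)
  finally have psiH: "E (\<lambda>\<omega>. \<psi> \<omega> powr p) \<le> 2 powr p * (8 powr p + K) * E (\<lambda>\<omega>. H \<omega> powr p)" .
  have "E (\<lambda>\<omega>. max_norm (\<lambda>n. \<Sum>k<n. \<epsilon> k *\<^sub>R D k \<omega>) N powr p) \<le>
      E (\<lambda>\<omega>. 2 powr p * (F \<omega> powr p + (s \<omega> + v \<omega>) powr p))"
  proof (rule E_mono)
    fix \<omega>
    have "max_norm (\<lambda>n. \<Sum>k<n. \<epsilon> k *\<^sub>R D k \<omega>) N \<le> F \<omega> + (s \<omega> + v \<omega>)"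
      unfolding F_def
    proof (rule max_norm_add_le)
      fix n assume n: "n \<le> N"
      show "(\<Sum>k<n. \<epsilon> k *\<^sub>R D k \<omega>) =
          (\<Sum>k<n. \<epsilon> k *\<^sub>R A k \<omega>) + (\<Sum>k<n. \<epsilon> k *\<^sub>R (Z k \<omega> - ce k (Z k) \<omega>))"
        unfolding A_def by (simp add: sum.distrib[symmetric] scaleR_add_right[symmetric])
    qed (rule bound[OF _ \<epsilon>])
    then have "max_norm (\<lambda>n. \<Sum>k<n. \<epsilon> k *\<^sub>R D k \<omega>) N powr p \<le> (F \<omega> + (s \<omega> + v \<omega>)) powr p"
      using p by (intro powr_mono2 max_norm_nonneg) auto
    also have "\<dots> \<le> 2 powr p * (F \<omega> powr p + (s \<omega> + v \<omega>) powr p)"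
      using s0[of \<omega>] v0[of \<omega>] by (intro powr_add_le p F0) auto
    finally show "max_norm (\<lambda>n. \<Sum>k<n. \<epsilon> k *\<^sub>R D k \<omega>) N powr p \<le>
      2 powr p * (F \<omega> powr p + (s \<omega> + v \<omega>) powr p)" .
  qed
  also have "\<dots> = 2 powr p * (E (\<lambda>\<omega>. F \<omega> powr p) + E (\<lambda>\<omega>. (s \<omega> + v \<omega>) powr p))"
    by (simp only: E_add E_cmult)
  also have "\<dots> \<le> 2 powr p * (2 * (2 / \<delta>) powr p *
      (2 powr p * (8 powr p + K) * E (\<lambda>\<omega>. H \<omega> powr p)) + K * E (\<lambda>\<omega>. H \<omega> powr p))"
    using \<delta> by (intro mult_left_mono add_mono order_trans[OF FA] bK psiH) auto
  finally show ?thesis unfolding H_def by (simp add: algebra_simps)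
qed

end

section \<open>Finite models on the real line\<close>

text \<open>The points of \<open>\<Omega>\<close> are numbered, and the numbers are viewed as reals.
  Reals that encode no point are decoded to a fixed \<open>\<omega>0\<close>, so that
  \<open>dec\<close> maps into \<open>\<Omega>\<close> everywhere; they carry no mass.\<close>

lemma finite_weights_real_model:
  fixes P :: "'c \<Rightarrow> real"
  assumes fin: "finite \<Omega>" and nn: "\<And>\<omega>. \<omega> \<in> \<Omega> \<Longrightarrow> 0 \<le> P \<omega>" and one: "sum P \<Omega> = 1"
  obtains Q :: "real pmf" and dec :: "real \<Rightarrow> 'c"
  where "\<And>r. dec r \<in> \<Omega>"
    "\<And>g. (\<integral>r. (g (dec r) :: real) \<partial>measure_pmf Q) = (\<Sum>\<omega>\<in>\<Omega>. P \<omega> * g \<omega>)"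
proof -
  obtain j :: "'c \<Rightarrow> nat" where j: "inj_on j \<Omega>"
    using finite_imp_inj_to_nat_seg[OF fin] by blast
  define j' where "j' \<omega> = real (j \<omega>)" for \<omega>
  have j': "inj_on j' \<Omega>" using j unfolding j'_def inj_on_def by auto
  define P' where "P' \<omega> = (if \<omega> \<in> \<Omega> then P \<omega> else 0)" for \<omega>
  have P'0: "0 \<le> P' \<omega>" for \<omega> using nn unfolding P'_def by simp
  have "(\<integral>\<^sup>+\<omega>. ennreal (P' \<omega>) \<partial>count_space UNIV) = (\<Sum>\<omega>\<in>\<Omega>. ennreal (P' \<omega>))"
    by (rule nn_integral_count_space'[OF fin]) (auto simp: P'_def)
  also have "\<dots> = ennreal (\<Sum>\<omega>\<in>\<Omega>. P' \<omega>)" by (rule sum_ennreal) (rule P'0)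
  also have "(\<Sum>\<omega>\<in>\<Omega>. P' \<omega>) = 1" using one unfolding P'_def by simp
  finally have total: "(\<integral>\<^sup>+\<omega>. ennreal (P' \<omega>) \<partial>count_space UNIV) = 1" by simp
  define R where "R = embed_pmf P'"
  have pmf_R: "pmf R \<omega> = P' \<omega>" for \<omega>
    unfolding R_def by (rule pmf_embed_pmf[OF P'0 total])
  have set_R: "set_pmf R \<subseteq> \<Omega>" unfolding set_pmf_eq pmf_R P'_def by auto
  obtain \<omega>0 where w0: "\<omega>0 \<in> \<Omega>" using one by fastforce
  define dec where "dec r = (if r \<in> j' ` \<Omega> then inv_into \<Omega> j' r else \<omega>0)" for r
  have dec_j: "dec (j' \<omega>) = \<omega>" if "\<omega> \<in> \<Omega>" for \<omega>
    unfolding dec_def using that j' by simp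
  show thesis
  proof (rule that[of dec "map_pmf j' R"])
    show "dec r \<in> \<Omega>" for r unfolding dec_def using w0 by (auto intro: inv_into_into)
    fix g :: "'c \<Rightarrow> real"
    have "(\<integral>r. g (dec r) \<partial>measure_pmf (map_pmf j' R)) = (\<integral>\<omega>. g (dec (j' \<omega>)) \<partial>measure_pmf R)"
      by simp
    also have "\<dots> = (\<Sum>\<omega>\<in>\<Omega>. g (dec (j' \<omega>)) * pmf R \<omega>)"
      using set_R fin by (intro integral_measure_pmf_real) auto
    also have "\<dots> = (\<Sum>\<omega>\<in>\<Omega>. P \<omega> * g \<omega>)"
      by (intro sum.cong) (auto simp: pmf_R P'_def dec_j)
    finally show "(\<integral>r. g (dec r) \<partial>measure_pmf (map_pmf j' R)) = (\<Sum>\<omega>\<in>\<Omega>. P \<omega> * g \<omega>)" .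
  qed
qed

definition level_algebra :: "('a \<Rightarrow> 'h) \<Rightarrow> 'a measure" where
  "level_algebra f = vimage_algebra UNIV f (count_space UNIV)"

lemma space_level_algebra [simp]: "space (level_algebra f) = UNIV"
  unfolding level_algebra_def by simp

lemma sets_level_algebra: "sets (level_algebra f) = {f -` A | A. True}"
  unfolding level_algebra_def by (subst sets_vimage_algebra2) auto

lemma simple_function_level_algebra:
  assumes "finite (range g)" "\<And>r r'. f r = f r' \<Longrightarrow> g r = g r'"
  shows "simple_function (level_algebra f) g"
  unfolding simple_function_def
proof (intro conjI ballI)
  fix x
  have "g -` {x} = f -` (f ` (g -` {x}))" using assms(2) by blast
  then show "g -` {x} \<inter> space (level_algebra f) \<in> sets (level_algebra f)"
    unfolding sets_level_algebra by auto
qed (simp add: assms(1))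

lemma simple_function_strongly_measurable: "simple_function M g \<Longrightarrow> strongly_measurable M g"
  unfolding strongly_measurable_def by (intro exI[of _ "\<lambda>_. g"]) auto

lemma subalgebra_level_algebra: "subalgebra (measure_pmf Q) (level_algebra f)"
  unfolding subalgebra_def by simp

text \<open>Every set is measurable for \<open>measure_pmf\<close>, which makes the measure
  complete. The information at time \<open>n\<close> is therefore prescribed freely by the map
  \<open>f n\<close>.\<close>

lemma stochastic_basis_level_algebra:
  fixes f :: "nat \<Rightarrow> 'a \<Rightarrow> 'h"
  assumes "\<And>n r r'. f (Suc n) r = f (Suc n) r' \<Longrightarrow> f n r = f n r'"
  shows "stochastic_basis (measure_pmf Q) (\<lambda>n. level_algebra (f n))"
  unfolding stochastic_basis_def
proof (intro conjI allI)
  show "prob_space (measure_pmf Q)" by (rule measure_pmf.prob_space_axioms)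
  show "complete_measure (measure_pmf Q)" by standard simp
  have refine: "f m r = f m r'" if "m \<le> n" "f n r = f n r'" for m n r r'
    using that
  proof (induction n rule: dec_induct)
    case (step n)
    show ?case by (rule step.IH, rule assms, rule step.prems)
  qed
  show "filtration (space (measure_pmf Q)) (\<lambda>n. level_algebra (f n))"
    unfolding filtration_def
  proof (intro conjI allI impI)
    fix m n :: nat assume mn: "m \<le> n"
    show "sets (level_algebra (f m)) \<subseteq> sets (level_algebra (f n))"
    proof
      fix A assume "A \<in> sets (level_algebra (f m))"
      then obtain B where A: "A = f m -` B" unfolding sets_level_algebra by auto
      have "A = f n -` (f n ` A)"
      proof (intro equalityI subsetI)
        fix r assume "r \<in> f n -` (f n ` A)"
        then obtain r' where "f n r = f n r'" "r' \<in> A" by auto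
        then show "r \<in> A" using refine[OF mn, of r r'] unfolding A by simp
      qed auto
      then show "A \<in> sets (level_algebra (f n))" unfolding sets_level_algebra by blast
    qed
  qed simp
qed (rule subalgebra_level_algebra)

text \<open>A function that factors through \<open>dec\<close> has finite range and serves as its
  own approximating sequence; its simple integral is evaluated by grouping the points of
  \<open>\<Omega>\<close> by the value of \<open>g\<close>.\<close>

lemma has_strong_integral_real_model:
  fixes g :: "'c \<Rightarrow> 'x::banach" and Q :: "real pmf"
  assumes fin: "finite \<Omega>" and dec: "\<And>r. dec r \<in> \<Omega>"
    and int: "\<And>g. (\<integral>r. (g (dec r) :: real) \<partial>measure_pmf Q) = (\<Sum>\<omega>\<in>\<Omega>. P \<omega> * g \<omega>)"
  shows "has_strong_integral (measure_pmf Q) (\<lambda>r. g (dec r)) (\<Sum>\<omega>\<in>\<Omega>. P \<omega> *\<^sub>R g \<omega>)"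
proof -
  let ?M = "measure_pmf Q" and ?f = "\<lambda>r. g (dec r)"
  have sub: "range ?f \<subseteq> g ` \<Omega>" using dec by auto
  have sf: "simple_function ?M ?f"
    unfolding simple_function_def using finite_subset[OF sub] fin by auto
  have sbi: "Bochner_Integration.simple_bochner_integrable ?M ?f"
    using sf by (auto simp: Bochner_Integration.simple_bochner_integrable.simps)
  have meas: "measure ?M {r\<in>space ?M. ?f r = y} = (\<Sum>\<omega>\<in>{\<omega>\<in>\<Omega>. g \<omega> = y}. P \<omega>)" for y
  proof -
    have "measure ?M {r\<in>space ?M. ?f r = y} = (\<integral>r. of_bool (g (dec r) = y) \<partial>?M)"
    proof -
      have "(\<lambda>r. of_bool (g (dec r) = y)) = (indicator {r\<in>space ?M. ?f r = y} :: real \<Rightarrow> real)"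
        by (auto simp: indicator_def)
      then show ?thesis by simp
    qed
    also have "\<dots> = (\<Sum>\<omega>\<in>\<Omega>. P \<omega> * of_bool (g \<omega> = y))" by (rule int)
    also have "\<dots> = (\<Sum>\<omega>\<in>{\<omega>\<in>\<Omega>. g \<omega> = y}. P \<omega>)"
      using fin by (intro sum.mono_neutral_cong_right) auto
    finally show ?thesis .
  qed
  have "Bochner_Integration.simple_bochner_integral ?M ?f = (\<Sum>y\<in>range ?f. measure ?M {r\<in>space ?M. ?f r = y} *\<^sub>R y)"
    unfolding Bochner_Integration.simple_bochner_integral_def by simp
  also have "\<dots> = (\<Sum>y\<in>g ` \<Omega>. measure ?M {r\<in>space ?M. ?f r = y} *\<^sub>R y)"
  proof (rule sum.mono_neutral_left)
    show "\<forall>y\<in>g ` \<Omega> - range ?f. measure ?M {r\<in>space ?M. ?f r = y} *\<^sub>R y = 0"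
    proof
      fix y assume "y \<in> g ` \<Omega> - range ?f"
      then have "\<And>r. ?f r \<noteq> y" by blast
      then have "{r\<in>space ?M. ?f r = y} = {}" by blast
      then show "measure ?M {r\<in>space ?M. ?f r = y} *\<^sub>R y = 0" by (metis measure_empty scaleR_zero_left)
    qed
  qed (use fin sub in auto)
  also have "\<dots> = (\<Sum>y\<in>g ` \<Omega>. \<Sum>\<omega>\<in>{\<omega>\<in>\<Omega>. g \<omega> = y}. P \<omega> *\<^sub>R g \<omega>)"
    unfolding meas scaleR_sum_left by (intro sum.cong) auto
  also have "\<dots> = (\<Sum>\<omega>\<in>\<Omega>. P \<omega> *\<^sub>R g \<omega>)"
    using fin by (intro sum.group) auto
  finally have eq: "Bochner_Integration.simple_bochner_integral ?M ?f = (\<Sum>\<omega>\<in>\<Omega>. P \<omega> *\<^sub>R g \<omega>)" .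
  show ?thesis
    unfolding has_strong_integral_def
    by (intro conjI simple_function_strongly_measurable sf exI[of _ "\<lambda>_. ?f"])
      (use sbi eq in simp_all)
qed

lemma integrable_real_model:
  fixes g :: "'c \<Rightarrow> real"
  assumes "finite \<Omega>" "\<And>r. dec r \<in> \<Omega>"
  shows "integrable (measure_pmf Q) (\<lambda>r. g (dec r))"
proof -
  have "bounded (range (\<lambda>r. g (dec r)))"
    by (rule finite_imp_bounded, rule finite_subset[of _ "g ` \<Omega>"]) (use assms in auto)
  then obtain K where "\<And>r. norm (g (dec r)) \<le> K"
    unfolding bounded_iff by blast
  then show ?thesis
    by (intro measure_pmf.integrable_const_bound[of _ K]) auto
qed

lemma Lp_norm_real_model:
  assumes int: "\<And>g. (\<integral>r. (g (dec r) :: real) \<partial>measure_pmf Q) = (\<Sum>\<omega>\<in>\<Omega>. P \<omega> * g \<omega>)"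
  shows "Lp_norm (measure_pmf Q) p (\<lambda>r. g (dec r)) = (\<Sum>\<omega>\<in>\<Omega>. P \<omega> * norm (g \<omega>) powr p) powr (1 / p)"
  unfolding Lp_norm_def using int[of "\<lambda>\<omega>. norm (g \<omega>) powr p"] by simp

lemma root_root_powr: "0 \<le> a \<Longrightarrow> 1 \<le> p \<Longrightarrow> (a powr (1 / p)) powr p = (a::real)"
  by (simp add: powr_powr)

lemma le_powr_of_root_le:
  fixes a b C p :: real
  assumes "0 \<le> a" "0 \<le> b" "0 \<le> C" "1 \<le> p" "a powr (1 / p) \<le> C * b powr (1 / p)"
  shows "a \<le> C powr p * b"
proof -
  have "(a powr (1 / p)) powr p \<le> (C * b powr (1 / p)) powr p"
    using assms by (intro powr_mono2) auto
  then show ?thesis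
    using assms root_root_powr[of a p] root_root_powr[of b p] by (simp add: powr_mult)
qed

context finite_filtration
begin

text \<open>The index is shifted because \<open>martingale_difference\<close> counts from
  \<open>1\<close> and \<open>mds\<close> from \<open>0\<close>. A set of time \<open>n\<close> is a
  union of cells, so centring on cells makes the integrals over it vanish.\<close>

lemma martingale_difference_real_model:
  fixes D :: "nat \<Rightarrow> 'c \<Rightarrow> 'x::banach" and Q :: "real pmf"
  assumes D: "mds D" and dec: "\<And>r. dec r \<in> \<Omega>"
    and int: "\<And>g. (\<integral>r. (g (dec r) :: real) \<partial>measure_pmf Q) = (\<Sum>\<omega>\<in>\<Omega>. P \<omega> * g \<omega>)"
  shows "martingale_difference (measure_pmf Q) (\<lambda>n. level_algebra (\<lambda>r. \<pi> n (dec r)))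
    (\<lambda>n r. D (n - 1) (dec r))"
proof -
  let ?M = "measure_pmf Q" and ?F = "\<lambda>n. level_algebra (\<lambda>r. \<pi> n (dec r))"
  note hsi = has_strong_integral_real_model[OF finite_space dec int]
  have fin: "finite (range (\<lambda>r. g (dec r)))" for g :: "'c \<Rightarrow> 'x"
    by (rule finite_subset[of _ "g ` \<Omega>"]) (use dec finite_space in auto)
  have "strongly_measurable (?F n) (\<lambda>r. D (n - 1) (dec r))" if "1 \<le> n" for n
    by (intro simple_function_strongly_measurable simple_function_level_algebra fin
        measD[OF mds_meas[OF D]] dec) (use that in auto)
  moreover have "strongly_integrable ?M (\<lambda>r. g (dec r))" for g :: "'c \<Rightarrow> 'x"
    using hsi[of g] unfolding strongly_integrable_def by blast
  moreover have "is_cond_exp ?M (?F n) (\<lambda>r. D n (dec r)) (\<lambda>r. 0)" for n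
    unfolding is_cond_exp_def
  proof (intro conjI ballI exI)
    show "strongly_integrable ?M (\<lambda>r. D n (dec r))" "strongly_integrable ?M (\<lambda>r. 0 :: 'x)"
      using hsi[of "D n"] hsi[of "\<lambda>_. 0"] unfolding strongly_integrable_def by blast+
    show "strongly_measurable (?F n) (\<lambda>r. 0 :: 'x)"
      by (intro simple_function_strongly_measurable) simp
    fix A assume "A \<in> sets (?F n)"
    then obtain B where A: "A = (\<lambda>r. \<pi> n (dec r)) -` B" unfolding sets_level_algebra by auto
    have "(\<Sum>\<omega>\<in>\<Omega>. P \<omega> *\<^sub>R indicator B (\<pi> n \<omega>) *\<^sub>R D n \<omega>) = (\<Sum>\<omega>\<in>\<Omega>. 0)"
    proof (rule sum_cells_eqI[where n = n])
      fix \<omega> assume w: "\<omega> \<in> \<Omega>"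
      have "(\<Sum>\<omega>'\<in>cell n \<omega>. P \<omega>' *\<^sub>R indicator B (\<pi> n \<omega>') *\<^sub>R D n \<omega>') =
          indicator B (\<pi> n \<omega>) *\<^sub>R (\<Sum>\<omega>'\<in>cell n \<omega>. P \<omega>' *\<^sub>R D n \<omega>')"
        unfolding scaleR_sum_right by (intro sum.cong) (auto simp: cell_def)
      then show "(\<Sum>\<omega>'\<in>cell n \<omega>. P \<omega>' *\<^sub>R indicator B (\<pi> n \<omega>') *\<^sub>R D n \<omega>') = (\<Sum>\<omega>'\<in>cell n \<omega>. 0)"
        using D w unfolding mds_def by simp
    qed
    moreover have "(\<lambda>r. indicator A r *\<^sub>R D n (dec r)) = (\<lambda>r. indicator B (\<pi> n (dec r)) *\<^sub>R D n (dec r))"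
      unfolding A by (auto simp: indicator_def)
    ultimately show "has_strong_integral ?M (\<lambda>r. indicator A r *\<^sub>R D n (dec r)) 0"
      using hsi[of "\<lambda>\<omega>. indicator B (\<pi> n \<omega>) *\<^sub>R D n \<omega>"] by simp
    show "has_strong_integral ?M (\<lambda>r. indicator A r *\<^sub>R 0) (0 :: 'x)"
      using hsi[of "\<lambda>_. 0"] by simp
  qed
  ultimately show ?thesis
    unfolding martingale_difference_def adapted_seq_def by auto
qed

text \<open>Here the UMD property enters, for the one exponent \<open>q\<close>: the finite space is
  modelled on the real line, and removing the \<open>q\<close>-th roots turns \<open>\<beta>\<close>
  into \<open>\<beta> powr q\<close>.\<close>

lemma umd_finite_filtration:
  fixes D :: "nat \<Rightarrow> 'c \<Rightarrow> 'x::banach"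
  assumes umd: "umd_bound TYPE(real) TYPE('x) q \<beta>" and q: "1 \<le> q" and \<beta>: "0 \<le> \<beta>"
    and \<epsilon>: "\<And>k. \<epsilon> k \<in> {-1, 1}" and D: "mds D"
  shows "E (\<lambda>\<omega>. norm (\<Sum>k<N. \<epsilon> k *\<^sub>R D k \<omega>) powr q) \<le> \<beta> powr q * E (\<lambda>\<omega>. norm (\<Sum>k<N. D k \<omega>) powr q)"
proof (cases "N = 0")
  case False
  obtain Q :: "real pmf" and dec where dec: "\<And>r. dec r \<in> \<Omega>"
    and int: "\<And>g. (\<integral>r. (g (dec r) :: real) \<partial>measure_pmf Q) = (\<Sum>\<omega>\<in>\<Omega>. P \<omega> * g \<omega>)"
    by (rule finite_weights_real_model[OF finite_space weight_nonneg weight_sum]) (assumption, rule that)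
  let ?d = "\<lambda>n r. D (n - 1) (dec r)"
  have basis: "stochastic_basis (measure_pmf Q) (\<lambda>n. level_algebra (\<lambda>r. \<pi> n (dec r)))"
    by (rule stochastic_basis_level_algebra) (rule refine[OF dec dec])
  have Lp: "bochner_Lp (measure_pmf Q) q (\<lambda>r. g (dec r))" for g :: "'c \<Rightarrow> 'x"
    unfolding bochner_Lp_def
  proof
    show "strongly_measurable (measure_pmf Q) (\<lambda>r. g (dec r))"
      using has_strong_integral_real_model[OF finite_space dec int, of g]
      unfolding has_strong_integral_def by blast
    show "integrable (measure_pmf Q) (\<lambda>r. norm (g (dec r)) powr q)"
      by (rule integrable_real_model[OF finite_space dec])
  qed
  have L: "Lp_norm (measure_pmf Q) q (\<lambda>r. g (dec r)) = E (\<lambda>\<omega>. norm (g \<omega>) powr q) powr (1 / q)"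
    for g :: "'c \<Rightarrow> 'x"
    unfolding E_def by (rule Lp_norm_real_model) (rule int)
  have "\<forall>n\<ge>1. bochner_Lp (measure_pmf Q) q (?d n)"
    by (intro allI impI Lp)
  moreover have "\<forall>n\<ge>1. \<epsilon> (n - 1) \<in> {-1, 1}" by (intro allI impI \<epsilon>)
  ultimately have "\<forall>N\<ge>1. Lp_norm (measure_pmf Q) q (\<lambda>x. \<Sum>n=1..N. \<epsilon> (n - 1) *\<^sub>R ?d n x) \<le>
      \<beta> * Lp_norm (measure_pmf Q) q (\<lambda>x. \<Sum>n=1..N. ?d n x)"
    by (rule umd[unfolded umd_bound_def, THEN spec, THEN spec, THEN spec, THEN spec,
        THEN mp, THEN mp, THEN mp, THEN mp, OF basis martingale_difference_real_model[OF D dec int]])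
  then have "Lp_norm (measure_pmf Q) q (\<lambda>x. \<Sum>n=1..N. \<epsilon> (n - 1) *\<^sub>R ?d n x) \<le>
      \<beta> * Lp_norm (measure_pmf Q) q (\<lambda>x. \<Sum>n=1..N. ?d n x)"
    using False by simp
  then have le: "E (\<lambda>\<omega>. norm (\<Sum>k<N. \<epsilon> k *\<^sub>R D k \<omega>) powr q) powr (1 / q) \<le>
      \<beta> * E (\<lambda>\<omega>. norm (\<Sum>k<N. D k \<omega>) powr q) powr (1 / q)"
    using L[of "\<lambda>\<omega>. \<Sum>k<N. \<epsilon> k *\<^sub>R D k \<omega>"] L[of "\<lambda>\<omega>. \<Sum>k<N. D k \<omega>"]
    by (simp add: sum.atLeast1_atMost_eq)
  show ?thesis
    by (rule le_powr_of_root_le[OF _ _ \<beta> q le]) (auto intro: E_nonneg)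
qed (simp add: E_def)

end

section \<open>Independent sums\<close>

text \<open>Convexity in the form of a tangent at \<open>a\<close>. Averaging it gives Jensen's
  inequality, for finite sums in \<open>sum_powr_jensen\<close> and conditionally in
  \<open>expectation_mean_le\<close>.\<close>

lemma powr_tangent_le:
  fixes a t p :: real
  assumes "0 \<le> a" "0 \<le> t" "1 \<le> p"
  shows "a powr p + p * a powr (p - 1) * (t - a) \<le> t powr p"
proof (cases "t \<le> a")
  case True
  then show ?thesis using powr_diff_le[of t a p] assms by (simp add: algebra_simps)
next
  case False
  show ?thesis
  proof (cases "a = 0")
    case True
    then show ?thesis by simp
  next
    case a: False
    then have at: "0 < a" "a < t" using assms False by auto
    have "\<exists>z. a < z \<and> z < t \<and> t powr p - a powr p = (t - a) * (p * z powr (p - 1))"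
      using at by (intro MVT2) (auto intro!: derivative_eq_intros)
    then obtain z where z: "a < z" "z < t" "t powr p - a powr p = (t - a) * (p * z powr (p - 1))"
      by auto
    have "a powr (p - 1) \<le> z powr (p - 1)" using z at assms by (intro powr_mono2) auto
    then have "(t - a) * (p * a powr (p - 1)) \<le> (t - a) * (p * z powr (p - 1))"
      using at assms by (intro mult_left_mono) auto
    then show ?thesis using z by (simp add: mult_ac)
  qed
qed

lemma sum_powr_jensen:
  fixes w f :: "'c \<Rightarrow> real"
  assumes "\<And>y. y \<in> A \<Longrightarrow> 0 \<le> w y" "\<And>y. y \<in> A \<Longrightarrow> 0 \<le> f y" "sum w A = 1" "1 \<le> p"
  shows "(\<Sum>y\<in>A. w y * f y) powr p \<le> (\<Sum>y\<in>A. w y * f y powr p)"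
proof -
  define a where "a = (\<Sum>y\<in>A. w y * f y)"
  have a: "0 \<le> a" unfolding a_def using assms by (intro sum_nonneg mult_nonneg_nonneg) auto
  have "(\<Sum>y\<in>A. w y * (a powr p + p * a powr (p - 1) * (f y - a))) \<le> (\<Sum>y\<in>A. w y * f y powr p)"
    using assms a by (intro sum_mono mult_left_mono powr_tangent_le) auto
  also have "(\<Sum>y\<in>A. w y * (a powr p + p * a powr (p - 1) * (f y - a))) =
      sum w A * a powr p + p * a powr (p - 1) * ((\<Sum>y\<in>A. w y * f y) - sum w A * a)"
    by (simp add: algebra_simps sum.distrib sum_subtractf sum_distrib_left sum_distrib_right)
  finally show ?thesis unfolding a_def using assms(3) by simp
qed

section \<open>Words with independent letters\<close>

definition words :: "'a set \<Rightarrow> nat \<Rightarrow> 'a list set" where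
  "words S n = {xs. set xs \<subseteq> S \<and> length xs = n}"

lemma finite_words [simp]: "finite S \<Longrightarrow> finite (words S n)"
  unfolding words_def by (rule finite_lists_length_eq)

lemma words_0 [simp]: "words S 0 = {[]}"
  unfolding words_def by auto

lemma length_words: "x \<in> words S n \<Longrightarrow> length x = n"
  unfolding words_def by simp

lemma nth_words: "x \<in> words S N \<Longrightarrow> n < N \<Longrightarrow> x ! n \<in> S"
  unfolding words_def by (auto simp: subset_iff)

lemma sum_words_Cons:
  fixes g :: "'a list \<Rightarrow> 'b::comm_monoid_add"
  shows "(\<Sum>x\<in>words S (Suc n). g x) = (\<Sum>a\<in>S. \<Sum>x\<in>words S n. g (a # x))"
proof -
  have "bij_betw (\<lambda>(a, x). a # x) (S \<times> words S n) (words S (Suc n))"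
    by (rule bij_betwI[where g = "\<lambda>x. (hd x, tl x)"]) (auto simp: words_def length_Suc_conv)
  then show ?thesis
    by (simp add: sum.reindex_bij_betw[symmetric] sum.cartesian_product case_prod_unfold)
qed

lemma sum_words_snoc:
  fixes g :: "'a list \<Rightarrow> 'b::comm_monoid_add"
  shows "(\<Sum>x\<in>words S (Suc n). g x) = (\<Sum>x\<in>words S n. \<Sum>a\<in>S. g (x @ [a]))"
proof -
  have "bij_betw (\<lambda>(x, a). x @ [a]) (words S n \<times> S) (words S (Suc n))"
    by (rule bij_betwI[where g = "\<lambda>x. (butlast x, last x)"])
      (auto simp: words_def length_Suc_conv_rev)
  then show ?thesis
    by (simp add: sum.reindex_bij_betw[symmetric] sum.cartesian_product case_prod_unfold)
qed

text \<open>The expectation of \<open>g\<close> over a random word whose letters are independent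
  with laws \<open>w 0\<close>, ..., \<open>w (N - 1)\<close>.\<close>

definition product_sum ::
    "'a set \<Rightarrow> nat \<Rightarrow> (nat \<Rightarrow> 'a \<Rightarrow> real) \<Rightarrow> ('a list \<Rightarrow> real) \<Rightarrow> real" where
  "product_sum S N w g = (\<Sum>y\<in>words S N. (\<Prod>k<N. w k (y ! k)) * g y)"

lemma product_sum_0 [simp]: "product_sum S 0 w g = g []"
  unfolding product_sum_def by simp

lemma product_sum_Suc:
  "product_sum S (Suc N) w g =
    (\<Sum>b\<in>S. w 0 b * product_sum S N (\<lambda>k. w (Suc k)) (\<lambda>y. g (b # y)))"
  unfolding product_sum_def sum_words_Cons
  by (simp only: prod.lessThan_Suc_shift) (simp add: sum_distrib_left mult_ac)

lemma product_sum_mono: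
  assumes "\<And>k a. a \<in> S \<Longrightarrow> 0 \<le> w k a" "\<And>y. y \<in> words S N \<Longrightarrow> f y \<le> g y"
  shows "product_sum S N w f \<le> product_sum S N w g"
  unfolding product_sum_def
  by (intro sum_mono mult_left_mono prod_nonneg assms) (auto intro: assms(1) nth_words)

lemma product_sum_add:
  "product_sum S N w (\<lambda>y. f y + g y) = product_sum S N w f + product_sum S N w g"
  unfolding product_sum_def by (simp add: algebra_simps sum.distrib)

lemma product_sum_cmult: "product_sum S N w (\<lambda>y. c * g y) = c * product_sum S N w g"
  unfolding product_sum_def by (simp add: sum_distrib_left mult_ac)

lemma product_sum_const:
  "(\<And>k. (\<Sum>a\<in>S. w k a) = 1) \<Longrightarrow> product_sum S N w (\<lambda>_. c) = c"
  by (induction N arbitrary: w) (simp_all add: product_sum_Suc sum_distrib_right[symmetric])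

text \<open>As \<open>u 0\<close> is centred, the tail is the average of the whole sum over the
  first letter, and averaging does not increase the expected norm.\<close>

lemma product_sum_tail_le:
  fixes u :: "nat \<Rightarrow> 'a \<Rightarrow> 'x::real_normed_vector"
  assumes w: "\<And>k a. a \<in> S \<Longrightarrow> 0 \<le> w k a" "\<And>k. (\<Sum>a\<in>S. w k a) = 1"
    and u: "\<And>k. (\<Sum>a\<in>S. w k a *\<^sub>R u k a) = 0"
  shows "product_sum S N (\<lambda>k. w (Suc k)) (\<lambda>y. norm (\<Sum>k<N. u (Suc k) (y ! k))) \<le>
    product_sum S (Suc N) w (\<lambda>y. norm (\<Sum>k<Suc N. u k (y ! k)))"
proof -
  let ?T = "\<lambda>y. \<Sum>k<N. u (Suc k) (y ! k)"
  have "product_sum S N (\<lambda>k. w (Suc k)) (\<lambda>y. norm (?T y)) \<le>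
      product_sum S N (\<lambda>k. w (Suc k)) (\<lambda>y. \<Sum>b\<in>S. w 0 b * norm (u 0 b + ?T y))"
  proof (rule product_sum_mono)
    fix y
    have "?T y = (\<Sum>b\<in>S. w 0 b *\<^sub>R (u 0 b + ?T y))"
      by (simp only: scaleR_add_right sum.distrib u scaleR_sum_left[symmetric] w) simp
    also have "norm \<dots> \<le> (\<Sum>b\<in>S. w 0 b * norm (u 0 b + ?T y))"
      by (rule sum_norm_le) (simp add: w)
    finally show "norm (?T y) \<le> (\<Sum>b\<in>S. w 0 b * norm (u 0 b + ?T y))" .
  qed (rule w)
  also have "\<dots> = (\<Sum>b\<in>S. w 0 b * product_sum S N (\<lambda>k. w (Suc k)) (\<lambda>y. norm (u 0 b + ?T y)))"
    unfolding product_sum_def sum_distrib_left by (subst sum.swap) (simp add: mult_ac)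
  also have "\<dots> = product_sum S (Suc N) w (\<lambda>y. norm (\<Sum>k<Suc N. u k (y ! k)))"
    unfolding product_sum_Suc by (simp add: sum.lessThan_Suc_shift del: sum.lessThan_Suc)
  finally show ?thesis .
qed

lemma product_sum_tails_le:
  fixes u :: "nat \<Rightarrow> 'a \<Rightarrow> 'x::real_normed_vector"
  assumes w: "\<And>k a. a \<in> S \<Longrightarrow> 0 \<le> w k a" "\<And>k. (\<Sum>a\<in>S. w k a) = 1"
    and u: "\<And>k. (\<Sum>a\<in>S. w k a *\<^sub>R u k a) = 0" and j: "j \<le> N"
  shows "product_sum S (N - j) (\<lambda>k. w (k + j)) (\<lambda>y. norm (\<Sum>k<N - j. u (k + j) (y ! k))) \<le>
    product_sum S N w (\<lambda>y. norm (\<Sum>k<N. u k (y ! k)))"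
  using j
proof (induction j)
  case (Suc j)
  have n: "N - j = Suc (N - Suc j)" using Suc.prems by simp
  have "product_sum S (N - Suc j) (\<lambda>k. w (k + Suc j)) (\<lambda>y. norm (\<Sum>k<N - Suc j. u (k + Suc j) (y ! k))) \<le>
      product_sum S (N - j) (\<lambda>k. w (k + j)) (\<lambda>y. norm (\<Sum>k<N - j. u (k + j) (y ! k)))"
    unfolding n using product_sum_tail_le[of S "\<lambda>k. w (k + j)" "\<lambda>k. u (k + j)" "N - Suc j"] w u by simp
  also have "\<dots> \<le> product_sum S N w (\<lambda>y. norm (\<Sum>k<N. u k (y ! k)))" using Suc by simp
  finally show ?case .
qed simp

text \<open>Markov's inequality at a level of at least twice the mean. At level \<open>0\<close> one
  cannot divide, but then the mean is \<open>0\<close> and \<open>f\<close> vanishes on all words of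
  positive weight.\<close>

lemma product_sum_markov:
  assumes w: "\<And>k a. a \<in> S \<Longrightarrow> 0 \<le> w k a" and S: "finite S"
    and f: "\<And>y. 0 \<le> f y" and le: "2 * product_sum S N w f \<le> \<alpha>"
  shows "product_sum S N w (\<lambda>y. of_bool (\<alpha> < f y)) \<le> 1/2"
proof -
  have f0: "0 \<le> product_sum S N w f"
    using product_sum_mono[of S w N "\<lambda>_. 0" f] w f by (simp add: product_sum_def)
  show ?thesis
  proof (cases "\<alpha> = 0")
    case True
    then have "(\<Sum>y\<in>words S N. (\<Prod>k<N. w k (y ! k)) * f y) = 0"
      using f0 le unfolding product_sum_def by simp
    then have "(\<Prod>k<N. w k (y ! k)) * f y = 0" if "y \<in> words S N" for y
      using that S by (subst (asm) sum_nonneg_eq_0_iff)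
        (auto intro!: mult_nonneg_nonneg prod_nonneg f w nth_words)
    then have "(\<Prod>k<N. w k (y ! k)) * of_bool (\<alpha> < f y) = 0" if "y \<in> words S N" for y
      using that True by fastforce
    then have "product_sum S N w (\<lambda>y. of_bool (\<alpha> < f y)) = 0"
      unfolding product_sum_def by (intro sum.neutral ballI)
    then show ?thesis by simp
  next
    case False
    then have a: "0 < \<alpha>" using f0 le by simp
    have "product_sum S N w (\<lambda>y. of_bool (\<alpha> < f y)) \<le> product_sum S N w (\<lambda>y. 1 / \<alpha> * f y)"
      using a f by (intro product_sum_mono w) (auto simp: field_simps)
    also have "\<dots> = 1 / \<alpha> * product_sum S N w f" by (rule product_sum_cmult)
    also have "\<dots> \<le> 1/2" using le a by (simp add: field_simps)
    finally show ?thesis .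
  qed
qed

text \<open>The first passage above \<open>x + \<alpha>\<close> is located by induction on the word,
  with \<open>s\<close> as the position reached so far. From a position beyond
  \<open>x + \<alpha>\<close>, the total can return to at most \<open>x\<close> only if the
  remaining tail exceeds \<open>\<alpha>\<close>, which has probability at most one half.\<close>

lemma ottaviani:
  fixes u :: "nat \<Rightarrow> 'a \<Rightarrow> 'x::real_normed_vector"
  assumes "\<And>k a. a \<in> S \<Longrightarrow> 0 \<le> w k a" "\<And>k. (\<Sum>a\<in>S. w k a) = 1"
    and "\<And>j. j \<le> N \<Longrightarrow> product_sum S (N - j) (\<lambda>k. w (k + j))
        (\<lambda>y. of_bool (\<alpha> < norm (\<Sum>k<N - j. u (k + j) (y ! k)))) \<le> 1/2"
  shows "product_sum S N w (\<lambda>y. of_bool (\<exists>n\<le>N. x + \<alpha> < norm (s + (\<Sum>k<n. u k (y ! k))))) \<le>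
    2 * product_sum S N w (\<lambda>y. of_bool (x < norm (s + (\<Sum>k<N. u k (y ! k)))))"
  using assms
proof (induction N arbitrary: w u s)
  case 0
  \<comment> \<open>The hypothesis on tails, read for the empty word, forces
    \<open>0 \<le> \<alpha>\<close>.\<close>
  show ?case using 0(3)[of 0] by (auto simp: of_bool_def split: if_splits) 
next
  case (Suc N)
  note w = Suc.prems(1,2) and tails = Suc.prems(3)
  let ?S = "\<lambda>y. \<Sum>k<Suc N. u k (y ! k)"
  show ?case
  \<comment> \<open>In the first case the left side is at most \<open>1\<close>, and the event on
    the right has probability at least one half. In the second case nothing has happened yet, and
    the first letter \<open>b\<close> moves the position to \<open>s + u 0 b\<close>.\<close>
  proof (cases "x + \<alpha> < norm s")
    case True
    have "product_sum S (Suc N) w (\<lambda>y. of_bool (\<exists>n\<le>Suc N. x + \<alpha> < norm (s + (\<Sum>k<n. u k (y ! k))))) \<le>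
        product_sum S (Suc N) w (\<lambda>_. 1)"
      by (intro product_sum_mono w) auto
    also have "\<dots> = 1" by (rule product_sum_const) (rule w)
    finally have 1: "product_sum S (Suc N) w
        (\<lambda>y. of_bool (\<exists>n\<le>Suc N. x + \<alpha> < norm (s + (\<Sum>k<n. u k (y ! k))))) \<le> 1" .
    have "1 = product_sum S (Suc N) w (\<lambda>_. 1)" by (rule product_sum_const[symmetric]) (rule w)
    also have "\<dots> \<le> product_sum S (Suc N) w
        (\<lambda>y. of_bool (x < norm (s + ?S y)) + of_bool (\<alpha> < norm (?S y)))"
    proof (intro product_sum_mono w)
      fix y
      have "norm s \<le> norm (s + ?S y) + norm (?S y)"
        using norm_triangle_ineq4[of "s + ?S y" "?S y"] by simp
      then show "(1::real) \<le> of_bool (x < norm (s + ?S y)) + of_bool (\<alpha> < norm (?S y))"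
        using True by (cases "x < norm (s + ?S y)"; cases "\<alpha> < norm (?S y)") (auto simp del: sum.lessThan_Suc)
    qed
    also have "\<dots> = product_sum S (Suc N) w (\<lambda>y. of_bool (x < norm (s + ?S y))) +
        product_sum S (Suc N) w (\<lambda>y. of_bool (\<alpha> < norm (?S y)))"
      by (rule product_sum_add)
    also have "product_sum S (Suc N) w (\<lambda>y. of_bool (\<alpha> < norm (?S y))) \<le> 1/2"
      using tails[of 0] by (simp del: sum.lessThan_Suc)
    finally show ?thesis using 1 by (simp del: sum.lessThan_Suc)
  next
    case False
    have ex: "(\<exists>n\<le>Suc N. x + \<alpha> < norm (s + (\<Sum>k<n. u k ((b # y) ! k)))) \<longleftrightarrow>
        (\<exists>n\<le>N. x + \<alpha> < norm ((s + u 0 b) + (\<Sum>k<n. u (Suc k) (y ! k))))" for b y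
    proof -
      have "(\<exists>n\<le>Suc N. x + \<alpha> < norm (s + (\<Sum>k<n. u k ((b # y) ! k)))) \<longleftrightarrow>
          (\<exists>n\<le>N. x + \<alpha> < norm (s + (\<Sum>k<Suc n. u k ((b # y) ! k))))"
        using False by (metis Suc_le_mono add.right_neutral le0 lessThan_0 not0_implies_Suc sum.empty)
      then show ?thesis
        by (simp add: sum.lessThan_Suc_shift add.assoc del: sum.lessThan_Suc)
    qed
    have IH: "product_sum S N (\<lambda>k. w (Suc k))
          (\<lambda>y. of_bool (\<exists>n\<le>N. x + \<alpha> < norm ((s + u 0 b) + (\<Sum>k<n. u (Suc k) (y ! k))))) \<le>
        2 * product_sum S N (\<lambda>k. w (Suc k))
          (\<lambda>y. of_bool (x < norm ((s + u 0 b) + (\<Sum>k<N. u (Suc k) (y ! k)))))" for b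
    proof (rule Suc.IH)
      fix j assume "j \<le> N"
      then show "product_sum S (N - j) (\<lambda>k. w (Suc (k + j)))
        (\<lambda>y. of_bool (\<alpha> < norm (\<Sum>k<N - j. u (Suc (k + j)) (y ! k)))) \<le> 1/2"
        using tails[of "Suc j"] by simp
    qed (use w in auto)
    show ?thesis
      unfolding product_sum_Suc ex sum_distrib_left[of 2]
    proof (rule sum_mono)
      fix b assume b: "b \<in> S"
      show "w 0 b * product_sum S N (\<lambda>k. w (Suc k))
          (\<lambda>y. of_bool (\<exists>n\<le>N. x + \<alpha> < norm ((s + u 0 b) + (\<Sum>k<n. u (Suc k) (y ! k))))) \<le>
        2 * (w 0 b * product_sum S N (\<lambda>k. w (Suc k))
          (\<lambda>y. of_bool (x < norm (s + (\<Sum>k<Suc N. u k ((b # y) ! k))))))"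
        using mult_left_mono[OF IH[of b] w(1)[OF b, of 0]]
        by (simp add: sum.lessThan_Suc_shift add.assoc del: sum.lessThan_Suc)
    qed
  qed
qed

text \<open>With \<open>\<alpha>\<close> twice the mean norm of the total, Markov's inequality
  supplies the hypothesis of \<open>ottaviani\<close> for all tails. Integration over
  \<open>x\<close> bounds the p-th moment of the excess of the maximum over \<open>\<alpha>\<close>
  by twice that of the total, and Jensen's inequality bounds \<open>\<alpha>\<close> itself; hence
  \<open>2 + 2 powr p\<close>. The argument includes \<open>p = 1\<close>.\<close>

lemma independent_maximal_bound:
  fixes u :: "nat \<Rightarrow> 'a \<Rightarrow> 'x::real_normed_vector"
  assumes S: "finite S" and p: "1 \<le> p"
    and w: "\<And>k a. a \<in> S \<Longrightarrow> 0 \<le> w k a" "\<And>k. (\<Sum>a\<in>S. w k a) = 1"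
    and u: "\<And>k. (\<Sum>a\<in>S. w k a *\<^sub>R u k a) = 0"
  shows "product_sum S N w (\<lambda>y. max_norm (\<lambda>n. \<Sum>k<n. u k (y ! k)) N powr p) \<le>
    2 powr p * (2 + 2 powr p) * product_sum S N w (\<lambda>y. norm (\<Sum>k<N. u k (y ! k)) powr p)"
proof -
  let ?R = "\<lambda>y. \<Sum>k<N. u k (y ! k)" and ?W = "\<lambda>y. \<Prod>k<N. w k (y ! k)"
  define M where "M y = max_norm (\<lambda>n. \<Sum>k<n. u k (y ! k)) N" for y
  define \<alpha> where "\<alpha> = 2 * product_sum S N w (\<lambda>y. norm (?R y))"
  have a0: "0 \<le> \<alpha>"
    using product_sum_mono[of S w N "\<lambda>_. 0" "\<lambda>y. norm (?R y)"] w unfolding \<alpha>_def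
    by (simp add: product_sum_def)
  have ott: "product_sum S N w (\<lambda>y. of_bool (\<exists>n\<le>N. x + \<alpha> < norm (0 + (\<Sum>k<n. u k (y ! k))))) \<le>
    2 * product_sum S N w (\<lambda>y. of_bool (x < norm (0 + ?R y)))" for x
  proof (rule ottaviani[OF w])
    fix j assume j: "j \<le> N"
    show "product_sum S (N - j) (\<lambda>k. w (k + j))
        (\<lambda>y. of_bool (\<alpha> < norm (\<Sum>k<N - j. u (k + j) (y ! k)))) \<le> 1/2"
      using product_sum_tails_le[of S w u j N, OF w u j] unfolding \<alpha>_def
      by (intro product_sum_markov w S) auto
  qed
  have "(\<Sum>y\<in>words S N. ?W y * max 0 (M y - \<alpha>) powr p) \<le>
      2 * (\<Sum>y\<in>words S N. ?W y * norm (?R y) powr p) + 0 * (\<Sum>y\<in>words S N. ?W y * 0 powr p)"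
  proof (rule layer_cake_sum)
    fix x :: real assume x: "0 < x"
    have "x < max 0 (M y - \<alpha>) \<longleftrightarrow> (\<exists>n\<le>N. x + \<alpha> < norm (0 + (\<Sum>k<n. u k (y ! k))))" for y
    proof -
      have "x < max 0 (M y - \<alpha>) \<longleftrightarrow> x + \<alpha> < M y" using x by auto
      then show ?thesis unfolding M_def less_max_norm_iff by simp
    qed
    then show "(\<Sum>y\<in>words S N. ?W y * of_bool (x < max 0 (M y - \<alpha>))) \<le>
      2 * (\<Sum>y\<in>words S N. ?W y * of_bool (x < norm (?R y))) +
      0 * (\<Sum>y\<in>words S N. ?W y * of_bool (x < 0))"
      using ott[of x] unfolding product_sum_def by simp
  qed (use S p in auto)
  then have 1: "product_sum S N w (\<lambda>y. max 0 (M y - \<alpha>) powr p) \<le>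
      2 * product_sum S N w (\<lambda>y. norm (?R y) powr p)"
    unfolding product_sum_def by simp
  have "\<alpha> powr p = 2 powr p * product_sum S N w (\<lambda>y. norm (?R y)) powr p"
    unfolding \<alpha>_def by (rule powr_mult)
  also have "\<dots> \<le> 2 powr p * product_sum S N w (\<lambda>y. norm (?R y) powr p)"
    unfolding product_sum_def
  proof (intro mult_left_mono sum_powr_jensen p)
    show "sum ?W (words S N) = 1"
      using product_sum_const[of w S N 1] w unfolding product_sum_def by simp
  qed (auto intro!: prod_nonneg w nth_words)
  finally have 2: "\<alpha> powr p \<le> 2 powr p * product_sum S N w (\<lambda>y. norm (?R y) powr p)" .
  have "product_sum S N w (\<lambda>y. M y powr p) \<le>
      product_sum S N w (\<lambda>y. 2 powr p * (max 0 (M y - \<alpha>) powr p + \<alpha> powr p))"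
  proof (intro product_sum_mono w)
    fix y
    have "M y powr p \<le> (max 0 (M y - \<alpha>) + \<alpha>) powr p"
      using p unfolding M_def by (intro powr_mono2 max_norm_nonneg) auto
    also have "\<dots> \<le> 2 powr p * (max 0 (M y - \<alpha>) powr p + \<alpha> powr p)"
      by (intro powr_add_le p a0) auto
    finally show "M y powr p \<le> 2 powr p * (max 0 (M y - \<alpha>) powr p + \<alpha> powr p)" .
  qed
  also have "\<dots> = 2 powr p * (product_sum S N w (\<lambda>y. max 0 (M y - \<alpha>) powr p) + \<alpha> powr p)"
    by (simp only: product_sum_cmult product_sum_add product_sum_const[OF w(2)])
  also have "\<dots> \<le> 2 powr p * (2 * product_sum S N w (\<lambda>y. norm (?R y) powr p) +
      2 powr p * product_sum S N w (\<lambda>y. norm (?R y) powr p))"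
    by (intro mult_left_mono add_mono 1 2) auto
  finally show ?thesis unfolding M_def by (simp add: algebra_simps)
qed

section \<open>Decoupling on trees\<close>

locale kernel_tree =
  fixes S :: "'a set" and \<kappa> :: "'a list \<Rightarrow> 'a \<Rightarrow> real"
  assumes finite_S: "finite S"
    and kernel_nonneg: "a \<in> S \<Longrightarrow> 0 \<le> \<kappa> h a"
    and kernel_sum: "(\<Sum>a\<in>S. \<kappa> h a) = 1"
begin

definition prob :: "'a list \<Rightarrow> 'a list \<Rightarrow> real" where
  "prob x y = (\<Prod>k<length x. \<kappa> (take k x) (y ! k))"

text \<open>Under the weights \<open>prob x x * prob x y\<close>, the word \<open>x\<close> is the path of the tree, and the letters of
  \<open>y\<close> are, conditionally on \<open>x\<close>, independent copies of the letters of \<open>x\<close> given their pasts.\<close>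

definition T :: "nat \<Rightarrow> ('a list \<Rightarrow> 'a list \<Rightarrow> 'b::real_vector) \<Rightarrow> 'b" where
  "T N g = (\<Sum>x\<in>words S N. \<Sum>y\<in>words S N. (prob x x * prob x y) *\<^sub>R g x y)"

lemma prob_nonneg: "x \<in> words S N \<Longrightarrow> y \<in> words S N \<Longrightarrow> 0 \<le> prob x y"
  unfolding prob_def using length_words by (auto intro!: prod_nonneg kernel_nonneg nth_words)

lemma prob_snoc: "length x = length y \<Longrightarrow> prob (x @ [a]) (y @ [b]) = prob x y * \<kappa> x b"
  unfolding prob_def by (simp add: nth_append)

lemma T_cong: "(\<And>x y. x \<in> words S N \<Longrightarrow> y \<in> words S N \<Longrightarrow> f x y = g x y) \<Longrightarrow> T N f = T N g"
  unfolding T_def by (intro sum.cong refl) simp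

lemma T_mono: "(\<And>x y. x \<in> words S N \<Longrightarrow> y \<in> words S N \<Longrightarrow> (f x y :: real) \<le> g x y) \<Longrightarrow> T N f \<le> T N g"
  unfolding T_def
  by (intro sum_mono) (auto intro!: mult_left_mono mult_nonneg_nonneg prob_nonneg)

lemma T_add: "T N (\<lambda>x y. f x y + g x y) = T N f + T N g"
  unfolding T_def by (simp add: scaleR_add_right sum.distrib)

lemma T_cmult: "T N (\<lambda>x y. c * g x y) = c * T N g" for c :: real
  unfolding T_def by (simp add: sum_distrib_left mult_ac)

lemma T_sum: "T N (\<lambda>x y. \<Sum>k\<in>I. g k x y) = (\<Sum>k\<in>I. T N (g k))"
  by (induction I rule: infinite_finite_induct) (simp_all add: T_add, simp_all add: T_def)

lemma T_eq_product_sum: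
  "T N g = (\<Sum>x\<in>words S N. prob x x * product_sum S N (\<lambda>k. \<kappa> (take k x)) (g x))"
  for g :: "'a list \<Rightarrow> 'a list \<Rightarrow> real"
  unfolding T_def product_sum_def sum_distrib_left
  by (intro sum.cong refl) (simp add: prob_def length_words mult_ac)

lemma T_Suc: "T (Suc n) g =
  T n (\<lambda>x y. \<Sum>a\<in>S. \<Sum>b\<in>S. (\<kappa> x a * \<kappa> x b) *\<^sub>R g (x @ [a]) (y @ [b]))"
proof -
  have "T (Suc n) g = (\<Sum>x\<in>words S n. \<Sum>a\<in>S. \<Sum>y\<in>words S n. \<Sum>b\<in>S.
      (prob (x @ [a]) (x @ [a]) * prob (x @ [a]) (y @ [b])) *\<^sub>R g (x @ [a]) (y @ [b]))"
    unfolding T_def sum_words_snoc ..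
  also have "\<dots> = (\<Sum>x\<in>words S n. \<Sum>y\<in>words S n. \<Sum>a\<in>S. \<Sum>b\<in>S.
      (prob (x @ [a]) (x @ [a]) * prob (x @ [a]) (y @ [b])) *\<^sub>R g (x @ [a]) (y @ [b]))"
    by (intro sum.cong refl sum.swap)
  also have "\<dots> = T n (\<lambda>x y. \<Sum>a\<in>S. \<Sum>b\<in>S. (\<kappa> x a * \<kappa> x b) *\<^sub>R g (x @ [a]) (y @ [b]))"
    unfolding T_def scaleR_sum_right
    by (intro sum.cong refl) (simp add: prob_snoc length_words mult_ac)
  finally show ?thesis .
qed

lemma T_take: "n \<le> N \<Longrightarrow> T N (\<lambda>x y. g (take n x) (take n y)) = T n g"
proof (induction N rule: dec_induct)
  case base
  show ?case by (intro T_cong) (simp add: length_words)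
next
  case (step N)
  have "T (Suc N) (\<lambda>x y. g (take n x) (take n y)) = T N (\<lambda>x y. g (take n x) (take n y))"
    unfolding T_Suc
  proof (rule T_cong)
    fix x y assume xy: "x \<in> words S N" "y \<in> words S N"
    have "(\<Sum>a\<in>S. \<Sum>b\<in>S. (\<kappa> x a * \<kappa> x b) *\<^sub>R g (take n (x @ [a])) (take n (y @ [b]))) =
        (\<Sum>a\<in>S. \<kappa> x a *\<^sub>R (\<Sum>b\<in>S. \<kappa> x b *\<^sub>R g (take n x) (take n y)))"
      using xy step.hyps by (simp add: length_words scaleR_sum_right)
    also have "\<dots> = g (take n x) (take n y)"
      unfolding scaleR_sum_left[symmetric] kernel_sum by simp
    finally show "(\<Sum>a\<in>S. \<Sum>b\<in>S. (\<kappa> x a * \<kappa> x b) *\<^sub>R g (take n (x @ [a])) (take n (y @ [b]))) =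
        g (take n x) (take n y)" .
  qed
  then show ?case using step.IH by simp
qed

lemma T_const: "T N (\<lambda>x y. c) = c"
  using T_take[of 0 N "\<lambda>x y. c"] by (simp add: T_def prob_def)

lemma T_step:
  assumes "n < N"
  shows "T N (\<lambda>x y. g (take n x) (take n y) (x ! n) (y ! n)) =
    T n (\<lambda>x y. \<Sum>a\<in>S. \<Sum>b\<in>S. (\<kappa> x a * \<kappa> x b) *\<^sub>R g x y a b)"
proof -
  have "T N (\<lambda>x y. g (take n x) (take n y) (x ! n) (y ! n)) =
      T N (\<lambda>x y. (\<lambda>x y. g (take n x) (take n y) (x ! n) (y ! n)) (take (Suc n) x) (take (Suc n) y))"
    using assms by (intro T_cong) (simp add: length_words min_def)
  also have "\<dots> = T (Suc n) (\<lambda>x y. g (take n x) (take n y) (x ! n) (y ! n))"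
    by (rule T_take) (use assms in simp)
  also have "\<dots> = T n (\<lambda>x y. \<Sum>a\<in>S. \<Sum>b\<in>S. (\<kappa> x a * \<kappa> x b) *\<^sub>R g x y a b)"
    unfolding T_Suc by (intro T_cong sum.cong refl) (simp add: length_words nth_append)
  finally show ?thesis .
qed

text \<open>Given the first \<open>n\<close> letters of both words, \<open>x ! n\<close> and
  \<open>y ! n\<close> are independent with the same law. Later letters must stay out of the
  integrand, since their laws depend on \<open>x ! n\<close> but not on
  \<open>y ! n\<close>.\<close>

lemma T_swap_letters:
  assumes "n < N"
  shows "T N (\<lambda>x y. g (take n x) (take n y) (x ! n) (y ! n)) =
    T N (\<lambda>x y. g (take n x) (take n y) (y ! n) (x ! n))"
  unfolding T_step[OF assms] T_step[OF assms, of "\<lambda>x y a b. g x y b a"]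
  by (intro T_cong) (subst sum.swap, simp add: mult.commute)

definition d :: "('a list \<Rightarrow> 'x) \<Rightarrow> nat \<Rightarrow> 'a list \<Rightarrow> 'x" where
  "d v n x = v (take n x @ [x ! n])"

definition e :: "('a list \<Rightarrow> 'x) \<Rightarrow> nat \<Rightarrow> 'a list \<Rightarrow> 'a list \<Rightarrow> 'x" where
  "e v n x y = v (take n x @ [y ! n])"

definition path_sum :: "('a list \<Rightarrow> 'x::real_normed_vector) \<Rightarrow> real \<Rightarrow> nat \<Rightarrow> real" where
  "path_sum v p N = T N (\<lambda>x y. norm (\<Sum>k<N. d v k x) powr p)"

definition decoupled_sum :: "('a list \<Rightarrow> 'x::real_normed_vector) \<Rightarrow> real \<Rightarrow> nat \<Rightarrow> real" where
  "decoupled_sum v p N = T N (\<lambda>x y. norm (\<Sum>k<N. e v k x y) powr p)"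

lemma max_jump_cong: "(\<And>k. k < n \<Longrightarrow> f k = g k) \<Longrightarrow> max_jump f n = max_jump g n"
  by (induction n) auto

text \<open>In p-th powers, the largest \<open>d\<close>-jump exceeds the largest
  \<open>e\<close>-jump by at most the sum of the excesses \<open>G\<close> of each
  \<open>d\<close>-jump over the running maximum \<open>J\<close> of the earlier
  \<open>e\<close>-jumps. \<open>J k\<close> depends on the first \<open>k\<close> letters only, so
  the two letters of time \<open>k\<close> may be exchanged in each excess. The excesses of the
  \<open>e\<close>-jumps telescope to \<open>J N\<close>, whence the factor
  \<open>2\<close>.\<close>

lemma max_jump_tangent:
  fixes v :: "'a list \<Rightarrow> 'x::real_normed_vector"
  assumes p: "1 \<le> p"
  shows "T N (\<lambda>x y. max_jump (\<lambda>k. d v k x) N powr p) \<le>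
    2 * T N (\<lambda>x y. max_jump (\<lambda>k. e v k x y) N powr p)"
proof -
  define J where "J k x y = max_jump (\<lambda>k. e v k x y) k powr p" for k x y
  define G where "G k x y a = max 0 (norm (v (x @ [a])) powr p - J k x y)" for k x y a
  have Jmono: "J k x y \<le> J N x y" if "k \<le> N" for k x y
    unfolding J_def using that p by (intro powr_mono2 max_jump_mono max_jump_nonneg) auto
  have J_take: "J k (take k x) (take k y) = J k x y" for k x y
    unfolding J_def by (intro arg_cong2[where f = "(powr)"] max_jump_cong) (simp_all add: e_def)
  have step: "J (Suc k) x y - J k x y = max 0 (norm (e v k x y) powr p - J k x y)" for k x y
    unfolding J_def using p max_jump_nonneg[of "\<lambda>k. e v k x y" k]
    by (simp add: max_def powr_mono2 not_le less_imp_le) (smt (verit) norm_ge_zero powr_mono2)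
  have "max_jump (\<lambda>k. d v k x) n powr p \<le> J N x y + (\<Sum>k<n. G k (take k x) (take k y) (x ! k))"
    if "n \<le> N" for n x y
    using that
  proof (induction n)
    case 0
    then show ?case by (simp add: J_def)
  next
    case (Suc n)
    have "norm (d v n x) powr p \<le> J n x y + G n (take n x) (take n y) (x ! n)"
      unfolding G_def J_take d_def by simp
    also have "\<dots> \<le> J N x y + (\<Sum>k<Suc n. G k (take k x) (take k y) (x ! k))"
    proof -
      have "0 \<le> (\<Sum>k<n. G k (take k x) (take k y) (x ! k))" by (intro sum_nonneg) (simp add: G_def)
      then show ?thesis using Jmono[of n x y] Suc.prems by simp
    qed
    finally have "norm (d v n x) powr p \<le> J N x y + (\<Sum>k<Suc n. G k (take k x) (take k y) (x ! k))" .
    moreover have "max_jump (\<lambda>k. d v k x) n powr p \<le> J N x y + (\<Sum>k<Suc n. G k (take k x) (take k y) (x ! k))"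
      using Suc by (simp add: G_def)
    ultimately show ?case by (simp add: max_def)
  qed
  then have "T N (\<lambda>x y. max_jump (\<lambda>k. d v k x) N powr p) \<le>
      T N (\<lambda>x y. J N x y + (\<Sum>k<N. G k (take k x) (take k y) (x ! k)))"
    by (intro T_mono) auto
  also have "\<dots> = T N (J N) + (\<Sum>k<N. T N (\<lambda>x y. G k (take k x) (take k y) (x ! k)))"
    by (simp only: T_add T_sum)
  also have "(\<Sum>k<N. T N (\<lambda>x y. G k (take k x) (take k y) (x ! k))) =
      (\<Sum>k<N. T N (\<lambda>x y. G k (take k x) (take k y) (y ! k)))"
    by (intro sum.cong refl, rule T_swap_letters[where g = "\<lambda>x y a b. G _ x y a"]) simp
  also have "\<dots> = T N (\<lambda>x y. \<Sum>k<N. J (Suc k) x y - J k x y)"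
    unfolding T_sum[symmetric] step unfolding G_def J_take e_def ..
  also have "\<dots> = T N (J N)"
  proof (rule T_cong)
    fix x y
    show "(\<Sum>k<N. J (Suc k) x y - J k x y) = J N x y"
      using sum_lessThan_telescope[of "\<lambda>k. J k x y" N] by (simp add: J_def del: max_jump.simps(2))
  qed
  finally show ?thesis unfolding J_def by simp
qed

text \<open>For fixed \<open>x\<close> the letters of \<open>y\<close> are independent and the
  summands centred, so the bound for independent sums holds for each \<open>x\<close> and is
  averaged over the paths.\<close>

lemma decoupled_maximal_bound:
  fixes v :: "'a list \<Rightarrow> 'x::real_normed_vector"
  assumes p: "1 \<le> p" and v: "\<And>h. (\<Sum>a\<in>S. \<kappa> h a *\<^sub>R v (h @ [a])) = 0"
  shows "T N (\<lambda>x y. max_norm (\<lambda>n. \<Sum>k<n. e v k x y) N powr p) \<le>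
    2 powr p * (2 + 2 powr p) * decoupled_sum v p N"
  unfolding T_eq_product_sum decoupled_sum_def sum_distrib_left
proof (rule sum_mono)
  fix x assume x: "x \<in> words S N"
  have "product_sum S N (\<lambda>k. \<kappa> (take k x)) (\<lambda>y. max_norm (\<lambda>n. \<Sum>k<n. e v k x y) N powr p) \<le>
    2 powr p * (2 + 2 powr p) *
    product_sum S N (\<lambda>k. \<kappa> (take k x)) (\<lambda>y. norm (\<Sum>k<N. e v k x y) powr p)"
    unfolding e_def
    by (rule independent_maximal_bound[of S p "\<lambda>k. \<kappa> (take k x)" "\<lambda>k a. v (take k x @ [a])",
          OF finite_S p kernel_nonneg kernel_sum v])
  from mult_left_mono[OF this prob_nonneg[OF x x]]
  show "prob x x * product_sum S N (\<lambda>k. \<kappa> (take k x)) (\<lambda>y. max_norm (\<lambda>n. \<Sum>k<n. e v k x y) N powr p) \<le>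
    2 powr p * (2 + 2 powr p) * (prob x x *
    product_sum S N (\<lambda>k. \<kappa> (take k x)) (\<lambda>y. norm (\<Sum>k<N. e v k x y) powr p))"
    by (simp only: mult_ac)
qed

end

section \<open>The interlaced martingale\<close>

context kernel_tree
begin

definition pair_weight :: "'a list \<times> 'a list \<Rightarrow> real" where
  "pair_weight = (\<lambda>(x, y). prob x x * prob x y)"

text \<open>At odd times only the unordered pair of the two next letters is revealed.\<close>

definition reveal :: "nat \<Rightarrow> 'a list \<times> 'a list \<Rightarrow> 'a list \<times> 'a list \<times> 'a set" where
  "reveal m = (\<lambda>(x, y). (take (m div 2) x, take (m div 2) y,
     if even m then {} else {x ! (m div 2), y ! (m div 2)}))"

lemma take_Suc_eqD:
  assumes "take (Suc n) x = take (Suc n) x'" "length x = length x'"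
  shows "take n x = take n x'" "x ! n = x' ! n"
proof -
  show "take n x = take n x'" using assms(1) by (metis take_take min_Suc_Suc min.idem min_def le_SucI order_refl)
  show "x ! n = x' ! n"
  proof (cases "n < length x")
    case True
    then show ?thesis using assms by (metis lessI nth_take)
  next
    case False
    then show ?thesis using assms by simp
  qed
qed

lemma finite_filtration_reveal:
  "finite_filtration (words S N \<times> words S N) pair_weight reveal"
proof
  show "finite (words S N \<times> words S N)" using finite_S by simp
  show "0 \<le> pair_weight \<omega>" if "\<omega> \<in> words S N \<times> words S N" for \<omega>
    using that prob_nonneg unfolding pair_weight_def by auto
  show "sum pair_weight (words S N \<times> words S N) = 1"
    using T_const[of N "1 :: real"] unfolding pair_weight_def T_def
    by (simp add: sum.cartesian_product)
  fix \<omega> \<omega>' n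
  assume w: "\<omega> \<in> words S N \<times> words S N" "\<omega>' \<in> words S N \<times> words S N"
    and eq: "reveal (Suc n) \<omega> = reveal (Suc n) \<omega>'"
  obtain x y x' y' where [simp]: "\<omega> = (x, y)" "\<omega>' = (x', y')" by (cases \<omega>, cases \<omega>') auto
  have len: "length x = length x'" "length y = length y'" using w by (auto simp: length_words)
  show "reveal n \<omega> = reveal n \<omega>'"
  proof (cases "even n")
    case True
    then show ?thesis using eq unfolding reveal_def by simp
  next
    case False
    then have "Suc n div 2 = Suc (n div 2)" by simp
    then have "take (Suc (n div 2)) x = take (Suc (n div 2)) x'"
      "take (Suc (n div 2)) y = take (Suc (n div 2)) y'"
      using eq False unfolding reveal_def by auto
    then have "take (n div 2) x = take (n div 2) x'" "x ! (n div 2) = x' ! (n div 2)"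
      "take (n div 2) y = take (n div 2) y'" "y ! (n div 2) = y' ! (n div 2)"
      using take_Suc_eqD len by blast+
    then show ?thesis unfolding reveal_def by simp
  qed
qed

text \<open>The half sum is symmetric in the two new letters, hence known as soon as their unordered
  pair is; the half difference also needs the order. From time \<open>2 * N\<close> on the sequence
  is continued by \<open>0\<close>.\<close>

definition interlaced :: "('a list \<Rightarrow> 'x::real_normed_vector) \<Rightarrow> nat \<Rightarrow> nat \<Rightarrow> 'a list \<times> 'a list \<Rightarrow> 'x" where
  "interlaced v N m = (\<lambda>(x, y). if m div 2 < N
     then (1/2) *\<^sub>R (if even m then e v (m div 2) x y + d v (m div 2) x
                     else e v (m div 2) x y - d v (m div 2) x) else 0)"

lemma T_uminus: "T N (\<lambda>x y. - g x y) = - T N g"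
  unfolding T_def by (simp add: sum_negf)

text \<open>At even times both summands average to zero because \<open>v\<close> is centred. At odd
  times a cell fixes the unordered pair; exchanging the two letters preserves the cell and the law
  but changes the sign of the difference.\<close>

lemma mds_interlaced:
  fixes v :: "'a list \<Rightarrow> 'x::real_normed_vector"
  assumes v: "\<And>h. (\<Sum>a\<in>S. \<kappa> h a *\<^sub>R v (h @ [a])) = 0"
  shows "finite_filtration.mds (words S N \<times> words S N) pair_weight reveal (interlaced v N)"
proof -
  interpret finite_filtration "words S N \<times> words S N" pair_weight reveal
    by (rule finite_filtration_reveal)
  show ?thesis
    unfolding mds_def
  proof (intro allI conjI ballI)
    fix m :: nat
    let ?n = "m div 2"
    show "meas (Suc m) (interlaced v N m)"
    proof (rule measI)
      fix \<omega> \<omega>' assume w: "\<omega> \<in> words S N \<times> words S N" "\<omega>' \<in> words S N \<times> words S N"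
        and eq: "reveal (Suc m) \<omega> = reveal (Suc m) \<omega>'"
      obtain x y x' y' where [simp]: "\<omega> = (x, y)" "\<omega>' = (x', y')" by (cases \<omega>, cases \<omega>') auto
      have len: "length x = length x'" "length y = length y'" using w by (auto simp: length_words)
      show "interlaced v N m \<omega> = interlaced v N m \<omega>'"
      proof (cases "even m")
        case True
        then have "take ?n x = take ?n x'" "{x ! ?n, y ! ?n} = {x' ! ?n, y' ! ?n}"
          using eq True unfolding reveal_def by simp_all
        then show ?thesis
          using True unfolding interlaced_def d_def e_def doubleton_eq_iff
          by (auto simp: add.commute)
      next
        case False
        then have "Suc m div 2 = Suc ?n" by simp
        then have "take (Suc ?n) x = take (Suc ?n) x'" "take (Suc ?n) y = take (Suc ?n) y'"
          using eq False unfolding reveal_def by auto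
        then have "take ?n x = take ?n x'" "x ! ?n = x' ! ?n" "y ! ?n = y' ! ?n"
          using take_Suc_eqD len by blast+
        then show ?thesis unfolding interlaced_def d_def e_def by simp
      qed
    qed
    fix \<omega> assume "\<omega> \<in> words S N \<times> words S N"
    obtain x0 y0 where w: "\<omega> = (x0, y0)" by (cases \<omega>) auto
    have "(\<Sum>\<omega>'\<in>cell m \<omega>. pair_weight \<omega>' *\<^sub>R interlaced v N m \<omega>') =
        T N (\<lambda>x y. of_bool (reveal m (x, y) = reveal m \<omega>) *\<^sub>R interlaced v N m (x, y))"
      unfolding cell_def T_def sum.cartesian_product pair_weight_def
      using finite_S by (intro sum.mono_neutral_cong_left) auto
    also have "\<dots> = 0"
    proof (cases "?n < N")
      case False
      then show ?thesis unfolding interlaced_def T_def by simp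
    next
      case n: True
      show ?thesis
      proof (cases "even m")
        case True
        define r :: "'a list \<Rightarrow> 'a list \<Rightarrow> real" where
          "r x y = of_bool (x = take ?n x0 \<and> y = take ?n y0) * (1/2)" for x y
        have "T N (\<lambda>x y. of_bool (reveal m (x, y) = reveal m \<omega>) *\<^sub>R interlaced v N m (x, y)) =
            T N (\<lambda>x y. r (take ?n x) (take ?n y) *\<^sub>R
              (v (take ?n x @ [y ! ?n]) + v (take ?n x @ [x ! ?n])))"
          using True n unfolding w reveal_def interlaced_def r_def d_def e_def by (intro T_cong) simp
        also have "\<dots> = T ?n (\<lambda>x y. \<Sum>a\<in>S. \<Sum>b\<in>S. (\<kappa> x a * \<kappa> x b) *\<^sub>R r x y *\<^sub>R
            (v (x @ [b]) + v (x @ [a])))"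
          by (rule T_step[OF n])
        also have "\<dots> = T ?n (\<lambda>x y. 0)"
        proof (rule T_cong)
          fix x y
          have 1: "(\<Sum>a\<in>S. \<Sum>b\<in>S. (\<kappa> x a * \<kappa> x b) *\<^sub>R v (x @ [b])) = 0"
            using v[of x] by (simp add: scaleR_sum_right[symmetric] flip: scaleR_scaleR)
          have 2: "(\<Sum>a\<in>S. \<Sum>b\<in>S. (\<kappa> x a * \<kappa> x b) *\<^sub>R v (x @ [a])) = 0"
            by (subst sum.swap) (use 1 in \<open>simp add: mult.commute\<close>)
          have "(\<Sum>a\<in>S. \<Sum>b\<in>S. (\<kappa> x a * \<kappa> x b) *\<^sub>R r x y *\<^sub>R (v (x @ [b]) + v (x @ [a]))) =
              r x y *\<^sub>R ((\<Sum>a\<in>S. \<Sum>b\<in>S. (\<kappa> x a * \<kappa> x b) *\<^sub>R v (x @ [b])) +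
                (\<Sum>a\<in>S. \<Sum>b\<in>S. (\<kappa> x a * \<kappa> x b) *\<^sub>R v (x @ [a])))"
            by (simp add: scaleR_sum_right scaleR_add_right sum.distrib mult_ac)
          then show "(\<Sum>a\<in>S. \<Sum>b\<in>S. (\<kappa> x a * \<kappa> x b) *\<^sub>R r x y *\<^sub>R (v (x @ [b]) + v (x @ [a]))) = 0"
            using 1 2 by simp
        qed
        also have "\<dots> = 0" by (rule T_const)
        finally show ?thesis .
      next
        case False
        define g :: "'a list \<Rightarrow> 'a list \<Rightarrow> 'a \<Rightarrow> 'a \<Rightarrow> 'x" where
          "g x y a b = (of_bool (x = take ?n x0 \<and> y = take ?n y0 \<and> {a, b} = {x0 ! ?n, y0 ! ?n}) * (1/2)) *\<^sub>R
            (v (x @ [b]) - v (x @ [a]))" for x y a b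
        let ?T = "T N (\<lambda>x y. g (take ?n x) (take ?n y) (x ! ?n) (y ! ?n))"
        have swap: "g x y b a = - g x y a b" for x y a b
          unfolding g_def insert_commute[of b a] by (simp add: scaleR_diff_right)
        have "?T = T N (\<lambda>x y. g (take ?n x) (take ?n y) (y ! ?n) (x ! ?n))"
          by (rule T_swap_letters[OF n])
        also have "\<dots> = - ?T" unfolding T_uminus[symmetric]
          by (intro T_cong) (rule swap)
        finally have "2 *\<^sub>R ?T = 0" by (simp add: scaleR_2 eq_neg_iff_add_eq_0)
        moreover have "T N (\<lambda>x y. of_bool (reveal m (x, y) = reveal m \<omega>) *\<^sub>R interlaced v N m (x, y)) = ?T"
          using False n unfolding w reveal_def interlaced_def g_def d_def e_def by (intro T_cong) simp
        ultimately show ?thesis by simp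
      qed
    qed
    finally show "(\<Sum>\<omega>'\<in>cell m \<omega>. pair_weight \<omega>' *\<^sub>R interlaced v N m \<omega>') = 0" .
  qed
qed

lemma sum_interlaced:
  fixes v :: "'a list \<Rightarrow> 'x::real_normed_vector"
  assumes "n \<le> N"
  shows "(\<Sum>k<2 * n. interlaced v N k (x, y)) = (\<Sum>k<n. e v k x y)"
    "(\<Sum>k<2 * n. (if even k then 1 else - 1) *\<^sub>R interlaced v N k (x, y)) = (\<Sum>k<n. d v k x)"
proof -
  have *: "(1/2) *\<^sub>R (a + b) + (1/2) *\<^sub>R (a - b) = a" "(1/2) *\<^sub>R (a + b) - (1/2) *\<^sub>R (a - b) = b"
    for a b :: 'x
    by (simp_all add: scaleR_add_right scaleR_diff_right scaleR_half_double flip: scaleR_add_left)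
  have 1: "interlaced v N (2 * k) (x, y) = (1/2) *\<^sub>R (e v k x y + d v k x)"
    "interlaced v N (Suc (2 * k)) (x, y) = (1/2) *\<^sub>R (e v k x y - d v k x)" if "k < N" for k
    using that unfolding interlaced_def by simp_all
  show "(\<Sum>k<2 * n. interlaced v N k (x, y)) = (\<Sum>k<n. e v k x y)"
    using assms by (induction n) (simp_all add: 1 * add.assoc)
  show "(\<Sum>k<2 * n. (if even k then 1 else - 1) *\<^sub>R interlaced v N k (x, y)) = (\<Sum>k<n. d v k x)"
    using assms
  proof (induction n)
    case (Suc n)
    then show ?case by (simp add: 1 flip: diff_conv_add_uminus add_diff_eq) (simp add: * add_diff_eq[symmetric])
  qed simp
qed

text \<open>At even times the partial sums are those of \<open>e\<close>. At odd times half of the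
  current \<open>e\<close> and \<open>d\<close> is added: the \<open>e\<close>-jump is at most twice
  the maximum, but the \<open>d\<close>-jump remains, and it is for this term that
  \<open>max_jump_tangent\<close> is proved.\<close>

lemma max_norm_interlaced_le:
  fixes v :: "'a list \<Rightarrow> 'x::real_normed_vector"
  shows "max_norm (\<lambda>n. \<Sum>k<n. interlaced v N k (x, y)) (2 * N) \<le>
    2 * max_norm (\<lambda>n. \<Sum>k<n. e v k x y) N + max_jump (\<lambda>k. d v k x) N"
  unfolding max_norm_le_iff
proof (intro allI impI)
  let ?M = "max_norm (\<lambda>n. \<Sum>k<n. e v k x y) N" and ?J = "max_jump (\<lambda>k. d v k x) N"
  fix m assume m: "m \<le> 2 * N"
  show "norm (\<Sum>k<m. interlaced v N k (x, y)) \<le> 2 * ?M + ?J"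
  proof (cases "even m")
    case True
    then obtain n where n: "m = 2 * n" by blast
    then have "norm (\<Sum>k<m. interlaced v N k (x, y)) \<le> ?M"
      using m max_norm_ge[of n N "\<lambda>n. \<Sum>k<n. e v k x y"] by (simp add: sum_interlaced)
    then show ?thesis
      using max_norm_nonneg[of "\<lambda>n. \<Sum>k<n. e v k x y" N] max_jump_nonneg[of "\<lambda>k. d v k x" N] by simp
  next
    case False
    then obtain n where n: "m = Suc (2 * n)" by (elim oddE) simp
    then have nN: "n < N" using m by simp
    have "(\<Sum>k<m. interlaced v N k (x, y)) = (\<Sum>k<n. e v k x y) + (1/2) *\<^sub>R (e v n x y + d v n x)"
      using nN unfolding n by (simp add: sum_interlaced) (simp add: interlaced_def)
    then have "norm (\<Sum>k<m. interlaced v N k (x, y)) \<le>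
        norm (\<Sum>k<n. e v k x y) + norm ((1/2) *\<^sub>R (e v n x y + d v n x))"
      by (simp only: norm_triangle_ineq)
    also have "\<dots> \<le> ?M + (2 * ?M + ?J) / 2"
    proof (rule add_mono)
      show "norm (\<Sum>k<n. e v k x y) \<le> ?M"
        using nN max_norm_ge[of n N "\<lambda>n. \<Sum>k<n. e v k x y"] by simp
      have "norm (e v n x y) \<le> 2 * ?M"
        using max_jump_ge[OF nN, of "\<lambda>k. e v k x y"] max_jump_le_max_norm[of "\<lambda>k. e v k x y" N] by simp
      moreover have "norm (d v n x) \<le> ?J" using max_jump_ge[OF nN, of "\<lambda>k. d v k x"] by simp
      ultimately show "norm ((1/2) *\<^sub>R (e v n x y + d v n x)) \<le> (2 * ?M + ?J) / 2"
        using norm_triangle_ineq[of "e v n x y" "d v n x"] by simp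
    qed
    also have "\<dots> \<le> 2 * ?M + ?J"
      using max_jump_nonneg[of "\<lambda>k. d v k x" N] by simp
    finally show ?thesis .
  qed
qed

text \<open>The three factors belong to the transform of the interlaced martingale into
  \<open>d\<close>, to the comparison of its maximal function with that of \<open>e\<close>, and to
  Ottaviani's inequality. In the middle one, \<open>3 * 2 powr p\<close> consists of
  \<open>2 powr p\<close> for the partial sums and twice \<open>2 powr p\<close> for the
  \<open>d\<close>-jumps.\<close>

lemma path_sum_le_decoupled_sum:
  fixes v :: "'a list \<Rightarrow> 'x::banach"
  assumes umd: "umd_bound TYPE(real) TYPE('x) q \<beta>" and q: "1 \<le> q" and \<beta>: "0 \<le> \<beta>"
    and p: "1 \<le> p" and v: "\<And>h. (\<Sum>a\<in>S. \<kappa> h a *\<^sub>R v (h @ [a])) = 0"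
    and \<delta>: "0 < \<delta>" "\<delta> \<le> 1/2" "2 powr p * (\<beta> powr q * (6 * \<delta>) powr q) \<le> 1/2"
    and K: "K = 2 powr p * (1 + 2 * (2 * p) powr p) * 4 powr p"
  shows "path_sum v p N \<le> 2 powr p * (2 * (2 / \<delta>) powr p * (2 powr p * (8 powr p + K)) + K) *
    (2 powr p * (3 * 2 powr p)) * (2 powr p * (2 + 2 powr p)) * decoupled_sum v p N"
proof -
  interpret finite_filtration "words S N \<times> words S N" pair_weight reveal
    by (rule finite_filtration_reveal)
  define M where "M x y = max_norm (\<lambda>n. \<Sum>k<n. e v k x y) N" for x y
  let ?C = "2 powr p * (2 * (2 / \<delta>) powr p * (2 powr p * (8 powr p + K)) + K)"
  let ?\<epsilon> = "\<lambda>k. if even k then 1 else - 1 :: real"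
  have C0: "0 \<le> ?C" unfolding K by (intro mult_nonneg_nonneg add_nonneg_nonneg) auto
  have E_T: "E Z = T N (\<lambda>x y. Z (x, y))" for Z
    unfolding E_def T_def sum.cartesian_product by (simp add: pair_weight_def case_prod_unfold)
  have "path_sum v p N =
      T N (\<lambda>x y. norm (\<Sum>k<2 * N. ?\<epsilon> k *\<^sub>R interlaced v N k (x, y)) powr p)"
    unfolding path_sum_def by (simp add: sum_interlaced)
  also have "\<dots> \<le> T N (\<lambda>x y. max_norm (\<lambda>n. \<Sum>k<n. ?\<epsilon> k *\<^sub>R interlaced v N k (x, y)) (2 * N) powr p)"
    using p by (intro T_mono powr_mono2 max_norm_ge[of "2 * N" "2 * N"]) auto
  also have "\<dots> \<le> ?C * T N (\<lambda>x y. max_norm (\<lambda>n. \<Sum>k<n. interlaced v N k (x, y)) (2 * N) powr p)"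
  proof -
    have "E (\<lambda>\<omega>. max_norm (\<lambda>n. \<Sum>k<n. ?\<epsilon> k *\<^sub>R interlaced v N k \<omega>) (2 * N) powr p) \<le>
        ?C * E (\<lambda>\<omega>. max_norm (\<lambda>n. \<Sum>k<n. interlaced v N k \<omega>) (2 * N) powr p)"
    proof (rule maximal_transform_bound[OF _ q _ p _ \<delta> mds_interlaced[OF v] K])
      show "E (\<lambda>\<omega>. norm (\<Sum>k<2 * N. ?\<epsilon> k *\<^sub>R D k \<omega>) powr q) \<le>
          \<beta> powr q * E (\<lambda>\<omega>. norm (\<Sum>k<2 * N. D k \<omega>) powr q)"
        if "mds D" for D :: "nat \<Rightarrow> 'a list \<times> 'a list \<Rightarrow> 'x"
        by (rule umd_finite_filtration[OF umd q \<beta> _ that]) simp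
    qed auto
    then show ?thesis unfolding E_T .
  qed
  finally have 1: "path_sum v p N \<le>
      ?C * T N (\<lambda>x y. max_norm (\<lambda>n. \<Sum>k<n. interlaced v N k (x, y)) (2 * N) powr p)" .
  have "T N (\<lambda>x y. max_norm (\<lambda>n. \<Sum>k<n. interlaced v N k (x, y)) (2 * N) powr p) \<le>
      T N (\<lambda>x y. 2 powr p * (2 powr p * M x y powr p + max_jump (\<lambda>k. d v k x) N powr p))"
  proof (rule T_mono)
    fix x y
    have "max_norm (\<lambda>n. \<Sum>k<n. interlaced v N k (x, y)) (2 * N) powr p \<le>
        (2 * M x y + max_jump (\<lambda>k. d v k x) N) powr p"
      unfolding M_def using p by (intro powr_mono2 max_norm_interlaced_le max_norm_nonneg) auto
    also have "\<dots> \<le> 2 powr p * ((2 * M x y) powr p + max_jump (\<lambda>k. d v k x) N powr p)"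
      unfolding M_def by (intro powr_add_le p max_jump_nonneg mult_nonneg_nonneg max_norm_nonneg) auto
    finally show "max_norm (\<lambda>n. \<Sum>k<n. interlaced v N k (x, y)) (2 * N) powr p \<le>
        2 powr p * (2 powr p * M x y powr p + max_jump (\<lambda>k. d v k x) N powr p)"
      by (simp only: powr_mult)
  qed
  also have "\<dots> = 2 powr p * (2 powr p * T N (\<lambda>x y. M x y powr p) +
      T N (\<lambda>x y. max_jump (\<lambda>k. d v k x) N powr p))"
    by (simp only: T_add T_cmult)
  finally have 2: "T N (\<lambda>x y. max_norm (\<lambda>n. \<Sum>k<n. interlaced v N k (x, y)) (2 * N) powr p) \<le>
      2 powr p * (2 powr p * T N (\<lambda>x y. M x y powr p) + T N (\<lambda>x y. max_jump (\<lambda>k. d v k x) N powr p))" .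
  have "T N (\<lambda>x y. max_jump (\<lambda>k. d v k x) N powr p) \<le> 2 * T N (\<lambda>x y. 2 powr p * M x y powr p)"
  proof (rule order_trans[OF max_jump_tangent[OF p]], intro mult_left_mono T_mono)
    fix x y
    have "max_jump (\<lambda>k. e v k x y) N powr p \<le> (2 * M x y) powr p"
      unfolding M_def using p by (intro powr_mono2 max_jump_le_max_norm max_jump_nonneg) auto
    then show "max_jump (\<lambda>k. e v k x y) N powr p \<le> 2 powr p * M x y powr p" by (simp only: powr_mult)
  qed simp
  then have "2 powr p * (2 powr p * T N (\<lambda>x y. M x y powr p) +
      T N (\<lambda>x y. max_jump (\<lambda>k. d v k x) N powr p)) \<le>
      2 powr p * (2 powr p * T N (\<lambda>x y. M x y powr p) + 2 * T N (\<lambda>x y. 2 powr p * M x y powr p))"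
    by (intro mult_left_mono add_left_mono) auto
  also have "2 powr p * (2 powr p * T N (\<lambda>x y. M x y powr p) + 2 * T N (\<lambda>x y. 2 powr p * M x y powr p)) =
      2 powr p * (3 * 2 powr p) * T N (\<lambda>x y. M x y powr p)"
    unfolding T_cmult by (simp add: algebra_simps)
  finally have 3: "2 powr p * (2 powr p * T N (\<lambda>x y. M x y powr p) +
      T N (\<lambda>x y. max_jump (\<lambda>k. d v k x) N powr p)) \<le>
      2 powr p * (3 * 2 powr p) * T N (\<lambda>x y. M x y powr p)" .
  have 4: "T N (\<lambda>x y. M x y powr p) \<le> 2 powr p * (2 + 2 powr p) * decoupled_sum v p N"
    unfolding M_def by (rule decoupled_maximal_bound[OF p v])
  have "2 powr p * (3 * 2 powr p) * T N (\<lambda>x y. M x y powr p) \<le>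
      2 powr p * (3 * 2 powr p) * (2 powr p * (2 + 2 powr p) * decoupled_sum v p N)"
    by (intro mult_left_mono 4) simp
  from order_trans[OF 1 mult_left_mono[OF order_trans[OF order_trans[OF 2 3] this] C0]]
  show ?thesis by (simp only: mult.assoc)
qed

end

lemma exists_tree_constant:
  assumes umd: "umd TYPE('x::banach)" and p: "1 \<le> p"
  shows "\<exists>C\<ge>0. \<forall>(S :: 'a set) \<kappa> (v :: 'a list \<Rightarrow> 'x) N. kernel_tree S \<kappa> \<longrightarrow>
    (\<forall>h. (\<Sum>a\<in>S. \<kappa> h a *\<^sub>R v (h @ [a])) = 0) \<longrightarrow>
    kernel_tree.path_sum S \<kappa> v p N \<le> C * kernel_tree.decoupled_sum S \<kappa> v p N"
proof -
  obtain q \<beta> where q: "1 < q" and \<beta>: "1 \<le> \<beta>" and b: "umd_bound TYPE(real) TYPE('x) q \<beta>"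
    using umd unfolding umd_def by blast
  define c where "c = 2 powr p * \<beta> powr q"
  have c: "0 < c" unfolding c_def using \<beta> by simp
  \<comment> \<open>Chosen so that \<open>c * (6 * \<delta>) powr q\<close> is at most one half,
    which is the absorption condition. It depends on \<open>p\<close>, \<open>q\<close> and
    \<open>\<beta>\<close> only, so the constant is uniform over all trees.\<close>
  define \<delta> where "\<delta> = min (1/2) ((1 / (2 * c)) powr (1 / q) / 6)"
  have d: "0 < \<delta>" "\<delta> \<le> 1/2" unfolding \<delta>_def using c by auto
  have "(6 * \<delta>) powr q \<le> ((1 / (2 * c)) powr (1 / q)) powr q"
    using d q unfolding \<delta>_def by (intro powr_mono2) auto
  also have "\<dots> = 1 / (2 * c)" using q c by (simp add: powr_powr)
  finally have "c * (6 * \<delta>) powr q \<le> 1/2" using c by (simp add: field_simps)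
  then have d3: "2 powr p * (\<beta> powr q * (6 * \<delta>) powr q) \<le> 1/2" unfolding c_def by (simp add: mult.assoc)
  define K where "K = 2 powr p * (1 + 2 * (2 * p) powr p) * 4 powr p"
  let ?C = "2 powr p * (2 * (2 / \<delta>) powr p * (2 powr p * (8 powr p + K)) + K) *
    (2 powr p * (3 * 2 powr p)) * (2 powr p * (2 + 2 powr p))"
  have "0 \<le> ?C" unfolding K_def by (intro mult_nonneg_nonneg add_nonneg_nonneg) auto
  moreover have "kernel_tree.path_sum S \<kappa> v p N \<le> ?C * kernel_tree.decoupled_sum S \<kappa> v p N"
    if "kernel_tree S \<kappa>" "\<forall>h. (\<Sum>a\<in>S. \<kappa> h a *\<^sub>R v (h @ [a])) = 0"
    for S :: "'a set" and \<kappa> N and v :: "'a list \<Rightarrow> 'x"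
    using kernel_tree.path_sum_le_decoupled_sum[OF that(1) b _ _ p that(2)[rule_format] d d3 K_def] q \<beta>
    by simp
  ultimately show ?thesis by blast
qed

section \<open>Realising trees as stochastic bases\<close>

lemma real_cond_exp_real_model:
  fixes Z Y :: "'c \<Rightarrow> real" and \<rho> :: "'c \<Rightarrow> 'h" and Q :: "real pmf"
  assumes fin: "finite \<Omega>" and dec: "\<And>r. dec r \<in> \<Omega>"
    and int: "\<And>g. (\<integral>r. (g (dec r) :: real) \<partial>measure_pmf Q) = (\<Sum>\<omega>\<in>\<Omega>. P \<omega> * g \<omega>)"
    and Y: "\<And>\<omega> \<omega>'. \<omega> \<in> \<Omega> \<Longrightarrow> \<omega>' \<in> \<Omega> \<Longrightarrow> \<rho> \<omega> = \<rho> \<omega>' \<Longrightarrow> Y \<omega> = Y \<omega>'"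
    and eq: "\<And>B. (\<Sum>\<omega>\<in>\<Omega>. P \<omega> * (indicator B (\<rho> \<omega>) * Z \<omega>)) = (\<Sum>\<omega>\<in>\<Omega>. P \<omega> * (indicator B (\<rho> \<omega>) * Y \<omega>))"
  shows "AE r in measure_pmf Q.
    real_cond_exp (measure_pmf Q) (level_algebra (\<lambda>r. \<rho> (dec r))) (\<lambda>r. Z (dec r)) r = Y (dec r)"
proof -
  let ?M = "measure_pmf Q" and ?H = "level_algebra (\<lambda>r. \<rho> (dec r))"
  interpret finite_measure_subalgebra ?M ?H
    by unfold_locales (rule subalgebra_level_algebra)
  show ?thesis
  proof (rule real_cond_exp_charact)
    fix A assume "A \<in> sets ?H"
    then obtain B where A: "A = (\<lambda>r. \<rho> (dec r)) -` B" unfolding sets_level_algebra by auto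
    have "(\<integral>r\<in>A. f (dec r) \<partial>?M) = (\<Sum>\<omega>\<in>\<Omega>. P \<omega> * (indicator B (\<rho> \<omega>) * f \<omega>))" for f
    proof -
      have "(\<integral>r\<in>A. f (dec r) \<partial>?M) = (\<integral>r. (\<lambda>\<omega>. indicator B (\<rho> \<omega>) * f \<omega>) (dec r) \<partial>?M)"
        unfolding set_lebesgue_integral_def A by (intro Bochner_Integration.integral_cong) (auto simp: indicator_def)
      then show ?thesis unfolding int[of "\<lambda>\<omega>. indicator B (\<rho> \<omega>) * f \<omega>"] .
    qed
    then show "(\<integral>r\<in>A. Z (dec r) \<partial>?M) = (\<integral>r\<in>A. Y (dec r) \<partial>?M)" using eq by simp
  next
    show "integrable ?M (\<lambda>r. Z (dec r))" "integrable ?M (\<lambda>r. Y (dec r))"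
      by (rule integrable_real_model[OF fin dec])+
    have "finite (range (\<lambda>r. Y (dec r)))"
      by (rule finite_subset[of _ "Y ` \<Omega>"]) (use fin dec in auto)
    then show "(\<lambda>r. Y (dec r)) \<in> borel_measurable ?H"
      by (intro borel_measurable_simple_function simple_function_level_algebra) (assumption, rule Y[OF dec dec])
  qed
qed

lemma product_sum_prod:
  "product_sum S N w (\<lambda>y. \<Prod>k<N. f k (y ! k)) = (\<Prod>k<N. \<Sum>a\<in>S. w k a * f k a)"
proof (induction N arbitrary: w f)
  case (Suc N)
  have "product_sum S (Suc N) w (\<lambda>y. \<Prod>k<Suc N. f k (y ! k)) =
      (\<Sum>b\<in>S. w 0 b * (f 0 b * product_sum S N (\<lambda>k. w (Suc k)) (\<lambda>y. \<Prod>k<N. f (Suc k) (y ! k))))"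
    unfolding product_sum_Suc prod.lessThan_Suc_shift by (simp add: product_sum_cmult)
  also have "\<dots> = (\<Prod>k<Suc N. \<Sum>a\<in>S. w k a * f k a)"
    unfolding prod.lessThan_Suc_shift Suc.IH[of "\<lambda>k. w (Suc k)" "\<lambda>k. f (Suc k)"]
    by (simp add: sum_distrib_right mult.assoc)
  finally show ?case .
qed simp

text \<open>The (CI) condition has to be verified for arbitrarily many indices, also beyond the
  length of the word, where \<open>y ! k\<close> has no meaning. There the factors are constants and
  leave the sum; the others factorise by independence.\<close>

lemma product_sum_prod_subset:
  assumes w: "\<And>k. (\<Sum>a\<in>S. w k a) = 1" and I: "finite I"
    and f: "\<And>k a. N \<le> k \<Longrightarrow> f k a = c k"
  shows "product_sum S N w (\<lambda>y. \<Prod>k\<in>I. f k (y ! k)) = (\<Prod>k\<in>I. \<Sum>a\<in>S. w k a * f k a)"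
proof -
  have split: "(\<Prod>k\<in>I. g k) = (\<Prod>k<N. if k \<in> I then g k else 1) * (\<Prod>k\<in>I - {..<N}. g k)"
    for g :: "nat \<Rightarrow> real"
  proof -
    have "(\<Prod>k<N. if k \<in> I then g k else 1) = (\<Prod>k\<in>{..<N} \<inter> I. g k)"
      by (rule prod.inter_restrict[symmetric]) simp
    moreover have "(\<Prod>k\<in>I. g k) = (\<Prod>k\<in>I \<inter> {..<N}. g k) * (\<Prod>k\<in>I - {..<N}. g k)"
      by (rule prod.Int_Diff[OF I])
    ultimately show ?thesis by (simp add: Int_commute)
  qed
  have tail: "(\<Prod>k\<in>I - {..<N}. f k (y ! k)) = (\<Prod>k\<in>I - {..<N}. c k)" for y
    by (intro prod.cong) (auto simp: f)
  have tail': "(\<Prod>k\<in>I - {..<N}. \<Sum>a\<in>S. w k a * f k a) = (\<Prod>k\<in>I - {..<N}. c k)"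
  proof (intro prod.cong refl)
    fix k assume "k \<in> I - {..<N}"
    then have "(\<Sum>a\<in>S. w k a * f k a) = (\<Sum>a\<in>S. w k a) * c k"
      unfolding sum_distrib_right by (intro sum.cong) (auto simp: f)
    then show "(\<Sum>a\<in>S. w k a * f k a) = c k" using w by simp
  qed
  have "product_sum S N w (\<lambda>y. \<Prod>k\<in>I. f k (y ! k)) =
      (\<Prod>k\<in>I - {..<N}. c k) * product_sum S N w (\<lambda>y. \<Prod>k<N. (\<lambda>k a. if k \<in> I then f k a else 1) k (y ! k))"
    unfolding product_sum_cmult[symmetric] split[of "\<lambda>k. f k (_ ! k)"] tail
    by (simp add: mult.commute)
  also have "\<dots> = (\<Prod>k\<in>I - {..<N}. c k) * (\<Prod>k<N. if k \<in> I then \<Sum>a\<in>S. w k a * f k a else 1)"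
    unfolding product_sum_prod[of S N w "\<lambda>k a. if k \<in> I then f k a else 1"]
    using w by (intro arg_cong2[where f = "(*)"] prod.cong refl) simp
  also have "\<dots> = (\<Prod>k\<in>I. \<Sum>a\<in>S. w k a * f k a)"
    unfolding split[of "\<lambda>k. \<Sum>a\<in>S. w k a * f k a"] tail' by simp
  finally show ?thesis .
qed

context kernel_tree
begin

lemma T_product:
  fixes g :: "'a list \<Rightarrow> real"
  assumes I: "finite I" and f: "\<And>k h a. N \<le> k \<Longrightarrow> f k h a = c k"
  shows "T N (\<lambda>x y. g x * (\<Prod>k\<in>I. f k (take k x) (y ! k))) =
    T N (\<lambda>x y. g x * (\<Prod>k\<in>I. \<Sum>a\<in>S. \<kappa> (take k x) a * f k (take k x) a))"
  unfolding T_eq_product_sum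
proof (intro sum.cong refl arg_cong2[where f = "(*)"])
  fix x
  have "product_sum S N (\<lambda>k. \<kappa> (take k x)) (\<lambda>y. \<Prod>k\<in>I. f k (take k x) (y ! k)) =
      (\<Prod>k\<in>I. \<Sum>a\<in>S. \<kappa> (take k x) a * f k (take k x) a)"
    by (rule product_sum_prod_subset[where c = c]) (rule kernel_sum, rule I, rule f)
  then show "product_sum S N (\<lambda>k. \<kappa> (take k x)) (\<lambda>y. g x * (\<Prod>k\<in>I. f k (take k x) (y ! k))) =
      product_sum S N (\<lambda>k. \<kappa> (take k x))
        (\<lambda>y. g x * (\<Prod>k\<in>I. \<Sum>a\<in>S. \<kappa> (take k x) a * f k (take k x) a))"
    unfolding product_sum_cmult product_sum_const[OF kernel_sum] by (rule arg_cong)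
qed

text \<open>In contrast to \<open>reveal\<close>, both new letters arrive at once and in order, so
  that the values read from \<open>x\<close> and from \<open>y\<close> are adapted to the same
  clock.\<close>

definition prefixes :: "nat \<Rightarrow> 'a list \<times> 'a list \<Rightarrow> 'a list \<times> 'a list" where
  "prefixes n = (\<lambda>(x, y). (take n x, take n y))"

lemma take_eq_mono: "take n x = take n x' \<Longrightarrow> m \<le> n \<Longrightarrow> take m x = take m x'"
  by (metis min.absorb1 take_take)

lemma finite_filtration_prefixes:
  "finite_filtration (words S N \<times> words S N) pair_weight prefixes"
proof -
  interpret R: finite_filtration "words S N \<times> words S N" pair_weight reveal
    by (rule finite_filtration_reveal)
  show ?thesis
  proof
    fix \<omega> \<omega>' n
    assume eq: "prefixes (Suc n) \<omega> = prefixes (Suc n) \<omega>'"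
    obtain x y x' y' where [simp]: "\<omega> = (x, y)" "\<omega>' = (x', y')" by (cases \<omega>, cases \<omega>') auto
    have "take (Suc n) x = take (Suc n) x'" "take (Suc n) y = take (Suc n) y'"
      using eq by (simp_all add: prefixes_def)
    then have "take n x = take n x'" "take n y = take n y'" by (auto elim: take_eq_mono)
    then show "prefixes n \<omega> = prefixes n \<omega>'" by (simp add: prefixes_def)
  qed (use R.finite_space R.weight_nonneg R.weight_sum in auto)
qed

text \<open>The sequences of the target statement are infinite; beyond the length \<open>N\<close>
  of the words they are continued by \<open>0\<close>.\<close>

definition stopped_value :: "('a list \<Rightarrow> 'x::zero) \<Rightarrow> nat \<Rightarrow> nat \<Rightarrow> 'a list \<Rightarrow> 'a \<Rightarrow> 'x" where
  "stopped_value v N k h a = (if k < N then v (h @ [a]) else 0)"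

lemma sum_pairs: "(\<Sum>\<omega>\<in>words S N \<times> words S N. pair_weight \<omega> *\<^sub>R g \<omega>) = T N (\<lambda>x y. g (x, y))"
  unfolding T_def sum.cartesian_product by (simp add: pair_weight_def case_prod_unfold)

lemma T_step_const:
  fixes c :: "'a list \<Rightarrow> 'a list \<Rightarrow> real" and s :: "'a list \<Rightarrow> 'a \<Rightarrow> real"
  assumes "k < N"
  shows "T N (\<lambda>x y. c (take k x) (take k y) * s (take k x) (x ! k)) =
      T N (\<lambda>x y. c (take k x) (take k y) * (\<Sum>a\<in>S. \<kappa> (take k x) a * s (take k x) a))"
proof -
  have "T N (\<lambda>x y. c (take k x) (take k y) * s (take k x) (x ! k)) =
      T k (\<lambda>x y. \<Sum>a\<in>S. \<Sum>b\<in>S. (\<kappa> x a * \<kappa> x b) *\<^sub>R (c x y * s x a))"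
    by (rule T_step[OF assms, of "\<lambda>x y a b. c x y * s x a"])
  also have "\<dots> = T k (\<lambda>x y. c x y * (\<Sum>a\<in>S. \<kappa> x a * s x a))"
  proof (rule T_cong)
    fix x y
    have "(\<Sum>a\<in>S. \<Sum>b\<in>S. (\<kappa> x a * \<kappa> x b) *\<^sub>R (c x y * s x a)) =
        (\<Sum>a\<in>S. \<kappa> x a * (c x y * s x a) * (\<Sum>b\<in>S. \<kappa> x b))"
      by (simp add: sum_distrib_left mult_ac)
    then show "(\<Sum>a\<in>S. \<Sum>b\<in>S. (\<kappa> x a * \<kappa> x b) *\<^sub>R (c x y * s x a)) = c x y * (\<Sum>a\<in>S. \<kappa> x a * s x a)"
      unfolding kernel_sum by (simp add: sum_distrib_left mult_ac)
  qed
  also have "\<dots> = T N (\<lambda>x y. c (take k x) (take k y) * (\<Sum>a\<in>S. \<kappa> (take k x) a * s (take k x) a))"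
    using T_take[of k N "\<lambda>x y. c x y * (\<Sum>a\<in>S. \<kappa> x a * s x a)"] assms by simp
  finally show ?thesis .
qed

lemma mds_prefixes:
  fixes v :: "'a list \<Rightarrow> 'x::real_normed_vector"
  assumes v: "\<And>h. (\<Sum>a\<in>S. \<kappa> h a *\<^sub>R v (h @ [a])) = 0"
  shows "finite_filtration.mds (words S N \<times> words S N) pair_weight prefixes
    (\<lambda>k (x, y). stopped_value v N k (take k x) (x ! k))"
proof -
  interpret finite_filtration "words S N \<times> words S N" pair_weight prefixes
    by (rule finite_filtration_prefixes)
  let ?D = "\<lambda>k (x, y). stopped_value v N k (take k x) (x ! k)"
  show ?thesis
    unfolding mds_def
  proof (intro allI conjI ballI)
    fix k
    show "meas (Suc k) (?D k)"
    proof (rule measI)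
      fix \<omega> \<omega>' assume w: "\<omega> \<in> words S N \<times> words S N" "\<omega>' \<in> words S N \<times> words S N"
        and eq: "prefixes (Suc k) \<omega> = prefixes (Suc k) \<omega>'"
      obtain x y x' y' where [simp]: "\<omega> = (x, y)" "\<omega>' = (x', y')" by (cases \<omega>, cases \<omega>') auto
      have "take (Suc k) x = take (Suc k) x'" "length x = length x'"
        using w eq by (auto simp: length_words prefixes_def)
      then have "take k x = take k x'" "x ! k = x' ! k" using take_Suc_eqD by blast+
      then show "?D k \<omega> = ?D k \<omega>'" by simp
    qed
    fix \<omega> assume "\<omega> \<in> words S N \<times> words S N"
    have "(\<Sum>\<omega>'\<in>cell k \<omega>. pair_weight \<omega>' *\<^sub>R ?D k \<omega>') =
        (\<Sum>\<omega>'\<in>words S N \<times> words S N. pair_weight \<omega>' *\<^sub>R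
          of_bool (prefixes k \<omega>' = prefixes k \<omega>) *\<^sub>R ?D k \<omega>')"
      unfolding cell_def using finite_S by (intro sum.mono_neutral_cong_left) auto
    also have "\<dots> = T N (\<lambda>x y. of_bool (prefixes k (x, y) = prefixes k \<omega>) *\<^sub>R ?D k (x, y))"
      by (rule sum_pairs)
    also have "\<dots> = 0"
    proof (cases "k < N")
      case False
      then show ?thesis by (simp add: stopped_value_def T_def)
    next
      case True
      have "T N (\<lambda>x y. of_bool (prefixes k (x, y) = prefixes k \<omega>) *\<^sub>R ?D k (x, y)) =
          T N (\<lambda>x y. of_bool ((take k x, take k y) = prefixes k \<omega>) *\<^sub>R v (take k x @ [x ! k]))"
        using True by (simp add: stopped_value_def prefixes_def)
      also have "\<dots> = T k (\<lambda>x y. \<Sum>a\<in>S. \<Sum>b\<in>S. (\<kappa> x a * \<kappa> x b) *\<^sub>R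
          of_bool ((x, y) = prefixes k \<omega>) *\<^sub>R v (x @ [a]))"
        by (rule T_step[OF True, of "\<lambda>x y a b. of_bool ((x, y) = prefixes k \<omega>) *\<^sub>R v (x @ [a])"])
      also have "\<dots> = T k (\<lambda>x y. 0)"
      proof (rule T_cong)
        fix x y
        have "(\<Sum>a\<in>S. \<Sum>b\<in>S. (\<kappa> x a * \<kappa> x b) *\<^sub>R of_bool ((x, y) = prefixes k \<omega>) *\<^sub>R v (x @ [a])) =
            of_bool ((x, y) = prefixes k \<omega>) *\<^sub>R (\<Sum>b\<in>S. \<kappa> x b *\<^sub>R (\<Sum>a\<in>S. \<kappa> x a *\<^sub>R v (x @ [a])))"
          by (subst sum.swap) (simp add: scaleR_sum_right mult_ac)
        then show "(\<Sum>a\<in>S. \<Sum>b\<in>S. (\<kappa> x a * \<kappa> x b) *\<^sub>R of_bool ((x, y) = prefixes k \<omega>) *\<^sub>R v (x @ [a])) = 0"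
          using v by simp
      qed
      also have "\<dots> = 0" by (rule T_const)
      finally show ?thesis .
    qed
    finally show "(\<Sum>\<omega>'\<in>cell k \<omega>. pair_weight \<omega>' *\<^sub>R ?D k \<omega>') = 0" .
  qed
qed

lemma sum_stopped_value:
  fixes v :: "'a list \<Rightarrow> 'x::real_normed_vector"
  shows "(\<Sum>n=1..N. stopped_value v N (n - 1) (take (n - 1) x) (y ! (n - 1))) = (\<Sum>k<N. e v k x y)"
  by (simp add: sum.atLeast1_atMost_eq stopped_value_def e_def)

lemma e_diagonal: "e v k x x = d v k x"
  unfolding e_def d_def ..

text \<open>The tree is itself a decoupled pair, with the identity as enlargement. Given both pasts,
  either new letter has the law \<open>\<kappa> (take k x)\<close>, which gives tangency; given all
  of \<open>x\<close>, the letters of \<open>y\<close> are independent with these same laws, which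
  gives the (CI) condition for the sigma-field of \<open>x\<close>.\<close>

lemma path_sum_bound:
  fixes v :: "'a list \<Rightarrow> 'x::banach"
  assumes bound: "decoupling_bound TYPE(real) TYPE(real) TYPE('x) p C" and N: "1 \<le> N"
    and v: "\<And>h. (\<Sum>a\<in>S. \<kappa> h a *\<^sub>R v (h @ [a])) = 0"
  shows "path_sum v p N powr (1 / p) \<le> C * decoupled_sum v p N powr (1 / p)"
proof -
  let ?\<Omega> = "words S N \<times> words S N"
  interpret finite_filtration ?\<Omega> pair_weight prefixes
    by (rule finite_filtration_prefixes)
  obtain Q :: "real pmf" and dec where dec: "\<And>r. dec r \<in> ?\<Omega>"
    and int: "\<And>g. (\<integral>r. (g (dec r) :: real) \<partial>measure_pmf Q) = (\<Sum>\<omega>\<in>?\<Omega>. pair_weight \<omega> * g \<omega>)"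
    by (rule finite_weights_real_model[OF finite_space weight_nonneg weight_sum]) (assumption, rule that)
  let ?M = "measure_pmf Q" and ?F = "\<lambda>n. level_algebra (\<lambda>r. prefixes n (dec r))"
  define D where "D k = (\<lambda>(x, y :: 'a list). stopped_value v N k (take k x) (x ! k))" for k
  define W where "W k = (\<lambda>(x, y). stopped_value v N k (take k x) (y ! k))" for k
  \<comment> \<open>The common value of three conditional probabilities: of \<open>d\<close> and of
    \<open>e\<close> given the past, and of \<open>e\<close> given the whole word
    \<open>x\<close>.\<close>
  define \<psi> where "\<psi> k A = (\<lambda>(x, y :: 'a list).
      \<Sum>a\<in>S. \<kappa> (take k x) a * indicator A (stopped_value v N k (take k x) a))" for k and A :: "'x set"
  let ?d = "\<lambda>n r. D (n - 1) (dec r)" and ?e = "\<lambda>n r. W (n - 1) (dec r)"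
  let ?G = "level_algebra (\<lambda>r. fst (dec r))"
  have basis: "stochastic_basis ?M ?F"
    by (rule stochastic_basis_level_algebra) (rule refine[OF dec dec])
  have md: "martingale_difference ?M ?F ?d"
    unfolding D_def by (rule martingale_difference_real_model[OF mds_prefixes[OF v] dec int])
  have Lp: "bochner_Lp ?M p (?d n)" for n
    unfolding bochner_Lp_def
  proof
    show "strongly_measurable ?M (?d n)"
      using has_strong_integral_real_model[OF finite_space dec int, of "D (n - 1)"]
      unfolding has_strong_integral_def by blast
    show "integrable ?M (\<lambda>r. norm (?d n r) powr p)"
      by (rule integrable_real_model[OF finite_space dec])
  qed
  have psi_const: "\<psi> k A \<omega> = indicator A 0" if "N \<le> k" for k A \<omega>
    using that kernel_sum unfolding \<psi>_def stopped_value_def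
    by (simp add: sum_distrib_right[symmetric] split: prod.splits)
  have cond_F: "AE r in ?M. cond_prob_in ?M (?F k) (\<lambda>r. Z (dec r)) A r = \<psi> k A (dec r)"
    if Z: "Z = D k \<or> Z = W k" for Z k A
  proof -
    have "AE r in ?M. real_cond_exp ?M (?F k) (\<lambda>r. indicator A (Z (dec r))) r = \<psi> k A (dec r)"
    proof (rule real_cond_exp_real_model[OF finite_space dec int])
      show "\<psi> k A \<omega> = \<psi> k A \<omega>'" if "prefixes k \<omega> = prefixes k \<omega>'" for \<omega> \<omega>'
        using that unfolding \<psi>_def prefixes_def by (auto split: prod.splits)
      fix B
      let ?c = "\<lambda>x y :: 'a list. indicator B (x :: 'a list, y) :: real"
      let ?s = "\<lambda>h a. indicator A (stopped_value v N k h a) :: real"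
      have "T N (\<lambda>x y. ?c (take k x) (take k y) * indicator A (Z (x, y))) =
          T N (\<lambda>x y. ?c (take k x) (take k y) * \<psi> k A (x, y))"
      proof (cases "k < N")
        case False
        then show ?thesis using Z psi_const by (auto simp: D_def W_def stopped_value_def)
      next
        case True
        have "T N (\<lambda>x y. ?c (take k x) (take k y) * ?s (take k x) (x ! k)) =
          T N (\<lambda>x y. ?c (take k x) (take k y) * \<psi> k A (x, y))"
          unfolding \<psi>_def prod.case by (rule T_step_const[OF True])
        moreover have "T N (\<lambda>x y. ?c (take k x) (take k y) * ?s (take k x) (y ! k)) =
            T N (\<lambda>x y. ?c (take k x) (take k y) * ?s (take k x) (x ! k))"
          by (rule T_swap_letters[OF True, of "\<lambda>x y a b. ?c x y * ?s x b"])
        ultimately show ?thesis using Z by (auto simp: D_def W_def)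
      qed
      then show "(\<Sum>\<omega>\<in>?\<Omega>. pair_weight \<omega> * (indicator B (prefixes k \<omega>) * indicator A (Z \<omega>))) =
          (\<Sum>\<omega>\<in>?\<Omega>. pair_weight \<omega> * (indicator B (prefixes k \<omega>) * \<psi> k A \<omega>))"
        using sum_pairs[where N = N and g = "\<lambda>\<omega>. indicator B (prefixes k \<omega>) * indicator A (Z \<omega>) :: real"]
          sum_pairs[where N = N and g = "\<lambda>\<omega>. indicator B (prefixes k \<omega>) * \<psi> k A \<omega>"]
        by (simp add: prefixes_def)
    qed
    moreover have "(\<lambda>r. indicator A (Z (dec r)) :: real) = indicator ((\<lambda>r. Z (dec r)) -` A \<inter> space ?M)"
      by (auto simp: indicator_def)
    ultimately show ?thesis unfolding cond_prob_in_def by simp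
  qed
  have cond_G: "AE r in ?M. real_cond_exp ?M ?G
      (\<lambda>r. \<Prod>k\<in>I. indicator ((\<lambda>r. W k (dec r)) -` A k \<inter> space ?M) r) r = (\<Prod>k\<in>I. \<psi> k (A k) (dec r))"
    if I: "finite I" for I A
  proof -
    have "AE r in ?M. real_cond_exp ?M ?G (\<lambda>r. \<Prod>k\<in>I. indicator (A k) (W k (dec r))) r =
        (\<Prod>k\<in>I. \<psi> k (A k) (dec r))"
    proof (rule real_cond_exp_real_model[OF finite_space dec int])
      show "(\<Prod>k\<in>I. \<psi> k (A k) \<omega>) = (\<Prod>k\<in>I. \<psi> k (A k) \<omega>')" if "fst \<omega> = fst \<omega>'" for \<omega> \<omega>'
        using that unfolding \<psi>_def by (simp add: case_prod_unfold)
      fix B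
      have "T N (\<lambda>x y. indicator B x * (\<Prod>k\<in>I. indicator (A k) (stopped_value v N k (take k x) (y ! k)))) =
        T N (\<lambda>x y. indicator B x * (\<Prod>k\<in>I. \<Sum>a\<in>S. \<kappa> (take k x) a *
          indicator (A k) (stopped_value v N k (take k x) a)) :: real)"
        by (rule T_product[OF I, where c = "\<lambda>k. indicator (A k) 0"]) (simp add: stopped_value_def)
      then show "(\<Sum>\<omega>\<in>?\<Omega>. pair_weight \<omega> * (indicator B (fst \<omega>) * (\<Prod>k\<in>I. indicator (A k) (W k \<omega>)))) =
          (\<Sum>\<omega>\<in>?\<Omega>. pair_weight \<omega> * (indicator B (fst \<omega>) * (\<Prod>k\<in>I. \<psi> k (A k) \<omega>)))"
        using sum_pairs[where N = N and g = "\<lambda>\<omega>. indicator B (fst \<omega>) * (\<Prod>k\<in>I. indicator (A k) (W k \<omega>)) :: real"]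
          sum_pairs[where N = N and g = "\<lambda>\<omega>. indicator B (fst \<omega>) * (\<Prod>k\<in>I. \<psi> k (A k) \<omega>)"]
        by (simp add: W_def \<psi>_def)
    qed
    moreover have "(\<lambda>r. \<Prod>k\<in>I. indicator (A k) (W k (dec r)) :: real) =
        (\<lambda>r. \<Prod>k\<in>I. indicator ((\<lambda>r. W k (dec r)) -` A k \<inter> space ?M) r)"
      by (intro ext prod.cong) (auto simp: indicator_def)
    ultimately show ?thesis by simp
  qed
  have cond_G1: "AE r in ?M. cond_prob_in ?M ?G (\<lambda>r. W k (dec r)) A r = \<psi> k A (dec r)" for k A
    using cond_G[of "{k}" "\<lambda>_. A"] unfolding cond_prob_in_def by simp
  have adapted_d: "adapted_seq ?F ?d" using md unfolding martingale_difference_def by blast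
  have adapted_e: "adapted_seq ?F ?e"
    unfolding adapted_seq_def
  proof (intro allI impI)
    fix n :: nat assume n: "1 \<le> n"
    then obtain k where k: "n = Suc k" by (cases n) auto
    have "W k \<omega> = W k \<omega>'" if "\<omega> \<in> ?\<Omega>" "\<omega>' \<in> ?\<Omega>" "prefixes (Suc k) \<omega> = prefixes (Suc k) \<omega>'" for \<omega> \<omega>'
    proof -
      obtain x y x' y' where [simp]: "\<omega> = (x, y)" "\<omega>' = (x', y')" by (cases \<omega>, cases \<omega>') auto
      have "take (Suc k) x = take (Suc k) x'" "length x = length x'"
        "take (Suc k) y = take (Suc k) y'" "length y = length y'"
        using that by (auto simp: length_words prefixes_def)
      then have "take k x = take k x'" "y ! k = y' ! k" using take_Suc_eqD by blast+
      then show ?thesis unfolding W_def by simp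
    qed
    moreover have "finite (range (\<lambda>r. W k (dec r)))"
      by (rule finite_subset[of _ "W k ` ?\<Omega>"]) (use dec finite_space in auto)
    ultimately show "strongly_measurable (?F n) (?e n)"
      unfolding k diff_Suc_1 using dec
      by (intro simple_function_strongly_measurable simple_function_level_algebra) blast+
  qed
  have tangent: "tangent ?M ?F ?d ?e"
    unfolding tangent_def
  proof (intro conjI adapted_d adapted_e allI impI ballI)
    fix n A
    show "AE r in ?M. cond_prob_in ?M (?F (n - 1)) (?d n) A r = cond_prob_in ?M (?F (n - 1)) (?e n) A r"
      using cond_F[of "D (n - 1)" "n - 1" A] cond_F[of "W (n - 1)" "n - 1" A] by fastforce
  qed
  have CI: "CI_condition ?M ?F ?e"
    unfolding CI_condition_def
  proof (intro conjI adapted_e exI[of _ ?G] allI impI ballI)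
    show "subalgebra (sigma (space ?M) (\<Union>n. sets (?F n))) ?G"
      unfolding subalgebra_def
    proof (intro conjI subsetI)
      fix A assume "A \<in> sets ?G"
      then obtain B where A: "A = (\<lambda>r. fst (dec r)) -` B" unfolding sets_level_algebra by auto
      \<comment> \<open>\<open>?G\<close> looks into the future of \<open>x\<close>, but all of
        \<open>x\<close> is known at time \<open>N\<close>, so \<open>?G\<close> stays within the
        sigma-field generated by the filtration.\<close>
      have "fst (prefixes N (dec r)) = fst (dec r)" for r
        using dec[of r] unfolding prefixes_def by (auto simp: length_words split: prod.splits)
      then have "A = (\<lambda>r. prefixes N (dec r)) -` (fst -` B)" unfolding A by (simp add: vimage_def)
      then have "A \<in> sets (?F N)" unfolding sets_level_algebra by blast
      then show "A \<in> sets (sigma (space ?M) (\<Union>n. sets (?F n)))"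
        by (subst sets_measure_of) auto
    qed simp
    fix n A
    show "AE r in ?M. cond_prob_in ?M (?F (n - 1)) (?e n) A r = cond_prob_in ?M ?G (?e n) A r"
      using cond_F[of "W (n - 1)" "n - 1" A] cond_G1[of "n - 1" A] by fastforce
  next
    fix n and A :: "nat \<Rightarrow> 'x set"
    have "AE r in ?M. \<forall>k\<in>{1..n}. cond_prob_in ?M ?G (?e k) (A k) r = \<psi> (k - 1) (A k) (dec r)"
      using cond_G1 by (intro AE_finite_allI) auto
    moreover have "AE r in ?M. real_cond_exp ?M ?G
        (\<lambda>r. \<Prod>k=1..n. indicator (?e k -` A k \<inter> space ?M) r) r = (\<Prod>k=1..n. \<psi> (k - 1) (A k) (dec r))"
      using cond_G[of "{..<n}" "\<lambda>k. A (Suc k)"] by (simp add: prod.atLeast1_atMost_eq)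
    ultimately show "AE r in ?M. real_cond_exp ?M ?G
        (\<lambda>r. \<Prod>k=1..n. indicator (?e k -` A k \<inter> space ?M) r) r =
        (\<Prod>k=1..n. cond_prob_in ?M ?G (?e k) (A k) r)"
      by eventually_elim simp
  qed
  have "Lp_norm ?M p (\<lambda>r. \<Sum>n=1..N. ?d n r) \<le> C * Lp_norm ?M p (\<lambda>r. \<Sum>n=1..N. ?e n r)"
    by (rule bound[unfolded decoupling_bound_def, THEN spec, THEN spec, THEN spec, THEN spec, THEN spec,
          THEN spec, THEN spec, THEN mp, THEN mp, THEN mp, THEN mp, THEN mp, THEN spec, THEN mp,
          OF basis md _ enlargement_refl[OF basis] _ N])
      (use Lp tangent CI in \<open>auto simp: decoupled_tangent_def\<close>)
  moreover have "Lp_norm ?M p (\<lambda>r. \<Sum>n=1..N. ?d n r) = path_sum v p N powr (1 / p)"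
    using Lp_norm_real_model[OF int, of p "\<lambda>\<omega>. \<Sum>n=1..N. D (n - 1) \<omega>"]
      sum_pairs[where N = N and g = "\<lambda>\<omega>. norm (\<Sum>n=1..N. D (n - 1) \<omega>) powr p"]
    unfolding D_def path_sum_def by (simp add: sum_stopped_value[simplified] e_diagonal)
  moreover have "Lp_norm ?M p (\<lambda>r. \<Sum>n=1..N. ?e n r) = decoupled_sum v p N powr (1 / p)"
    using Lp_norm_real_model[OF int, of p "\<lambda>\<omega>. \<Sum>n=1..N. W (n - 1) \<omega>"]
      sum_pairs[where N = N and g = "\<lambda>\<omega>. norm (\<Sum>n=1..N. W (n - 1) \<omega>) powr p"]
    unfolding W_def decoupled_sum_def by (simp add: sum_stopped_value[simplified])
  ultimately show ?thesis by simp
qed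

end

section \<open>Discretisation\<close>

text \<open>Convexity applied to \<open>a + b = (1 - t) * (a / (1 - t)) + t * (b / t)\<close>.
  Unlike in \<open>powr_add_le\<close>, the factor of the main term \<open>a\<close> tends to
  \<open>1\<close> with \<open>t\<close> tending to \<open>0\<close>; the error \<open>b\<close> is
  made small before that limit. This keeps the constant exact.\<close>

lemma powr_add_split:
  fixes a b t p :: real
  assumes "0 \<le> a" "0 \<le> b" "0 < t" "t < 1" "1 \<le> p"
  shows "(a + b) powr p \<le> (1 - t) powr (1 - p) * a powr p + t powr (1 - p) * b powr p"
proof -
  let ?c = "a + b"
  have *: "s * (x / s) powr p = s powr (1 - p) * x powr p" if "0 < s" for s x :: real
    using that by (simp add: powr_divide powr_diff)
  have "?c powr p = (1 - t) * (?c powr p + p * ?c powr (p - 1) * (a / (1 - t) - ?c)) +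
      t * (?c powr p + p * ?c powr (p - 1) * (b / t - ?c))"
  proof -
    have "(1 - t) * (a / (1 - t) - ?c) + t * (b / t - ?c) = 0"
      using assms by (simp add: field_simps)
    then have "p * ?c powr (p - 1) * ((1 - t) * (a / (1 - t) - ?c) + t * (b / t - ?c)) = 0" by simp
    then show ?thesis by (simp only: algebra_simps)
  qed
  also have "\<dots> \<le> (1 - t) * (a / (1 - t)) powr p + t * (b / t) powr p"
    using assms by (intro add_mono mult_left_mono powr_tangent_le) auto
  also have "\<dots> = (1 - t) powr (1 - p) * a powr p + t powr (1 - p) * b powr p"
    using assms by (simp add: *)
  finally show ?thesis .
qed

lemma sum_powr_le:
  fixes a :: "'i \<Rightarrow> real"
  assumes "finite J" "\<And>j. j \<in> J \<Longrightarrow> 0 \<le> a j" "0 \<le> p"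
  shows "(\<Sum>j\<in>J. a j) powr p \<le> real (card J) powr p * (\<Sum>j\<in>J. a j powr p)"
proof (cases "J = {}")
  case False
  define m where "m = Max (a ` J)"
  have "m \<in> a ` J" unfolding m_def using assms False by (intro Max_in) auto
  then obtain j where j: "j \<in> J" "m = a j" by blast
  have "(\<Sum>j\<in>J. a j) \<le> real (card J) * m"
    using assms unfolding m_def by (intro sum_bounded_above) auto
  then have "(\<Sum>j\<in>J. a j) powr p \<le> (real (card J) * m) powr p"
    using assms by (intro powr_mono2 sum_nonneg) auto
  also have "\<dots> = real (card J) powr p * a j powr p" by (simp add: powr_mult j)
  also have "\<dots> \<le> real (card J) powr p * (\<Sum>j\<in>J. a j powr p)"
    using j assms by (intro mult_left_mono member_le_sum) auto
  finally show ?thesis .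
qed simp

section \<open>Strongly measurable functions and their integral\<close>

lemma strongly_measurable_borel:
  assumes "strongly_measurable M f"
  shows "f \<in> borel_measurable M"
proof -
  obtain s where s: "\<And>i. simple_function M (s i)"
    "\<And>\<omega>. \<omega> \<in> space M \<Longrightarrow> (\<lambda>i::nat. s i \<omega>) \<longlonglongrightarrow> f \<omega>"
    using assms unfolding strongly_measurable_def by blast
  show ?thesis
    by (rule borel_measurable_LIMSEQ_metric[OF borel_measurable_simple_function[OF s(1)] s(2)])
qed

lemma strongly_measurable_norm:
  "strongly_measurable M f \<Longrightarrow> (\<lambda>\<omega>. norm (f \<omega>)) \<in> borel_measurable M"
  using measurable_compose[OF strongly_measurable_borel borel_measurable_continuous_onI]
  by (auto intro: continuous_intros)

lemma strongly_measurable_compose2: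
  assumes f: "strongly_measurable M f" and g: "strongly_measurable M g"
    and h: "\<And>X Y x y. X \<longlonglongrightarrow> x \<Longrightarrow> Y \<longlonglongrightarrow> y \<Longrightarrow> (\<lambda>i::nat. h (X i) (Y i)) \<longlonglongrightarrow> h x y"
  shows "strongly_measurable M (\<lambda>\<omega>. h (f \<omega>) (g \<omega>))"
proof -
  obtain s where s: "\<And>i. simple_function M (s i)"
    "\<And>\<omega>. \<omega> \<in> space M \<Longrightarrow> (\<lambda>i::nat. s i \<omega>) \<longlonglongrightarrow> f \<omega>"
    using f unfolding strongly_measurable_def by blast
  obtain r where r: "\<And>i. simple_function M (r i)"
    "\<And>\<omega>. \<omega> \<in> space M \<Longrightarrow> (\<lambda>i::nat. r i \<omega>) \<longlonglongrightarrow> g \<omega>"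
    using g unfolding strongly_measurable_def by blast
  show ?thesis
    unfolding strongly_measurable_def
  proof (intro exI conjI allI ballI)
    show "simple_function M (\<lambda>\<omega>. h (s i \<omega>) (r i \<omega>))" for i
      by (rule simple_function_compose2[OF s(1) r(1)])
    show "(\<lambda>i. h (s i \<omega>) (r i \<omega>)) \<longlonglongrightarrow> h (f \<omega>) (g \<omega>)" if "\<omega> \<in> space M" for \<omega>
      by (rule h[OF s(2)[OF that] r(2)[OF that]])
  qed
qed

lemmas strongly_measurable_add = strongly_measurable_compose2[where h = "(+)", OF _ _ tendsto_add]
lemmas strongly_measurable_diff = strongly_measurable_compose2[where h = "(-)", OF _ _ tendsto_diff]

lemma strongly_measurable_sum:
  "finite I \<Longrightarrow> (\<And>i. i \<in> I \<Longrightarrow> strongly_measurable M (f i)) \<Longrightarrow>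
    strongly_measurable M (\<lambda>\<omega>. \<Sum>i\<in>I. f i \<omega>)"
proof (induction I rule: finite_induct)
  case empty
  show ?case by (intro simple_function_strongly_measurable) simp
next
  case (insert i I)
  then have "strongly_measurable M (\<lambda>\<omega>. f i \<omega> + (\<Sum>i\<in>I. f i \<omega>))"
    by (intro strongly_measurable_add) auto
  then show ?case using insert by simp
qed

lemma strongly_measurable_subalgebra:
  assumes "strongly_measurable H f" "subalgebra M H"
  shows "strongly_measurable M f"
proof -
  obtain s where s: "\<And>i. simple_function H (s i)"
    "\<And>\<omega>. \<omega> \<in> space H \<Longrightarrow> (\<lambda>i::nat. s i \<omega>) \<longlonglongrightarrow> f \<omega>"
    using assms unfolding strongly_measurable_def by blast
  have "simple_function M (s i)" for i
    using s(1)[of i] assms(2) unfolding simple_function_def subalgebra_def by auto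
  then show ?thesis
    unfolding strongly_measurable_def using s(2) assms(2) unfolding subalgebra_def by metis
qed

text \<open>\<open>u\<close> is compared with the simple functions approximating \<open>g\<close>,
  followed by passage to the limit. For \<open>u = 0\<close> and \<open>g = 0\<close> this shows
  that \<open>0\<close> is the only integral of the zero function, which the existential definition
  does not say.\<close>

lemma has_strong_integral_simple_approx:
  assumes g: "has_strong_integral M g x"
    and u: "Bochner_Integration.simple_bochner_integrable M u"
  shows "ennreal (norm (Bochner_Integration.simple_bochner_integral M u - x)) \<le>
    (\<integral>\<^sup>+\<omega>. norm (u \<omega> - g \<omega>) \<partial>M)"
proof -
  let ?I = "Bochner_Integration.simple_bochner_integral M"
  obtain s where gm: "strongly_measurable M g"
    and s: "\<And>i. Bochner_Integration.simple_bochner_integrable M (s i)"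
    and lim: "(\<lambda>i::nat. \<integral>\<^sup>+ \<omega>. norm (g \<omega> - s i \<omega>) \<partial>M) \<longlonglongrightarrow> 0" "(\<lambda>i. ?I (s i)) \<longlonglongrightarrow> x"
    using g unfolding has_strong_integral_def by blast
  have sf: "strongly_measurable M (s i)" "strongly_measurable M u" for i
    using s[of i] u by (auto intro: simple_function_strongly_measurable
        elim: Bochner_Integration.simple_bochner_integrable.cases)
  have m1 [measurable]: "(\<lambda>\<omega>. norm (u \<omega> - g \<omega>)) \<in> borel_measurable M"
    by (rule strongly_measurable_norm[OF strongly_measurable_diff[OF sf(2) gm]])
  have m2 [measurable]: "(\<lambda>\<omega>. norm (g \<omega> - s i \<omega>)) \<in> borel_measurable M" for i
    by (rule strongly_measurable_norm[OF strongly_measurable_diff[OF gm sf(1)]])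
  have le: "ennreal (norm (?I u - ?I (s i))) \<le>
      (\<integral>\<^sup>+\<omega>. norm (u \<omega> - g \<omega>) \<partial>M) + (\<integral>\<^sup>+ \<omega>. norm (g \<omega> - s i \<omega>) \<partial>M)" for i
  proof -
    have "ennreal (norm (?I u - ?I (s i))) = norm (?I (\<lambda>\<omega>. u \<omega> - s i \<omega>))"
      using s u by (subst simple_bochner_integral_diff) auto
    also have "\<dots> \<le> ?I (\<lambda>\<omega>. norm (u \<omega> - s i \<omega>))"
      using simple_bochner_integrable_compose2[of "(-)" M u "s i"] s u
      by (auto intro!: simple_bochner_integral_norm_bound ennreal_leI)
    also have "\<dots> = (\<integral>\<^sup>+\<omega>. norm (u \<omega> - s i \<omega>) \<partial>M)"
      using simple_bochner_integrable_compose2[of "\<lambda>x y. norm (x - y)" M u "s i"] s u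
      by (auto intro!: simple_bochner_integral_eq_nn_integral)
    also have "\<dots> \<le> (\<integral>\<^sup>+\<omega>. ennreal (norm (u \<omega> - g \<omega>)) + ennreal (norm (g \<omega> - s i \<omega>)) \<partial>M)"
    proof (rule nn_integral_mono)
      fix \<omega>
      have "norm (u \<omega> - s i \<omega>) \<le> norm (u \<omega> - g \<omega>) + norm (g \<omega> - s i \<omega>)"
        using norm_triangle_ineq[of "u \<omega> - g \<omega>" "g \<omega> - s i \<omega>"] by simp
      then show "ennreal (norm (u \<omega> - s i \<omega>)) \<le> ennreal (norm (u \<omega> - g \<omega>)) + ennreal (norm (g \<omega> - s i \<omega>))"
        by (simp add: ennreal_leI flip: ennreal_plus)
    qed
    also have "\<dots> = (\<integral>\<^sup>+\<omega>. norm (u \<omega> - g \<omega>) \<partial>M) + (\<integral>\<^sup>+ \<omega>. norm (g \<omega> - s i \<omega>) \<partial>M)"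
      by (rule nn_integral_add) auto
    finally show ?thesis .
  qed
  have "(\<lambda>i. ennreal (norm (?I u - ?I (s i)))) \<longlonglongrightarrow> ennreal (norm (?I u - x))"
    by (intro tendsto_intros lim)
  moreover have "(\<lambda>i. (\<integral>\<^sup>+\<omega>. norm (u \<omega> - g \<omega>) \<partial>M) + (\<integral>\<^sup>+ \<omega>. norm (g \<omega> - s i \<omega>) \<partial>M))
      \<longlonglongrightarrow> (\<integral>\<^sup>+\<omega>. norm (u \<omega> - g \<omega>) \<partial>M) + 0"
    by (intro tendsto_add tendsto_const lim)
  ultimately show ?thesis
    using LIMSEQ_le[of _ _ _ "(\<integral>\<^sup>+\<omega>. norm (u \<omega> - g \<omega>) \<partial>M) + 0"] le by fastforce
qed

text \<open>Rounding destroys the mean zero property, but only up to the rounding error: the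
  integral of \<open>g\<close> over \<open>B\<close> vanishes, so that of the rounded function is
  bounded by the integral of the difference.\<close>

lemma cond_exp_zero_discretization:
  fixes g :: "'w \<Rightarrow> 'x::banach" and c :: "nat \<Rightarrow> 'x" and i :: "'w \<Rightarrow> nat"
  assumes M: "prob_space M" and H: "subalgebra M H" and ce: "is_cond_exp M H g (\<lambda>_. 0)"
    and B: "B \<in> sets H" and i: "i \<in> measurable M (count_space UNIV)" and im: "\<And>\<omega>. i \<omega> \<le> m"
    and int: "integrable M (\<lambda>\<omega>. norm (c (i \<omega>) - g \<omega>))"
  shows "norm (\<Sum>j\<le>m. measure M {\<omega>\<in>B. i \<omega> = j} *\<^sub>R c j) \<le>
    (\<integral>\<omega>. indicator B \<omega> * norm (c (i \<omega>) - g \<omega>) \<partial>M)"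
proof -
  interpret prob_space M by (rule M)
  let ?I = "Bochner_Integration.simple_bochner_integral M"
  have BM: "B \<in> sets M" using B H unfolding subalgebra_def by blast
  have Bs: "B \<subseteq> space M" using BM by (rule sets.sets_into_space)
  define u where "u \<omega> = indicator B \<omega> *\<^sub>R c (i \<omega>)" for \<omega>
  have sf_i: "simple_function M i"
    unfolding simple_function_def
  proof (intro conjI ballI)
    show "finite (i ` space M)" by (rule finite_subset[of _ "{..m}"]) (auto simp: im)
    show "i -` {x} \<inter> space M \<in> sets M" for x by (rule measurable_sets[OF i]) simp
  qed
  have sf_B: "simple_function M (indicator B :: 'w \<Rightarrow> real)" by (rule simple_function_indicator[OF BM])
  have sf_u: "simple_function M u"
    unfolding u_def using simple_function_compose2[OF sf_B sf_i, of "\<lambda>b j. b *\<^sub>R c j"] .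
  have u: "Bochner_Integration.simple_bochner_integrable M u"
    using sf_u by (auto simp: Bochner_Integration.simple_bochner_integrable.simps)
  have zero: "Bochner_Integration.simple_bochner_integrable M (\<lambda>_. 0 :: 'x)"
    by (auto simp: Bochner_Integration.simple_bochner_integrable.simps)
  obtain x where x: "has_strong_integral M (\<lambda>\<omega>. indicator B \<omega> *\<^sub>R g \<omega>) x"
    "has_strong_integral M (\<lambda>\<omega>. indicator B \<omega> *\<^sub>R (0 :: 'x)) x"
    using ce B unfolding is_cond_exp_def by blast
  have "x = 0"
    using has_strong_integral_simple_approx[OF x(2) zero]
    by (simp add: Bochner_Integration.simple_bochner_integral_def image_constant_conv split: if_splits)
  have "?I u = (\<Sum>j\<le>m. measure M {\<omega>\<in>B. i \<omega> = j} *\<^sub>R c j)"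
  proof -
    have "?I u = (\<Sum>y\<in>(\<lambda>\<omega>. (indicator B \<omega> :: real, i \<omega>)) ` space M.
        measure M {\<omega>\<in>space M. (indicator B \<omega>, i \<omega>) = y} *\<^sub>R (fst y *\<^sub>R c (snd y)))"
      using simple_function_Pair[OF sf_B sf_i]
      by (intro simple_bochner_integral_partition[OF u]) (auto simp: u_def)
    also have "\<dots> = (\<Sum>y\<in>{0, 1} \<times> {..m}.
        measure M {\<omega>\<in>space M. (indicator B \<omega>, i \<omega>) = y} *\<^sub>R (fst y *\<^sub>R c (snd y)))"
    proof (rule sum.mono_neutral_left)
      show "\<forall>y\<in>{0, 1} \<times> {..m} - (\<lambda>\<omega>. (indicator B \<omega> :: real, i \<omega>)) ` space M.
        measure M {\<omega>\<in>space M. (indicator B \<omega>, i \<omega>) = y} *\<^sub>R (fst y *\<^sub>R c (snd y)) = 0"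
      proof
        fix y assume "y \<in> {0, 1} \<times> {..m} - (\<lambda>\<omega>. (indicator B \<omega> :: real, i \<omega>)) ` space M"
        then have "{\<omega>\<in>space M. (indicator B \<omega>, i \<omega>) = y} = {}" by blast
        then show "measure M {\<omega>\<in>space M. (indicator B \<omega>, i \<omega>) = y} *\<^sub>R (fst y *\<^sub>R c (snd y)) = 0"
          by (simp only: measure_empty scaleR_zero_left)
      qed
    qed (auto simp: im indicator_def)
    also have "\<dots> = (\<Sum>b\<in>{0, 1}. \<Sum>j\<le>m.
        measure M {\<omega>\<in>space M. indicator B \<omega> = (b :: real) \<and> i \<omega> = j} *\<^sub>R (b *\<^sub>R c j))"
      by (simp add: sum.cartesian_product case_prod_unfold prod_eq_iff)
    also have "\<dots> = (\<Sum>j\<le>m. measure M {\<omega>\<in>space M. indicator B \<omega> = (1 :: real) \<and> i \<omega> = j} *\<^sub>R c j)"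
      by simp
    also have "\<dots> = (\<Sum>j\<le>m. measure M {\<omega>\<in>B. i \<omega> = j} *\<^sub>R c j)"
      using Bs by (intro sum.cong refl arg_cong2[where f = scaleR] arg_cong[where f = "measure M"])
        (auto simp: indicator_def split: if_splits)
    finally show ?thesis .
  qed
  then have "ennreal (norm (\<Sum>j\<le>m. measure M {\<omega>\<in>B. i \<omega> = j} *\<^sub>R c j)) \<le>
      (\<integral>\<^sup>+\<omega>. norm (u \<omega> - indicator B \<omega> *\<^sub>R g \<omega>) \<partial>M)"
    using has_strong_integral_simple_approx[OF x(1) u] \<open>x = 0\<close> by simp
  also have "\<dots> = (\<integral>\<^sup>+\<omega>. indicator B \<omega> * norm (c (i \<omega>) - g \<omega>) \<partial>M)"
    by (intro nn_integral_cong) (auto simp: u_def indicator_def)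
  also have "\<dots> = ennreal (\<integral>\<omega>. indicator B \<omega> * norm (c (i \<omega>) - g \<omega>) \<partial>M)"
    using integrable_real_mult_indicator[OF BM int] 
    by (intro nn_integral_eq_integral) (auto simp: mult.commute)
  finally show ?thesis
    by (subst (asm) ennreal_le_iff) (auto intro!: integral_nonneg)
qed

text \<open>\<open>\<iota> x\<close> selects a nearest point to \<open>x\<close> among the first
  \<open>m + 1\<close> points of a countable set whose closure contains the ranges of the
  \<open>g k\<close>. It depends on the value \<open>x\<close> alone, so the same rounding applies
  to the decoupled sequence.\<close>

lemma nearest_point_discretization:
  fixes g :: "nat \<Rightarrow> 'w \<Rightarrow> 'x::banach"
  assumes M: "prob_space M" and p: "1 \<le> p" and J: "finite J"
    and g: "\<And>k. k \<in> J \<Longrightarrow> bochner_Lp M p (g k)" and \<eta>: "0 < \<eta>"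
  obtains m :: nat and c :: "nat \<Rightarrow> 'x" and \<iota> :: "'x \<Rightarrow> nat"
  where "\<iota> \<in> measurable borel (count_space UNIV)" "\<And>x. \<iota> x \<le> m" "\<And>x. norm (c (\<iota> x) - x) \<le> norm x"
    "\<And>k. k \<in> J \<Longrightarrow> (\<integral>\<omega>. norm (c (\<iota> (g k \<omega>)) - g k \<omega>) powr p \<partial>M) \<le> \<eta>"
proof -
  interpret prob_space M by (rule M)
  have gm: "strongly_measurable M (g k)" "integrable M (\<lambda>\<omega>. norm (g k \<omega>) powr p)" if "k \<in> J" for k
    using g[OF that] unfolding bochner_Lp_def by auto
  have "\<forall>k\<in>J. \<exists>s. (\<forall>i. simple_function M (s i)) \<and> (\<forall>\<omega>\<in>space M. (\<lambda>i::nat. s i \<omega>) \<longlonglongrightarrow> g k \<omega>)"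
    using gm(1) unfolding strongly_measurable_def by blast
  then obtain s where "\<forall>k\<in>J. (\<forall>i. simple_function M (s k i)) \<and>
      (\<forall>\<omega>\<in>space M. (\<lambda>i::nat. s k i \<omega>) \<longlonglongrightarrow> g k \<omega>)"
    by (rule bchoice[THEN exE])
  then have s: "simple_function M (s k i)" "\<omega> \<in> space M \<Longrightarrow> (\<lambda>i. s k i \<omega>) \<longlonglongrightarrow> g k \<omega>"
    if "k \<in> J" for k i \<omega>
    using that by auto
  define A where "A = insert 0 (\<Union>k\<in>J. \<Union>i. s k i ` space M)"
  have "countable (\<Union>i. s k i ` space M)" if "k \<in> J" for k
  proof (rule countable_UN)
    show "countable (s k i ` space M)" for i
      using s(1)[OF that] unfolding simple_function_def by (intro countable_finite) blast
  qed simp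
  then have A: "countable A"
    unfolding A_def by (intro countable_insert countable_UN[OF countable_finite[OF J]])
  \<comment> \<open>The point \<open>0\<close> comes first, so rounding moves \<open>x\<close> by at
    most \<open>norm x\<close>; this dominates the errors in the convergence theorem.\<close>
  define c where "c n = (case n of 0 \<Rightarrow> 0 | Suc n \<Rightarrow> from_nat_into A n)" for n
  have c_range: "\<exists>n. c n = x" if "x \<in> A" for x
    using from_nat_into_surj[OF A that] unfolding c_def by (metis nat.case(2))
  \<comment> \<open>Taking the least index resolves ties and keeps the rounding Borel
    measurable.\<close>
  define \<iota> where "\<iota> m x = (LEAST i. i \<le> m \<and> (\<forall>j\<in>{..m}. norm (c i - x) \<le> norm (c j - x)))" for m x
  have ex: "\<exists>i. i \<le> m \<and> (\<forall>j\<in>{..m}. norm (c i - x) \<le> norm (c j - x))" for m x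
  proof -
    have "\<exists>i\<in>{..m}. \<forall>j\<in>{..m}. norm (c i - x) \<le> norm (c j - x)"
      using arg_min_if_finite(1)[of "{..m}" "\<lambda>j. norm (c j - x)"]
        arg_min_least[of "{..m}" _ "\<lambda>j. norm (c j - x)"] by (metis atMost_iff empty_iff finite_atMost le0)
    then show ?thesis by auto
  qed
  have iota: "\<iota> m x \<le> m" "j \<le> m \<Longrightarrow> norm (c (\<iota> m x) - x) \<le> norm (c j - x)" for m x j
    using LeastI_ex[OF ex[of m x]] unfolding \<iota>_def by auto
  have near: "norm (c (\<iota> m x) - x) \<le> norm x" for m x
    using iota(2)[of 0 m x] by (simp add: c_def)
  have iota_meas: "\<iota> m \<in> measurable borel (count_space UNIV)" for m
  proof -
    have [measurable]: "(\<lambda>x. norm (c i - x)) \<in> borel_measurable borel" for i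
      by (intro borel_measurable_continuous_onI continuous_intros)
    show ?thesis unfolding \<iota>_def by measurable
  qed
  have lim: "(\<lambda>m. norm (c (\<iota> m (g k \<omega>)) - g k \<omega>)) \<longlonglongrightarrow> 0" if k: "k \<in> J" and w: "\<omega> \<in> space M" for k \<omega>
  proof (rule LIMSEQ_I)
    fix r :: real assume "0 < r"
    then obtain i where i: "norm (s k i \<omega> - g k \<omega>) < r"
      using LIMSEQ_D[OF s(2)[OF k w]] by blast
    have "s k i \<omega> \<in> A" unfolding A_def using k w by auto
    then obtain n where n: "c n = s k i \<omega>" using c_range by blast
    have "norm (norm (c (\<iota> m (g k \<omega>)) - g k \<omega>) - 0) < r" if "n \<le> m" for m
      using iota(2)[OF that, of "g k \<omega>"] i n by simp
    then show "\<exists>no. \<forall>m\<ge>no. norm (norm (c (\<iota> m (g k \<omega>)) - g k \<omega>) - 0) < r" by blast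
  qed
  have meas: "(\<lambda>\<omega>. norm (c (\<iota> m (g k \<omega>)) - g k \<omega>)) \<in> borel_measurable M" if k: "k \<in> J" for k m
  proof -
    have "(\<lambda>x. norm (c i - x)) \<in> borel_measurable borel" for i
      by (intro borel_measurable_continuous_onI continuous_intros)
    then have "(\<lambda>x. norm (c (\<iota> m x) - x)) \<in> borel_measurable borel"
      by (rule measurable_compose_countable[OF _ iota_meas])
    then show ?thesis by (rule measurable_compose[OF strongly_measurable_borel[OF gm(1)[OF k]]])
  qed
  have "(\<lambda>m. \<integral>\<omega>. norm (c (\<iota> m (g k \<omega>)) - g k \<omega>) powr p \<partial>M) \<longlonglongrightarrow> (\<integral>\<omega>. 0 \<partial>M)" if k: "k \<in> J" for k
  proof (rule integral_dominated_convergence)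
    show "AE \<omega> in M. (\<lambda>m. norm (c (\<iota> m (g k \<omega>)) - g k \<omega>) powr p) \<longlonglongrightarrow> 0"
    proof (rule AE_I2)
      fix \<omega> assume "\<omega> \<in> space M"
      from tendsto_powr'[OF lim[OF k this] tendsto_const[of p]]
      show "(\<lambda>m. norm (c (\<iota> m (g k \<omega>)) - g k \<omega>) powr p) \<longlonglongrightarrow> 0" using p by simp
    qed
    show "AE \<omega> in M. norm (norm (c (\<iota> m (g k \<omega>)) - g k \<omega>) powr p) \<le> norm (g k \<omega>) powr p" for m
      using near p by (intro AE_I2) (simp add: powr_mono2)
  qed (use gm(2)[OF k] meas[OF k] in auto)
  then have "\<forall>\<^sub>F m in sequentially. (\<integral>\<omega>. norm (c (\<iota> m (g k \<omega>)) - g k \<omega>) powr p \<partial>M) < \<eta>" if "k \<in> J" for k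
    using that \<eta> by (intro order_tendstoD(2)[where y = 0]) auto
  then have "\<forall>\<^sub>F m in sequentially. \<forall>k\<in>J. (\<integral>\<omega>. norm (c (\<iota> m (g k \<omega>)) - g k \<omega>) powr p \<partial>M) < \<eta>"
    using J by (intro eventually_ball_finite) auto
  then obtain m where m: "\<forall>k\<in>J. (\<integral>\<omega>. norm (c (\<iota> m (g k \<omega>)) - g k \<omega>) powr p \<partial>M) < \<eta>"
    unfolding eventually_sequentially by blast
  show thesis
    by (rule that[of "\<iota> m" m c]) (use iota_meas iota near m in \<open>auto intro: less_imp_le\<close>)
qed

section \<open>The law of the decoupled sequence\<close>

lemma stochastic_basisD:
  assumes "stochastic_basis M F"
  shows "prob_space M" "subalgebra M (F n)" "space (F n) = space M"
    "m \<le> n \<Longrightarrow> sets (F m) \<subseteq> sets (F n)"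
  using assms unfolding stochastic_basis_def filtration_def subalgebra_def by auto

lemma expectation_cond_prob_in:
  assumes M: "prob_space M" and H: "subalgebra M H" and f: "f \<in> borel_measurable M" and A: "A \<in> sets borel"
  shows "(\<integral>\<omega>. cond_prob_in M H f A \<omega> \<partial>M) = measure M (f -` A \<inter> space M)"
proof -
  interpret prob_space M by (rule M)
  interpret finite_measure_subalgebra M H by unfold_locales (rule H)
  have "f -` A \<inter> space M \<in> sets M" by (rule measurable_sets[OF f A])
  then have "integrable M (indicator (f -` A \<inter> space M) :: _ \<Rightarrow> real)"
    by (intro integrable_real_indicator) (auto simp: emeasure_eq_measure)
  from real_cond_exp_int(2)[OF this] show ?thesis unfolding cond_prob_in_def by simp
qed

context
  fixes M :: "'w measure" and F and M' :: "'v measure" and F' and f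
    and d :: "nat \<Rightarrow> 'w \<Rightarrow> 'x::banach" and e :: "nat \<Rightarrow> 'v \<Rightarrow> 'x"
  assumes enl: "enlargement M F M' F' f" and dt: "decoupled_tangent M' F' (\<lambda>n \<omega>. d n (f \<omega>)) e"
    and ad: "adapted_seq F d"
begin

lemma enl_facts: "stochastic_basis M F" "stochastic_basis M' F'" "f \<in> measurable M' M" "distr M' M f = M"
  using enl unfolding enlargement_def by auto

lemma d_borel: "1 \<le> n \<Longrightarrow> d n \<in> borel_measurable (F n)" "1 \<le> n \<Longrightarrow> d n \<in> borel_measurable M"
  using ad strongly_measurable_borel strongly_measurable_subalgebra stochastic_basisD(2)[OF enl_facts(1)]
  unfolding adapted_seq_def by blast+

lemma e_strong: "1 \<le> n \<Longrightarrow> strongly_measurable M' (e n)"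
  using dt strongly_measurable_subalgebra stochastic_basisD(2)[OF enl_facts(2)]
  unfolding decoupled_tangent_def tangent_def adapted_seq_def by blast

text \<open>Tangency leads from \<open>e\<close> to the lifted \<open>d\<close> on the enlarged
  space; the last clause of \<open>enlargement\<close>, applied to an event of \<open>F n\<close>,
  leads from there to the original space.\<close>

lemma tangent_cond_prob:
  assumes n: "1 \<le> n" and A: "A \<in> sets borel"
  shows "AE \<omega> in M'. cond_prob_in M' (F' (n - 1)) (e n) A \<omega> = cond_prob_in M (F (n - 1)) (d n) A (f \<omega>)"
proof -
  have 1: "AE \<omega> in M'. cond_prob_in M' (F' (n - 1)) (\<lambda>\<omega>. d n (f \<omega>)) A \<omega> = cond_prob_in M' (F' (n - 1)) (e n) A \<omega>"
    using dt n A unfolding decoupled_tangent_def tangent_def by blast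
  let ?B = "d n -` A \<inter> space M"
  have "?B \<in> sets (F n)"
    using measurable_sets[OF d_borel(1)[OF n] A] stochastic_basisD(3)[OF enl_facts(1)] by simp
  then have B: "?B \<in> sets (F (Suc (n - 1)))" using n by simp
  have "AE \<omega> in M'. real_cond_exp M' (F' (n - 1)) (indicator (f -` ?B \<inter> space M')) \<omega> =
      real_cond_exp M (F (n - 1)) (indicator ?B) (f \<omega>)"
    using enl B unfolding enlargement_def by blast
  moreover have "f -` ?B \<inter> space M' = (\<lambda>\<omega>. d n (f \<omega>)) -` A \<inter> space M'"
    using measurable_space[OF enl_facts(3)] by auto
  ultimately have "AE \<omega> in M'. cond_prob_in M' (F' (n - 1)) (\<lambda>\<omega>. d n (f \<omega>)) A \<omega> =
      cond_prob_in M (F (n - 1)) (d n) A (f \<omega>)"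
    unfolding cond_prob_in_def by simp
  with 1 show ?thesis by eventually_elim simp
qed

text \<open>Conditioning on \<open>G\<close> yields a product. Each factor is also the conditional
  probability given \<open>F' (k - 1)\<close>, hence by tangency a function on \<open>M\<close>
  composed with \<open>f\<close>, and \<open>distr M' M f = M\<close> carries the expectation back
  to \<open>M\<close>.\<close>

lemma decoupled_joint_law:
  assumes N: "1 \<le> N" and A: "\<And>k. k \<in> {1..N} \<Longrightarrow> A k \<in> sets borel"
  shows "measure M' {\<omega>\<in>space M'. \<forall>k\<in>{1..N}. e k \<omega> \<in> A k} =
    (\<integral>\<omega>. (\<Prod>k=1..N. cond_prob_in M (F (k - 1)) (d k) (A k) \<omega>) \<partial>M)"
proof -
  interpret P': prob_space M' using stochastic_basisD(1)[OF enl_facts(2)] .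
  obtain G where G: "subalgebra (sigma (space M') (\<Union>n. sets (F' n))) G"
    and G1: "\<And>n A. 1 \<le> n \<Longrightarrow> A \<in> sets borel \<Longrightarrow> AE \<omega> in M'.
         cond_prob_in M' (F' (n - 1)) (e n) A \<omega> = cond_prob_in M' G (e n) A \<omega>"
    and G2: "\<And>n A. 1 \<le> n \<Longrightarrow> (\<forall>k\<in>{1..n}. A k \<in> sets borel) \<Longrightarrow> AE \<omega> in M'.
            real_cond_exp M' G (\<lambda>\<omega>'. \<Prod>k=1..n. indicator (e k -` A k \<inter> space M') \<omega>') \<omega> =
            (\<Prod>k=1..n. cond_prob_in M' G (e k) (A k) \<omega>)"
    using dt unfolding decoupled_tangent_def CI_condition_def by auto
  have sub: "(\<Union>n. sets (F' n)) \<subseteq> sets M'"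
    using stochastic_basisD(2)[OF enl_facts(2)] unfolding subalgebra_def by auto
  then have "(\<Union>n. sets (F' n)) \<subseteq> Pow (space M')" using sets.space_closed by auto
  then have "sets (sigma (space M') (\<Union>n. sets (F' n))) \<subseteq> sets M'"
    using sets.sigma_sets_subset[OF sub] by (simp add: sets_measure_of)
  then have "subalgebra M' G" using G unfolding subalgebra_def by (auto simp: space_measure_of_conv)
  then interpret finite_measure_subalgebra M' G by unfold_locales
  have ek: "e k -` A k \<inter> space M' \<in> sets M'" if "k \<in> {1..N}" for k
    using that by (intro measurable_sets[OF strongly_measurable_borel[OF e_strong]] A) auto
  let ?Z = "\<lambda>\<omega>'. \<Prod>k=1..N. indicator (e k -` A k \<inter> space M') \<omega>' :: real"
  let ?S = "{\<omega>\<in>space M'. \<forall>k\<in>{1..N}. e k \<omega> \<in> A k}"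
  have S: "?S \<in> sets M'"
  proof -
    have "?S = (\<Inter>k\<in>{1..N}. e k -` A k \<inter> space M')" using N by auto
    also have "\<dots> \<in> sets M'" using N by (intro sets.finite_INT ek) auto
    finally show ?thesis .
  qed
  have Z: "?Z \<omega> = indicator ?S \<omega>" if w: "\<omega> \<in> space M'" for \<omega>
  proof (cases "\<omega> \<in> ?S")
    case False
    then obtain k where "k \<in> {1..N}" "e k \<omega> \<notin> A k" using w by blast
    then show ?thesis using False by (auto intro!: prod_zero bexI[of _ k])
  qed simp
  have Zint: "integrable M' ?Z"
    using S by (subst Bochner_Integration.integrable_cong[OF refl Z])
      (auto intro!: integrable_real_indicator simp: P'.emeasure_eq_measure)
  have "measure M' ?S = (\<integral>\<omega>. ?Z \<omega> \<partial>M')"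
    using S Z by (subst Bochner_Integration.integral_cong[OF refl Z]) auto
  also have "\<dots> = (\<integral>\<omega>. real_cond_exp M' G ?Z \<omega> \<partial>M')"
    by (rule real_cond_exp_int(2)[OF Zint, symmetric])
  also have "\<dots> = (\<integral>\<omega>. (\<Prod>k=1..N. cond_prob_in M (F (k - 1)) (d k) (A k) (f \<omega>)) \<partial>M')"
  proof (rule integral_cong_AE)
    have [measurable]: "f \<in> measurable M' M" by (rule enl_facts(3))
    have meas [measurable]: "cond_prob_in M H g B \<in> borel_measurable M" for H g B
      unfolding cond_prob_in_def by (rule borel_measurable_cond_exp2)
    show "(\<lambda>\<omega>. \<Prod>k=1..N. cond_prob_in M (F (k - 1)) (d k) (A k) (f \<omega>)) \<in> borel_measurable M'"
      by measurable
    show "real_cond_exp M' G ?Z \<in> borel_measurable M'" by (rule borel_measurable_cond_exp2)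
    have "AE \<omega> in M'. \<forall>k\<in>{1..N}. cond_prob_in M' G (e k) (A k) \<omega> =
        cond_prob_in M (F (k - 1)) (d k) (A k) (f \<omega>)"
    proof (rule AE_finite_allI)
      fix k assume k: "k \<in> {1..N}"
      then show "AE \<omega> in M'. cond_prob_in M' G (e k) (A k) \<omega> = cond_prob_in M (F (k - 1)) (d k) (A k) (f \<omega>)"
        using G1[of k "A k"] tangent_cond_prob[of k "A k"] A[OF k] by fastforce
    qed simp
    with G2[OF N, of A] A
    show "AE \<omega> in M'. real_cond_exp M' G ?Z \<omega> =
        (\<Prod>k=1..N. cond_prob_in M (F (k - 1)) (d k) (A k) (f \<omega>))"
      by (auto elim!: eventually_elim2 intro!: prod.cong)
  qed
  also have "\<dots> = (\<integral>\<omega>. (\<Prod>k=1..N. cond_prob_in M (F (k - 1)) (d k) (A k) \<omega>) \<partial>distr M' M f)"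
  proof (rule integral_distr[symmetric, OF enl_facts(3)])
    have [measurable]: "cond_prob_in M H g B \<in> borel_measurable M" for H g B
      unfolding cond_prob_in_def by (rule borel_measurable_cond_exp2)
    show "(\<lambda>\<omega>. \<Prod>k=1..N. cond_prob_in M (F (k - 1)) (d k) (A k) \<omega>) \<in> borel_measurable M" by measurable
  qed
  finally show ?thesis unfolding enl_facts(4) .
qed

text \<open>Equal conditional probabilities have equal expectations. Hence the rounding errors of
  \<open>e\<close> are as small as those of \<open>d\<close>.\<close>

lemma distr_e_eq_d:
  assumes n: "1 \<le> n"
  shows "distr M' borel (e n) = distr M borel (d n)"
proof (rule measure_eqI)
  interpret P: prob_space M using stochastic_basisD(1)[OF enl_facts(1)] .
  interpret P': prob_space M' using stochastic_basisD(1)[OF enl_facts(2)] .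
  have em: "e n \<in> borel_measurable M'" by (rule strongly_measurable_borel[OF e_strong[OF n]])
  fix A assume "A \<in> sets (distr M' borel (e n))"
  then have A: "A \<in> sets borel" by simp
  have [measurable]: "cond_prob_in M H g B \<in> borel_measurable M" for H g B
    unfolding cond_prob_in_def by (rule borel_measurable_cond_exp2)
  have [measurable]: "cond_prob_in M' H g B \<in> borel_measurable M'" for H g B
    unfolding cond_prob_in_def by (rule borel_measurable_cond_exp2)
  have [measurable]: "f \<in> measurable M' M" by (rule enl_facts(3))
  have "measure M' (e n -` A \<inter> space M') = (\<integral>\<omega>. cond_prob_in M' (F' (n - 1)) (e n) A \<omega> \<partial>M')"
    by (rule expectation_cond_prob_in[symmetric, OF P'.prob_space_axioms
        stochastic_basisD(2)[OF enl_facts(2)] em A])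
  also have "\<dots> = (\<integral>\<omega>. cond_prob_in M (F (n - 1)) (d n) A (f \<omega>) \<partial>M')"
    by (rule integral_cong_AE[OF _ _ tangent_cond_prob[OF n A]]) measurable
  also have "\<dots> = (\<integral>\<omega>. cond_prob_in M (F (n - 1)) (d n) A \<omega> \<partial>distr M' M f)"
    by (rule integral_distr[symmetric]) measurable
  also have "\<dots> = measure M (d n -` A \<inter> space M)"
    unfolding enl_facts(4)
    by (rule expectation_cond_prob_in[OF P.prob_space_axioms stochastic_basisD(2)[OF enl_facts(1)]
          d_borel(2)[OF n] A])
  finally show "emeasure (distr M' borel (e n)) A = emeasure (distr M borel (d n)) A"
    using A em d_borel(2)[OF n]
    by (simp add: emeasure_distr P.emeasure_eq_measure P'.emeasure_eq_measure)
qed simp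

end

section \<open>Trees generated by finite-valued processes\<close>

locale finite_process = prob_space M for M :: "'w measure" +
  fixes \<sigma> :: "nat \<Rightarrow> 'w \<Rightarrow> 'a" and S :: "'a set"
  assumes finite_S: "finite S"
    and values_in: "\<sigma> k \<omega> \<in> S"
    and measurable_process: "\<sigma> k \<in> measurable M (count_space UNIV)"
begin

definition path :: "nat \<Rightarrow> 'w \<Rightarrow> 'a list" where
  "path n \<omega> = map (\<lambda>k. \<sigma> k \<omega>) [0..<n]"

definition path_prob :: "'a list \<Rightarrow> real" where
  "path_prob h = prob {\<omega>\<in>space M. path (length h) \<omega> = h}"

text \<open>The kernel is the conditional law of the next letter; on words of probability zero it is
  an arbitrary point mass.\<close>

definition kernel :: "'a list \<Rightarrow> 'a \<Rightarrow> real" where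
  "kernel h a = (if path_prob h = 0 then of_bool (a = (SOME a. a \<in> S))
     else path_prob (h @ [a]) / path_prob h)"

lemma length_path [simp]: "length (path n \<omega>) = n"
  unfolding path_def by simp

lemma path_0 [simp]: "path 0 \<omega> = []"
  unfolding path_def by simp

lemma path_Suc: "path (Suc n) \<omega> = path n \<omega> @ [\<sigma> n \<omega>]"
  unfolding path_def by simp

lemma take_path: "k \<le> n \<Longrightarrow> take k (path n \<omega>) = path k \<omega>"
  unfolding path_def by (simp add: take_map)

lemma nth_path: "k < n \<Longrightarrow> path n \<omega> ! k = \<sigma> k \<omega>"
  unfolding path_def by simp

lemma path_in_words: "path n \<omega> \<in> words S n"
  unfolding words_def path_def using values_in by auto

lemma path_eq_iff: "length h = n \<Longrightarrow> path n \<omega> = h \<longleftrightarrow> (\<forall>k<n. \<sigma> k \<omega> = h ! k)"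
  by (auto simp: list_eq_iff_nth_eq nth_path)

lemma path_sets: "{\<omega>\<in>space M. path n \<omega> = h} \<in> sets M"
proof (cases "length h = n")
  case True
  have [measurable]: "\<sigma> k \<in> measurable M (count_space UNIV)" for k by (rule measurable_process)
  show ?thesis unfolding path_eq_iff[OF True] by measurable
next
  case False
  then have "{\<omega>\<in>space M. path n \<omega> = h} = {}" by auto
  then show ?thesis by (simp only: sets.empty_sets)
qed

lemma simple_function_path: "simple_function M (path n)"
  unfolding simple_function_def
proof (intro conjI ballI)
  show "finite (path n ` space M)"
    by (rule finite_subset[of _ "words S n"]) (use path_in_words finite_S in auto)
  have "path n -` {h} \<inter> space M = {\<omega>\<in>space M. path n \<omega> = h}" for h by auto
  then show "path n -` {h} \<inter> space M \<in> sets M" for h using path_sets by simp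
qed

lemma integrable_path: "integrable M (\<lambda>\<omega>. g (path n \<omega>) :: real)"
proof -
  have "simple_function M (\<lambda>\<omega>. g (path n \<omega>))"
    by (rule simple_function_compose1[OF simple_function_path])
  then have "Bochner_Integration.simple_bochner_integrable M (\<lambda>\<omega>. g (path n \<omega>))"
    by (auto simp: Bochner_Integration.simple_bochner_integrable.simps emeasure_eq_measure)
  then show ?thesis by (rule integrableI_simple_bochner_integrable)
qed

lemma expectation_path:
  "expectation (\<lambda>\<omega>. g (path n \<omega>)) = (\<Sum>h\<in>words S n. path_prob h * (g h :: real))"
proof -
  have eq: "g (path n \<omega>) = (\<Sum>h\<in>words S n. indicator {\<omega>\<in>space M. path n \<omega> = h} \<omega> * g h)"
    if "\<omega> \<in> space M" for \<omega>
  proof -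
    have "(\<Sum>h\<in>words S n. indicator {\<omega>\<in>space M. path n \<omega> = h} \<omega> * g h) =
        (\<Sum>h\<in>words S n. if h = path n \<omega> then g h else 0)"
      using that by (intro sum.cong) (auto simp: indicator_def)
    also have "\<dots> = g (path n \<omega>)" using path_in_words finite_S by simp
    finally show ?thesis ..
  qed
  have int: "integrable M (\<lambda>\<omega>. indicator {\<omega>\<in>space M. path n \<omega> = h} \<omega> * g h)" for h
    using path_sets by (intro integrable_mult_left integrable_real_indicator)
      (auto simp: emeasure_eq_measure)
  have "expectation (\<lambda>\<omega>. g (path n \<omega>)) =
      expectation (\<lambda>\<omega>. \<Sum>h\<in>words S n. indicator {\<omega>\<in>space M. path n \<omega> = h} \<omega> * g h)"
    using eq by (intro Bochner_Integration.integral_cong) auto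
  also have "\<dots> = (\<Sum>h\<in>words S n. expectation (\<lambda>\<omega>. indicator {\<omega>\<in>space M. path n \<omega> = h} \<omega> * g h))"
    by (rule Bochner_Integration.integral_sum) (rule int)
  also have "\<dots> = (\<Sum>h\<in>words S n. path_prob h * g h)"
    unfolding path_prob_def using path_sets by (intro sum.cong) (auto simp: length_words)
  finally show ?thesis .
qed

lemma path_prob_nonneg: "0 \<le> path_prob h"
  unfolding path_prob_def by simp

lemma path_prob_Nil: "path_prob [] = 1"
  unfolding path_prob_def using prob_space by simp

lemma path_prob_snoc: "path_prob h = (\<Sum>a\<in>S. path_prob (h @ [a]))"
proof -
  let ?B = "\<lambda>a. {\<omega>\<in>space M. path (Suc (length h)) \<omega> = h @ [a]}"
  have "{\<omega>\<in>space M. path (length h) \<omega> = h} = (\<Union>a\<in>S. ?B a)"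
    using values_in by (auto simp: path_Suc)
  then have "path_prob h = prob (\<Union>a\<in>S. ?B a)" unfolding path_prob_def by simp
  also have "\<dots> = (\<Sum>a\<in>S. prob (?B a))"
    using path_sets finite_S by (intro finite_measure_finite_Union) (auto simp: disjoint_family_on_def)
  finally show ?thesis unfolding path_prob_def by simp
qed

lemma path_prob_le: "a \<in> S \<Longrightarrow> path_prob (h @ [a]) \<le> path_prob h"
  unfolding path_prob_snoc[of h] using finite_S path_prob_nonneg by (intro member_le_sum) auto

lemma path_prob_kernel: "a \<in> S \<Longrightarrow> path_prob h * kernel h a = path_prob (h @ [a])"
  using path_prob_le[of a h] path_prob_nonneg[of "h @ [a]"] unfolding kernel_def by auto

sublocale tree: kernel_tree S kernel
proof
  obtain \<omega> where "\<omega> \<in> space M" using not_empty by blast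
  then have "\<exists>a. a \<in> S" using values_in by blast
  then have some: "(SOME a. a \<in> S) \<in> S" by (rule someI_ex)
  show "finite S" by (rule finite_S)
  show "0 \<le> kernel h a" for h a unfolding kernel_def using path_prob_nonneg by simp
  show "(\<Sum>a\<in>S. kernel h a) = 1" for h
  proof (cases "path_prob h = 0")
    case True
    then show ?thesis unfolding kernel_def using some finite_S by (simp add: of_bool_def)
  next
    case False
    then have "(\<Sum>a\<in>S. kernel h a) = (\<Sum>a\<in>S. path_prob (h @ [a])) / path_prob h"
      unfolding kernel_def by (simp add: sum_divide_distrib)
    then show ?thesis using False path_prob_snoc[of h] by simp
  qed
qed

text \<open>The chain rule. The arbitrary choice of \<open>kernel\<close> on null words does no
  harm, because extensions of a null word are null.\<close>

lemma tree_prob_eq: "h \<in> words S n \<Longrightarrow> tree.prob h h = path_prob h"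
proof (induction n arbitrary: h)
  case 0
  then show ?case by (simp add: tree.prob_def path_prob_Nil)
next
  case (Suc n)
  then obtain g a where h: "h = g @ [a]" "g \<in> words S n" "a \<in> S"
    unfolding words_def by (auto simp: length_Suc_conv_rev)
  then show ?case using Suc.IH[of g] by (simp add: tree.prob_snoc path_prob_kernel)
qed

lemma sum_tree_prob: "x \<in> words S n \<Longrightarrow> (\<Sum>y\<in>words S n. tree.prob x y) = 1"
  using product_sum_const[of "\<lambda>k. kernel (take k x)" S n 1] tree.kernel_sum
  unfolding product_sum_def tree.prob_def by (simp add: length_words)

lemma T_path: "tree.T n (\<lambda>x y. g x) = expectation (\<lambda>\<omega>. g (path n \<omega>) :: real)"
proof -
  have "tree.T n (\<lambda>x y. g x) = (\<Sum>x\<in>words S n. path_prob x * (\<Sum>y\<in>words S n. tree.prob x y) * g x)"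
    unfolding tree.T_def by (intro sum.cong refl) (simp add: tree_prob_eq sum_distrib_left sum_distrib_right)
  then show ?thesis unfolding expectation_path by (simp add: sum_tree_prob)
qed

end

text \<open>\<open>i k\<close> is the index of the rounded value at time \<open>k\<close>,
  \<open>q k j\<close> the conditional probability of the index \<open>j\<close> given
  \<open>F (k - 1)\<close>, and \<open>w k\<close> the rounding error. By \<open>w_bound\<close> the
  rounded values are centred up to that error.\<close>

locale discretization = prob_space M for M :: "'w measure" +
  fixes F :: "nat \<Rightarrow> 'w measure" and i :: "nat \<Rightarrow> 'w \<Rightarrow> nat" and q :: "nat \<Rightarrow> nat \<Rightarrow> 'w \<Rightarrow> real"
    and c :: "nat \<Rightarrow> 'x::banach" and w :: "nat \<Rightarrow> 'w \<Rightarrow> real" and N m K :: nat and p :: real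
  assumes subalg: "subalgebra M (F n)" and mono: "l \<le> n \<Longrightarrow> sets (F l) \<subseteq> sets (F n)"
    and N: "1 \<le> N" and p: "1 \<le> p" and K: "0 < K"
    and i_le: "i k \<omega> \<le> m" and i_meas: "k \<in> {1..N} \<Longrightarrow> i k \<in> measurable (F k) (count_space UNIV)"
    and q_meas: "k \<in> {1..N} \<Longrightarrow> q k j \<in> borel_measurable (F (k - 1))"
    and q_range: "0 \<le> q k j \<omega>" "q k j \<omega> \<le> 1"
    and q_cond: "k \<in> {1..N} \<Longrightarrow> B \<in> sets (F (k - 1)) \<Longrightarrow>
      prob {\<omega>\<in>B. i k \<omega> = j} = expectation (\<lambda>\<omega>. indicator B \<omega> * q k j \<omega>)"
    and w_nonneg: "0 \<le> w k \<omega>"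
    and w_int: "k \<in> {1..N} \<Longrightarrow> integrable M (w k)" "k \<in> {1..N} \<Longrightarrow> integrable M (\<lambda>\<omega>. w k \<omega> powr p)"
    and w_bound: "k \<in> {1..N} \<Longrightarrow> B \<in> sets (F (k - 1)) \<Longrightarrow>
      norm (\<Sum>j\<le>m. prob {\<omega>\<in>B. i k \<omega> = j} *\<^sub>R c j) \<le> expectation (\<lambda>\<omega>. indicator B \<omega> * w k \<omega>)"
begin

text \<open>The conditional law of the value at time \<open>k + 1\<close>, rounded down to multiples
  of \<open>1/K\<close>. From time \<open>N\<close> on there is no further value to predict, and the
  list is empty.\<close>

definition level :: "nat \<Rightarrow> 'w \<Rightarrow> nat list" where
  "level k \<omega> = (if k < N then map (\<lambda>j. nat \<lfloor>real K * q (Suc k) j \<omega>\<rfloor>) [0..<Suc m] else [])"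

text \<open>The letter at time \<open>k\<close> records the value at time \<open>k\<close> and, up to \<open>1/K\<close>, the conditional law of the
  value at time \<open>k + 1\<close>.\<close>

definition letter :: "nat \<Rightarrow> 'w \<Rightarrow> nat \<times> nat list" where
  "letter k \<omega> = (if k \<in> {1..N} then i k \<omega> else 0, level k \<omega>)"

definition alphabet :: "(nat \<times> nat list) set" where
  "alphabet = {..m} \<times> {l. set l \<subseteq> {..K} \<and> length l \<le> Suc m}"

lemma space_F: "space (F n) = space M"
  using subalg[of n] unfolding subalgebra_def by simp

lemma F_in_M: "A \<in> sets (F n) \<Longrightarrow> A \<in> sets M"
  by (rule subsetD[OF conjunct2[OF subalg[unfolded subalgebra_def]]])

lemma map_upt_eq_iff: "map f [0..<n] = l \<longleftrightarrow> length l = n \<and> (\<forall>j\<in>{..<n}. f j = l ! j)"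
  by (auto simp: list_eq_iff_nth_eq)

lemma letter_sets: "{\<omega>\<in>space M. letter k \<omega> = a} \<in> sets (F k)"
proof -
  have i': "{\<omega>\<in>space (F k). (if k \<in> {1..N} then i k \<omega> else 0) = fst a} \<in> sets (F k)"
  proof (cases "k \<in> {1..N}")
    case True
    have "i k -` {fst a} \<inter> space (F k) \<in> sets (F k)" by (rule measurable_sets[OF i_meas[OF True]]) simp
    moreover have "{\<omega>\<in>space (F k). i k \<omega> = fst a} = i k -` {fst a} \<inter> space (F k)" by blast
    ultimately show ?thesis unfolding if_P[OF True] by simp
  next
    case False
    then show ?thesis unfolding if_not_P[OF False] by (cases "0 = fst a") simp_all
  qed
  have l': "{\<omega>\<in>space (F k). level k \<omega> = snd a} \<in> sets (F k)"
  proof (cases "k < N \<and> length (snd a) = Suc m")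
    case True
    let ?f = "\<lambda>j \<omega>. nat \<lfloor>real K * q (Suc k) j \<omega>\<rfloor>"
    have f: "?f j \<in> measurable (F k) (count_space UNIV)" for j
    proof -
      have [measurable]: "q (Suc k) j \<in> borel_measurable (F k)"
        using q_meas[of "Suc k" j] True by simp
      show ?thesis by measurable
    qed
    have "level k \<omega> = snd a \<longleftrightarrow> (\<forall>j\<in>{..<Suc m}. ?f j \<omega> = snd a ! j)" for \<omega>
      unfolding level_def if_P[OF True[THEN conjunct1]] map_upt_eq_iff using True by blast
    then have "{\<omega>\<in>space (F k). level k \<omega> = snd a} =
        (\<Inter>j\<in>{..<Suc m}. ?f j -` {snd a ! j} \<inter> space (F k))" by auto
    also have "\<dots> \<in> sets (F k)"
      by (intro sets.finite_INT measurable_sets[OF f]) auto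
    finally show ?thesis .
  next
    case False
    show ?thesis
    proof (cases "k < N")
      case True
      then have "level k \<omega> \<noteq> snd a" for \<omega>
        using False unfolding level_def if_P[OF True] map_upt_eq_iff by blast
      then show ?thesis by simp
    next
      case False
      then show ?thesis unfolding level_def if_not_P[OF False] by (cases "[] = snd a") simp_all
    qed
  qed
  obtain j l where a: "a = (j, l)" by (cases a)
  from sets.sets_Collect_conj[OF l' i']
  show ?thesis unfolding letter_def a prod.inject fst_conv snd_conv space_F .
qed

lemma floor_level_le: "nat \<lfloor>real K * q k j \<omega>\<rfloor> \<le> K"
proof -
  have "real K * q k j \<omega> \<le> real K * 1" by (intro mult_left_mono q_range) simp
  then have "\<lfloor>real K * q k j \<omega>\<rfloor> \<le> \<lfloor>real K\<rfloor>" by (intro floor_mono) simp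
  then show ?thesis by simp
qed

lemma level_alphabet: "set (level k \<omega>) \<subseteq> {..K}" "length (level k \<omega>) \<le> Suc m"
proof -
  show "set (level k \<omega>) \<subseteq> {..K}"
  proof (cases "k < N")
    case True
    show ?thesis
      unfolding level_def if_P[OF True] set_map by (rule image_subsetI) (simp only: atMost_iff floor_level_le)
  next
    case False
    show ?thesis unfolding level_def if_not_P[OF False] by simp
  qed
  show "length (level k \<omega>) \<le> Suc m"
    unfolding level_def by (simp del: upt_Suc)
qed

lemma letter_in: "letter k \<omega> \<in> alphabet"
proof -
  have "(if k \<in> {1..N} then i k \<omega> else 0) \<le> m" by (cases "k \<in> {1..N}") (simp_all add: i_le)
  then show ?thesis unfolding letter_def alphabet_def using level_alphabet[of k \<omega>] by blast
qed

sublocale process: finite_process M letter alphabet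
proof
  show "finite alphabet"
    unfolding alphabet_def by (intro finite_cartesian_product finite_lists_length_le) auto
  show "letter k \<omega> \<in> alphabet" for k \<omega> by (rule letter_in)
  show "letter k \<in> measurable M (count_space UNIV)" for k
  proof -
    have eq: "letter k -` {a} \<inter> space M = {\<omega>\<in>space M. letter k \<omega> = a}" for a by blast
    show ?thesis
      unfolding measurable_count_space_eq_countable[OF countableI_type] eq
      using F_in_M[OF letter_sets] by simp
  qed
qed

abbreviation event :: "(nat \<times> nat list) list \<Rightarrow> 'w set" where
  "event h \<equiv> {\<omega>\<in>space M. process.path (length h) \<omega> = h}"

text \<open>Letters are numbered from \<open>0\<close>, and letter \<open>k\<close> is known at time
  \<open>k\<close>. So a history of length \<open>k\<close> is an event of time
  \<open>k - 1\<close>, the time to which \<open>q k\<close> refers.\<close>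

lemma event_sets:
  assumes "1 \<le> length h"
  shows "event h \<in> sets (F (length h - 1))"
proof -
  have "event h = (\<Inter>k\<in>{..<length h}. {\<omega>\<in>space M. letter k \<omega> = h ! k})"
    using assms unfolding process.path_eq_iff[OF refl] by (auto simp: Suc_le_eq)
  also have "\<dots> \<in> sets (F (length h - 1))"
  proof (rule sets.finite_INT)
    show "{..<length h} \<noteq> {}" using assms by (auto simp: Suc_le_eq)
    show "{\<omega>\<in>space M. letter k \<omega> = h ! k} \<in> sets (F (length h - 1))" if "k \<in> {..<length h}" for k
    proof -
      have "k \<le> length h - 1" using that by simp
      then show ?thesis by (rule subsetD[OF mono letter_sets])
    qed
  qed simp
  finally show ?thesis .
qed

definition cond_mass :: "nat \<Rightarrow> (nat \<times> nat list) list \<Rightarrow> real" where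
  "cond_mass j h = (\<Sum>a\<in>alphabet. process.kernel h a * of_bool (fst a = j))"

definition mean :: "(nat \<times> nat list) list \<Rightarrow> 'x" where
  "mean h = (\<Sum>a\<in>alphabet. process.kernel h a *\<^sub>R c (fst a))"

text \<open>The tree inequality demands exactly centred values, so the conditional mean given the
  letters is subtracted. Letter \<open>0\<close> carries no value of the martingale, only the law of
  the first one; hence the value \<open>0\<close> for words of length \<open>1\<close>.\<close>

definition value_at :: "(nat \<times> nat list) list \<Rightarrow> 'x" where
  "value_at l = (if length l \<le> 1 then 0 else c (fst (last l)) - mean (butlast l))"

lemma value_at_centered: "(\<Sum>a\<in>alphabet. process.kernel h a *\<^sub>R value_at (h @ [a])) = 0"
proof (cases "h = []")
  case False
  then have "(\<Sum>a\<in>alphabet. process.kernel h a *\<^sub>R value_at (h @ [a])) =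
      (\<Sum>a\<in>alphabet. process.kernel h a *\<^sub>R (c (fst a) - mean h))"
    unfolding value_at_def by (intro sum.cong) auto
  also have "\<dots> = mean h - (\<Sum>a\<in>alphabet. process.kernel h a) *\<^sub>R mean h"
    unfolding scaleR_diff_right sum_subtractf scaleR_sum_left by (simp add: mean_def)
  finally show ?thesis using process.tree.kernel_sum by simp
qed (simp add: value_at_def)

lemma cond_mass_range: "0 \<le> cond_mass j h" "cond_mass j h \<le> 1"
proof -
  show "0 \<le> cond_mass j h"
    unfolding cond_mass_def by (intro sum_nonneg mult_nonneg_nonneg process.tree.kernel_nonneg) auto
  have "cond_mass j h \<le> (\<Sum>a\<in>alphabet. process.kernel h a * 1)"
    unfolding cond_mass_def by (intro sum_mono mult_left_mono process.tree.kernel_nonneg) auto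
  then show "cond_mass j h \<le> 1" using process.tree.kernel_sum[of h] by simp
qed

lemma mean_eq: "mean h = (\<Sum>j\<le>m. cond_mass j h *\<^sub>R c j)"
proof -
  have "(\<Sum>j\<le>m. cond_mass j h *\<^sub>R c j) =
      (\<Sum>a\<in>alphabet. \<Sum>j\<le>m. (process.kernel h a * of_bool (fst a = j)) *\<^sub>R c j)"
    unfolding cond_mass_def scaleR_sum_left by (rule sum.swap)
  also have "\<dots> = mean h"
    unfolding mean_def
  proof (rule sum.cong[OF refl])
    fix a :: "nat \<times> nat list" assume "a \<in> alphabet"
    then have "fst a \<le> m" unfolding alphabet_def by auto
    have "(\<Sum>j\<le>m. (process.kernel h a * of_bool (fst a = j)) *\<^sub>R c j) =
        (\<Sum>j\<le>m. if j = fst a then process.kernel h a *\<^sub>R c j else 0)"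
      by (intro sum.cong) auto
    also have "\<dots> = process.kernel h a *\<^sub>R c (fst a)" using \<open>fst a \<le> m\<close> by simp
    finally show "(\<Sum>j\<le>m. (process.kernel h a * of_bool (fst a = j)) *\<^sub>R c j) =
        process.kernel h a *\<^sub>R c (fst a)" .
  qed
  finally show ?thesis by simp
qed

lemma path_prob_cond_mass:
  assumes h: "h \<in> words alphabet k" and k: "k \<in> {1..N}"
  shows "process.path_prob h * cond_mass j h = prob {\<omega>\<in>event h. i k \<omega> = j}"
proof -
  have len: "length h = k" using h by (rule length_words)
  define g :: "(nat \<times> nat list) list \<Rightarrow> real" where
    "g l = of_bool (butlast l = h \<and> fst (last l) = j)" for l
  have "prob {\<omega>\<in>event h. i k \<omega> = j} = expectation (\<lambda>\<omega>. g (process.path (Suc k) \<omega>))"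
  proof -
    have g: "g (process.path (Suc k) \<omega>) = indicator {\<omega>\<in>event h. i k \<omega> = j} \<omega>" if "\<omega> \<in> space M" for \<omega>
      using that k len unfolding g_def process.path_Suc letter_def by (auto simp: indicator_def)
    have s: "{\<omega>\<in>event h. i k \<omega> = j} = (if j \<le> m then
        event h \<inter> {\<omega>\<in>space M. fst (letter k \<omega>) = j} else {})"
      using k i_le by (auto simp: letter_def)
    have "{\<omega>\<in>event h. i k \<omega> = j} \<in> sets M"
    proof -
      have [measurable]: "letter k \<in> measurable M (count_space UNIV)"
        by (rule process.measurable_process)
      have "{\<omega>\<in>space M. fst (letter k \<omega>) = j} \<in> sets M" by measurable
      then show ?thesis unfolding s using process.path_sets by auto
    qed
    then show ?thesis
      using g by (subst Bochner_Integration.integral_cong[OF refl g]) auto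
  qed
  also have "\<dots> = (\<Sum>x\<in>words alphabet k. \<Sum>a\<in>alphabet. process.path_prob (x @ [a]) * g (x @ [a]))"
    unfolding process.expectation_path sum_words_snoc ..
  also have "\<dots> = (\<Sum>x\<in>words alphabet k. if x = h then
      (\<Sum>a\<in>alphabet. process.path_prob (h @ [a]) * of_bool (fst a = j)) else 0)"
    unfolding g_def by (intro sum.cong) auto
  also have "\<dots> = (\<Sum>a\<in>alphabet. process.path_prob (h @ [a]) * of_bool (fst a = j))"
    using h process.finite_S by simp
  also have "\<dots> = process.path_prob h * cond_mass j h"
    unfolding cond_mass_def sum_distrib_left
    by (intro sum.cong refl) (simp add: process.path_prob_kernel flip: mult.assoc)
  finally show ?thesis ..
qed

lemma integrable_indicator_mult:
  "A \<in> sets M \<Longrightarrow> integrable M f \<Longrightarrow> integrable M (\<lambda>\<omega>. indicator A \<omega> * (f \<omega> :: real))"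
  using integrable_real_mult_indicator[of A M f] by (simp add: mult.commute)

text \<open>On each history the norm of \<open>mean\<close> is at most the average of
  \<open>w k\<close>. Jensen's inequality follows by integrating a tangent over the history, and the
  histories of length \<open>k\<close> partition the space.\<close>

lemma expectation_mean_le:
  assumes k: "k \<in> {1..N}"
  shows "expectation (\<lambda>\<omega>. norm (mean (process.path k \<omega>)) powr p) \<le> expectation (\<lambda>\<omega>. w k \<omega> powr p)"
proof -
  have h: "process.path_prob h * norm (mean h) powr p \<le>
      expectation (\<lambda>\<omega>. indicator (event h) \<omega> * w k \<omega> powr p)" if h: "h \<in> words alphabet k" for h
  proof -
    let ?\<mu> = "process.path_prob h" and ?B = "event h" and ?a = "norm (mean h)"
    have len: "length h = k" using h by (rule length_words)
    have BF: "?B \<in> sets (F (k - 1))" using event_sets[of h] len k by auto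
    have B: "?B \<in> sets M" by (rule F_in_M[OF BF])
    have mu: "expectation (indicator ?B) = ?\<mu>" using B by (simp add: process.path_prob_def)
    have "?\<mu> *\<^sub>R mean h = (\<Sum>j\<le>m. prob {\<omega>\<in>?B. i k \<omega> = j} *\<^sub>R c j)"
      unfolding mean_eq scaleR_sum_right
      by (simp only: scaleR_scaleR path_prob_cond_mass[OF h k])
    then have "norm (?\<mu> *\<^sub>R mean h) \<le> expectation (\<lambda>\<omega>. indicator ?B \<omega> * w k \<omega>)"
      using w_bound[OF k BF] by simp
    then have le: "?\<mu> * ?a \<le> expectation (\<lambda>\<omega>. indicator ?B \<omega> * w k \<omega>)"
      by (simp add: process.path_prob_nonneg)
    have int1: "integrable M (indicator ?B :: 'w \<Rightarrow> real)"
      using integrable_indicator_mult[OF B, of "\<lambda>_. 1"] by simp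
    note int2 = integrable_indicator_mult[OF B w_int(1)[OF k]]
    have "?\<mu> * ?a powr p \<le> ?\<mu> * ?a powr p + p * ?a powr (p - 1) *
        (expectation (\<lambda>\<omega>. indicator ?B \<omega> * w k \<omega>) - ?a * ?\<mu>)"
      using le p by (simp add: mult.commute)
    also have "\<dots> = expectation (\<lambda>\<omega>. (?a powr p - p * ?a powr (p - 1) * ?a) * indicator ?B \<omega> +
        p * ?a powr (p - 1) * (indicator ?B \<omega> * w k \<omega>))"
    proof -
      have "expectation (\<lambda>\<omega>. x * indicator ?B \<omega> + y * (indicator ?B \<omega> * w k \<omega>)) =
          x * ?\<mu> + y * expectation (\<lambda>\<omega>. indicator ?B \<omega> * w k \<omega>)" for x y
        by (simp only: Bochner_Integration.integral_add[OF integrable_mult_right[OF int1]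
              integrable_mult_right[OF int2]] integral_mult_right_zero mu)
      note lin = this[of "?a powr p - p * ?a powr (p - 1) * ?a" "p * ?a powr (p - 1)"]
      show ?thesis unfolding lin by (simp add: algebra_simps)
    qed
    also have "\<dots> \<le> expectation (\<lambda>\<omega>. indicator ?B \<omega> * w k \<omega> powr p)"
    proof (rule integral_mono)
      show "integrable M (\<lambda>\<omega>. (?a powr p - p * ?a powr (p - 1) * ?a) * indicator ?B \<omega> +
          p * ?a powr (p - 1) * (indicator ?B \<omega> * w k \<omega>))"
        using int1 int2 by simp
      show "integrable M (\<lambda>\<omega>. indicator ?B \<omega> * w k \<omega> powr p)"
        by (rule integrable_indicator_mult[OF B w_int(2)[OF k]])
      fix \<omega>
      show "(?a powr p - p * ?a powr (p - 1) * ?a) * indicator ?B \<omega> +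
          p * ?a powr (p - 1) * (indicator ?B \<omega> * w k \<omega>) \<le> indicator ?B \<omega> * w k \<omega> powr p"
        using powr_tangent_le[OF norm_ge_zero[of "mean h"] w_nonneg[of k \<omega>] p]
        by (cases "\<omega> \<in> ?B") (simp_all add: algebra_simps)
    qed
    finally show ?thesis .
  qed
  have "expectation (\<lambda>\<omega>. norm (mean (process.path k \<omega>)) powr p) \<le>
      (\<Sum>h\<in>words alphabet k. expectation (\<lambda>\<omega>. indicator (event h) \<omega> * w k \<omega> powr p))"
    unfolding process.expectation_path[of "\<lambda>h. norm (mean h) powr p"] by (intro sum_mono h)
  also have "\<dots> = expectation (\<lambda>\<omega>. \<Sum>h\<in>words alphabet k. indicator (event h) \<omega> * w k \<omega> powr p)"
    using process.path_sets
    by (intro Bochner_Integration.integral_sum[symmetric] integrable_indicator_mult w_int k) auto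
  also have "\<dots> = expectation (\<lambda>\<omega>. w k \<omega> powr p)"
  proof (rule Bochner_Integration.integral_cong[OF refl])
    fix \<omega> assume "\<omega> \<in> space M"
    then have "(\<Sum>h\<in>words alphabet k. indicator (event h) \<omega> * w k \<omega> powr p) =
        (\<Sum>h\<in>words alphabet k. if h = process.path k \<omega> then w k \<omega> powr p else 0)"
      by (intro sum.cong) (auto simp: indicator_def length_words)
    then show "(\<Sum>h\<in>words alphabet k. indicator (event h) \<omega> * w k \<omega> powr p) = w k \<omega> powr p"
      using process.path_in_words process.finite_S by simp
  qed
  finally show ?thesis .
qed

text \<open>Points with the same history share the last recorded level, so on this event
  \<open>q k j\<close> stays within an interval of length \<open>1/K\<close>.
  \<open>cond_mass\<close> is the average of \<open>q k j\<close> over the event and lies in the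
  same interval.\<close>

lemma cond_mass_approx:
  assumes k: "k \<in> {1..N}" and j: "j \<le> m"
  shows "AE \<omega> in M. \<bar>cond_mass j (process.path k \<omega>) - q k j \<omega>\<bar> \<le> 1 / K"
proof -
  let ?Z = "{\<omega>\<in>space M. process.path_prob (process.path k \<omega>) = 0}"
  \<comment> \<open>Histories of probability zero, on which the kernel is arbitrary, are almost
    surely avoided.\<close>
  have "expectation (\<lambda>\<omega>. of_bool (process.path_prob (process.path k \<omega>) = 0) :: real) =
      (\<Sum>h\<in>words alphabet k. process.path_prob h * of_bool (process.path_prob h = 0))"
    by (rule process.expectation_path)
  also have "\<dots> = 0" by (intro sum.neutral) auto
  finally have "expectation (\<lambda>\<omega>. of_bool (process.path_prob (process.path k \<omega>) = 0) :: real) = 0" .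
  then have "AE \<omega> in M. (of_bool (process.path_prob (process.path k \<omega>) = 0) :: real) = 0"
    by (subst (asm) integral_nonneg_eq_0_iff_AE)
      (auto intro: process.integrable_path[of "\<lambda>h. of_bool (process.path_prob h = 0)"])
  then have "AE \<omega> in M. process.path_prob (process.path k \<omega>) \<noteq> 0" by simp
  then show ?thesis
  proof (rule AE_mp, intro AE_I2 impI)
    fix \<omega> assume w: "\<omega> \<in> space M" and nz: "process.path_prob (process.path k \<omega>) \<noteq> 0"
    define h where "h = process.path k \<omega>"
    define r where "r = nat \<lfloor>real K * q k j \<omega>\<rfloor>"
    let ?\<mu> = "process.path_prob h" and ?B = "event h"
    have mu: "0 < ?\<mu>" using nz process.path_prob_nonneg[of h] unfolding h_def by simp
    have len: "length h = k" unfolding h_def by simp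
    have BF: "?B \<in> sets (F (k - 1))" using event_sets[of h] len k by auto
    have B: "?B \<in> sets M" by (rule F_in_M[OF BF])
    have bounds: "real r \<le> real K * q k j \<omega>' \<and> real K * q k j \<omega>' \<le> real r + 1" if "\<omega>' \<in> ?B" for \<omega>'
    proof -
      have "process.path k \<omega>' = process.path k \<omega>" using that len unfolding h_def by simp
      then have "letter (k - 1) \<omega>' = letter (k - 1) \<omega>"
        using k process.nth_path[of "k - 1" k] by (metis atLeastAtMost_iff diff_less less_le_trans zero_less_one)
      then have "level (k - 1) \<omega>' ! j = level (k - 1) \<omega> ! j" unfolding letter_def by simp
      then have "nat \<lfloor>real K * q k j \<omega>'\<rfloor> = r"
        using k j unfolding level_def r_def by (cases k) (simp_all del: upt_Suc)
      moreover have "0 \<le> real K * q k j \<omega>'" using q_range by simp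
      ultimately show ?thesis by linarith
    qed
    have "?\<mu> * cond_mass j h = prob {\<omega>\<in>?B. i k \<omega> = j}"
      by (rule path_prob_cond_mass[OF _ k]) (simp add: h_def process.path_in_words)
    also have "\<dots> = expectation (\<lambda>\<omega>. indicator ?B \<omega> * q k j \<omega>)" by (rule q_cond[OF k BF])
    finally have eq: "?\<mu> * cond_mass j h = expectation (\<lambda>\<omega>. indicator ?B \<omega> * q k j \<omega>)" .
    have int1: "integrable M (indicator ?B :: 'w \<Rightarrow> real)"
      using integrable_indicator_mult[OF B, of "\<lambda>_. 1"] by simp
    have qM: "q k j \<in> borel_measurable M" by (rule measurable_from_subalg[OF subalg q_meas[OF k]])
    have "integrable M (q k j)"
      by (rule integrable_const_bound[of _ 1]) (use q_range qM in auto)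
    then have int2: "integrable M (\<lambda>\<omega>. indicator ?B \<omega> * q k j \<omega>)"
      by (rule integrable_indicator_mult[OF B])
    have e: "expectation (\<lambda>\<omega>. x * indicator ?B \<omega>) = x * ?\<mu>" for x
      using B by (simp add: process.path_prob_def)
    have "r / K * ?\<mu> \<le> ?\<mu> * cond_mass j h"
      unfolding eq e[symmetric]
    proof (rule integral_mono)
      fix \<omega>'
      show "r / K * indicator ?B \<omega>' \<le> indicator ?B \<omega>' * q k j \<omega>'"
        using bounds[of \<omega>'] K by (cases "\<omega>' \<in> ?B") (simp_all add: field_simps)
    qed (use int1 int2 in simp_all)
    then have "?\<mu> * (r / K) \<le> ?\<mu> * cond_mass j h" by (simp only: mult.commute)
    then have lo: "r / K \<le> cond_mass j h" by (rule mult_left_le_imp_le[OF _ mu])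
    have "?\<mu> * cond_mass j h \<le> (r + 1) / K * ?\<mu>"
      unfolding eq e[symmetric]
    proof (rule integral_mono)
      fix \<omega>'
      show "indicator ?B \<omega>' * q k j \<omega>' \<le> (r + 1) / K * indicator ?B \<omega>'"
        using bounds[of \<omega>'] K by (cases "\<omega>' \<in> ?B") (simp_all add: field_simps)
    qed (use int1 int2 in simp_all)
    then have "?\<mu> * cond_mass j h \<le> ?\<mu> * ((r + 1) / K)" by (simp only: mult.commute)
    then have hi: "cond_mass j h \<le> (r + 1) / K" by (rule mult_left_le_imp_le[OF _ mu])
    have "\<omega> \<in> ?B" using w unfolding h_def by simp
    from bounds[OF this] have "r / K \<le> q k j \<omega>" "q k j \<omega> \<le> (r + 1) / K"
      using K by (simp_all add: field_simps)
    with lo hi show "\<bar>cond_mass j (process.path k \<omega>) - q k j \<omega>\<bar> \<le> 1 / K"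
      unfolding h_def[symmetric] by (simp add: add_divide_distrib abs_le_iff)
  qed
qed

text \<open>Products of numbers from \<open>[0, 1]\<close> differ by at most the sum of the
  differences of their factors, here \<open>N\<close> times \<open>1/K\<close>.\<close>

lemma expectation_prod_cond_mass_le:
  assumes u: "u \<in> words {..m} N"
  shows "expectation (\<lambda>\<omega>. \<Prod>k=1..N. cond_mass (u ! (k - 1)) (process.path k \<omega>)) \<le>
    expectation (\<lambda>\<omega>. \<Prod>k=1..N. q k (u ! (k - 1)) \<omega>) + N / K"
proof -
  have um: "u ! (k - 1) \<le> m" if "k \<in> {1..N}" for k
    using nth_words[OF u, of "k - 1"] that by auto
  have meas1: "(\<lambda>\<omega>. cond_mass j (process.path k \<omega>)) \<in> borel_measurable M" for j k
    by (rule borel_measurable_integrable[OF process.integrable_path])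
  have meas2: "q k j \<in> borel_measurable M" if "k \<in> {1..N}" for k j
    by (rule measurable_from_subalg[OF subalg q_meas[OF that]])
  have int1: "integrable M (\<lambda>\<omega>. \<Prod>k=1..N. cond_mass (u ! (k - 1)) (process.path k \<omega>))"
    by (rule integrable_const_bound[of _ 1])
      (use meas1 cond_mass_range in \<open>auto intro!: AE_I2 borel_measurable_prod prod_le_1 simp: abs_prod\<close>)
  have int2: "integrable M (\<lambda>\<omega>. \<Prod>k=1..N. q k (u ! (k - 1)) \<omega>)"
    by (rule integrable_const_bound[of _ 1])
      (use meas2 q_range in \<open>auto intro!: AE_I2 borel_measurable_prod prod_le_1 simp: abs_prod\<close>)
  have "expectation (\<lambda>\<omega>. \<Prod>k=1..N. cond_mass (u ! (k - 1)) (process.path k \<omega>)) \<le>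
      expectation (\<lambda>\<omega>. (\<Prod>k=1..N. q k (u ! (k - 1)) \<omega>) + N / K)"
  proof (rule integral_mono_AE[OF int1])
    have "AE \<omega> in M. \<forall>k\<in>{1..N}. \<bar>cond_mass (u ! (k - 1)) (process.path k \<omega>) - q k (u ! (k - 1)) \<omega>\<bar> \<le> 1 / K"
      by (rule AE_finite_allI) (use cond_mass_approx um in auto)
    then show "AE \<omega> in M. (\<Prod>k=1..N. cond_mass (u ! (k - 1)) (process.path k \<omega>)) \<le>
        (\<Prod>k=1..N. q k (u ! (k - 1)) \<omega>) + N / K"
    proof (rule AE_mp, intro AE_I2 impI)
      fix \<omega> assume a: "\<forall>k\<in>{1..N}. \<bar>cond_mass (u ! (k - 1)) (process.path k \<omega>) - q k (u ! (k - 1)) \<omega>\<bar> \<le> 1 / K"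
      have "norm ((\<Prod>k=1..N. cond_mass (u ! (k - 1)) (process.path k \<omega>)) - (\<Prod>k=1..N. q k (u ! (k - 1)) \<omega>)) \<le>
          (\<Sum>k=1..N. norm (cond_mass (u ! (k - 1)) (process.path k \<omega>) - q k (u ! (k - 1)) \<omega>))"
        by (rule norm_prod_diff) (simp_all add: cond_mass_range q_range)
      also have "\<dots> \<le> (\<Sum>k=1..N. 1 / K)" using a by (intro sum_mono) auto
      also have "\<dots> = N / K" by simp
      finally show "(\<Prod>k=1..N. cond_mass (u ! (k - 1)) (process.path k \<omega>)) \<le>
        (\<Prod>k=1..N. q k (u ! (k - 1)) \<omega>) + N / K" by (simp add: abs_le_iff)
    qed
  qed (use int2 in simp)
  also have "\<dots> = expectation (\<lambda>\<omega>. \<Prod>k=1..N. q k (u ! (k - 1)) \<omega>) + N / K"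
    using int2 prob_space by simp
  finally show ?thesis .
qed

end

section \<open>The tree inequality for the discretised sequence\<close>

context discretization
begin

text \<open>The tree inequality is applied to words of length \<open>N + 1\<close>. Its left side is
  exactly the moment of the recentred rounded sum. On the right, the decoupled values split into the
  rounded values, whose joint law is an averaged product of conditional masses, and the means, which
  \<open>expectation_mean_le\<close> controls.\<close>

lemma discretized_bound:
  assumes t: "0 < t" "t < 1" and D: "0 \<le> D"
    and tree: "\<And>(S :: (nat \<times> nat list) set) \<kappa> (v :: (nat \<times> nat list) list \<Rightarrow> 'x) N.
      kernel_tree S \<kappa> \<Longrightarrow> (\<And>h. (\<Sum>a\<in>S. \<kappa> h a *\<^sub>R v (h @ [a])) = 0) \<Longrightarrow> 1 \<le> N \<Longrightarrow>
      kernel_tree.path_sum S \<kappa> v p N \<le> D * kernel_tree.decoupled_sum S \<kappa> v p N"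
  shows "expectation (\<lambda>\<omega>. norm (\<Sum>k=1..N. c (i k \<omega>) - mean (process.path k \<omega>)) powr p) \<le>
    D * ((1 - t) powr (1 - p) * (\<Sum>u\<in>words {..m} N. norm (\<Sum>k<N. c (u ! k)) powr p *
        (expectation (\<lambda>\<omega>. \<Prod>k=1..N. q k (u ! (k - 1)) \<omega>) + N / K)) +
      t powr (1 - p) * (N powr p * (\<Sum>k=1..N. expectation (\<lambda>\<omega>. w k \<omega> powr p))))"
proof -
  let ?T = "process.tree.T (Suc N)" and ?L = "(1 - t) powr (1 - p)" and ?R = "t powr (1 - p)"
  have "process.tree.path_sum value_at p (Suc N) =
      expectation (\<lambda>\<omega>. norm (\<Sum>k<Suc N. process.tree.d value_at k (process.path (Suc N) \<omega>)) powr p)"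
    unfolding process.tree.path_sum_def by (rule process.T_path)
  also have "\<dots> = expectation (\<lambda>\<omega>. norm (\<Sum>k=1..N. c (i k \<omega>) - mean (process.path k \<omega>)) powr p)"
  proof (intro Bochner_Integration.integral_cong refl arg_cong[where f = "\<lambda>z. norm z powr p"])
    fix \<omega>
    have 0: "process.tree.d value_at 0 (process.path (Suc N) \<omega>) = 0"
      by (simp add: process.tree.d_def value_at_def)
    have S: "process.tree.d value_at (Suc k) (process.path (Suc N) \<omega>) =
        c (i (Suc k) \<omega>) - mean (process.path (Suc k) \<omega>)" if "k < N" for k
      using that by (simp add: process.tree.d_def process.take_path process.nth_path value_at_def letter_def)
    show "(\<Sum>k<Suc N. process.tree.d value_at k (process.path (Suc N) \<omega>)) =
        (\<Sum>k=1..N. c (i k \<omega>) - mean (process.path k \<omega>))"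
      unfolding sum.lessThan_Suc_shift 0 One_nat_def sum.atLeast1_atMost_eq by (simp add: S)
  qed
  finally have path: "process.tree.path_sum value_at p (Suc N) =
      expectation (\<lambda>\<omega>. norm (\<Sum>k=1..N. c (i k \<omega>) - mean (process.path k \<omega>)) powr p)" .
  \<comment> \<open>The expectation is expanded over the finitely many words \<open>u\<close> of
    indices. Letter \<open>0\<close> has no value, so letter \<open>k\<close> of \<open>y\<close> is
    compared with \<open>u ! (k - 1)\<close>.\<close>
  have main: "?T (\<lambda>x y. norm (\<Sum>k=1..N. c (fst (y ! k))) powr p) \<le>
      (\<Sum>u\<in>words {..m} N. norm (\<Sum>k<N. c (u ! k)) powr p *
        (expectation (\<lambda>\<omega>. \<Prod>k=1..N. q k (u ! (k - 1)) \<omega>) + N / K))"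
  proof -
    have "?T (\<lambda>x y. norm (\<Sum>k=1..N. c (fst (y ! k))) powr p) =
        ?T (\<lambda>x y. \<Sum>u\<in>words {..m} N. norm (\<Sum>k<N. c (u ! k)) powr p *
          (\<Prod>k\<in>{1..N}. of_bool (fst (y ! k) = u ! (k - 1))))"
    proof (rule process.tree.T_cong)
      fix x y assume y: "y \<in> words alphabet (Suc N)"
      define z where "z = map (\<lambda>k. fst (y ! Suc k)) [0..<N]"
      have "fst (y ! Suc k) \<le> m" if "k < N" for k
        using nth_words[OF y, of "Suc k"] that unfolding alphabet_def by auto
      then have z: "z \<in> words {..m} N" unfolding z_def words_def by auto
      have prod: "(\<Prod>k\<in>{1..N}. of_bool (fst (y ! k) = u ! (k - 1))) = (if u = z then 1 else 0 :: real)"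
        if u: "u \<in> words {..m} N" for u
      proof (cases "u = z")
        case True
        then show ?thesis unfolding z_def by (auto intro!: prod.neutral)
      next
        case False
        then obtain k where "k < N" "u ! k \<noteq> fst (y ! Suc k)"
          using length_words[OF u] unfolding z_def by (auto simp: list_eq_iff_nth_eq)
        then show ?thesis using False by (auto intro!: prod_zero bexI[of _ "Suc k"])
      qed
      have "(\<Sum>u\<in>words {..m} N. norm (\<Sum>k<N. c (u ! k)) powr p *
          (\<Prod>k\<in>{1..N}. of_bool (fst (y ! k) = u ! (k - 1)))) =
          (\<Sum>u\<in>words {..m} N. if u = z then norm (\<Sum>k<N. c (u ! k)) powr p else 0)"
        by (rule sum.cong[OF refl], subst prod, assumption) simp
      also have "\<dots> = norm (\<Sum>k<N. c (z ! k)) powr p" using z by simp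
      also have "(\<Sum>k<N. c (z ! k)) = (\<Sum>k=1..N. c (fst (y ! k)))"
        unfolding z_def by (simp add: sum.atLeast1_atMost_eq)
      finally show "norm (\<Sum>k=1..N. c (fst (y ! k))) powr p = (\<Sum>u\<in>words {..m} N. norm (\<Sum>k<N. c (u ! k)) powr p *
          (\<Prod>k\<in>{1..N}. of_bool (fst (y ! k) = u ! (k - 1))))" ..
    qed
    also have "\<dots> = (\<Sum>u\<in>words {..m} N. norm (\<Sum>k<N. c (u ! k)) powr p *
        ?T (\<lambda>x y. \<Prod>k\<in>{1..N}. of_bool (fst (y ! k) = u ! (k - 1))))"
      by (simp only: process.tree.T_sum process.tree.T_cmult)
    also have "\<dots> \<le> (\<Sum>u\<in>words {..m} N. norm (\<Sum>k<N. c (u ! k)) powr p *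
        (expectation (\<lambda>\<omega>. \<Prod>k=1..N. q k (u ! (k - 1)) \<omega>) + N / K))"
    proof (intro sum_mono mult_left_mono)
      fix u assume u: "u \<in> words {..m} N"
      let ?f = "\<lambda>k (h :: (nat \<times> nat list) list) a. if k < Suc N then of_bool (fst a = u ! (k - 1)) else 0 :: real"
      have "?T (\<lambda>x y. \<Prod>k\<in>{1..N}. of_bool (fst (y ! k) = u ! (k - 1))) =
          ?T (\<lambda>x y. 1 * (\<Prod>k\<in>{1..N}. ?f k (take k x) (y ! k)))"
        by (intro process.tree.T_cong) (auto intro!: prod.cong)
      also have "\<dots> = ?T (\<lambda>x y. 1 * (\<Prod>k\<in>{1..N}. \<Sum>a\<in>alphabet. process.kernel (take k x) a * ?f k (take k x) a))"
        by (rule process.tree.T_product[where c = "\<lambda>_. 0"]) auto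
      also have "\<dots> = ?T (\<lambda>x y. \<Prod>k=1..N. cond_mass (u ! (k - 1)) (take k x))"
        unfolding cond_mass_def by (intro process.tree.T_cong) (auto intro!: prod.cong)
      also have "\<dots> = expectation (\<lambda>\<omega>. \<Prod>k=1..N. cond_mass (u ! (k - 1)) (take k (process.path (Suc N) \<omega>)))"
        by (rule process.T_path)
      also have "\<dots> = expectation (\<lambda>\<omega>. \<Prod>k=1..N. cond_mass (u ! (k - 1)) (process.path k \<omega>))"
        by (intro Bochner_Integration.integral_cong refl prod.cong) (auto simp: process.take_path)
      also have "\<dots> \<le> expectation (\<lambda>\<omega>. \<Prod>k=1..N. q k (u ! (k - 1)) \<omega>) + N / K"
        by (rule expectation_prod_cond_mass_le[OF u])
      finally show "?T (\<lambda>x y. \<Prod>k\<in>{1..N}. of_bool (fst (y ! k) = u ! (k - 1))) \<le>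
          expectation (\<lambda>\<omega>. \<Prod>k=1..N. q k (u ! (k - 1)) \<omega>) + N / K" .
    qed simp
    finally show ?thesis .
  qed
  have err: "?T (\<lambda>x y. (\<Sum>k=1..N. norm (mean (take k x))) powr p) \<le>
      N powr p * (\<Sum>k=1..N. expectation (\<lambda>\<omega>. w k \<omega> powr p))"
  proof -
    have "?T (\<lambda>x y. (\<Sum>k=1..N. norm (mean (take k x))) powr p) \<le>
        ?T (\<lambda>x y. N powr p * (\<Sum>k=1..N. norm (mean (take k x)) powr p))"
      using p sum_powr_le[of "{1..N}" "\<lambda>k. norm (mean (take k _))" p]
      by (intro process.tree.T_mono) auto
    also have "\<dots> = N powr p * (\<Sum>k=1..N. ?T (\<lambda>x y. norm (mean (take k x)) powr p))"
      by (simp only: process.tree.T_sum process.tree.T_cmult)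
    also have "\<dots> \<le> N powr p * (\<Sum>k=1..N. expectation (\<lambda>\<omega>. w k \<omega> powr p))"
    proof (intro mult_left_mono sum_mono)
      fix k assume k: "k \<in> {1..N}"
      have "?T (\<lambda>x y. norm (mean (take k x)) powr p) =
          expectation (\<lambda>\<omega>. norm (mean (take k (process.path (Suc N) \<omega>))) powr p)"
        by (rule process.T_path)
      also have "\<dots> = expectation (\<lambda>\<omega>. norm (mean (process.path k \<omega>)) powr p)"
        using k by (simp add: process.take_path)
      also have "\<dots> \<le> expectation (\<lambda>\<omega>. w k \<omega> powr p)" by (rule expectation_mean_le[OF k])
      finally show "?T (\<lambda>x y. norm (mean (take k x)) powr p) \<le> expectation (\<lambda>\<omega>. w k \<omega> powr p)" .
    qed simp
    finally show ?thesis .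
  qed
  have "process.tree.decoupled_sum value_at p (Suc N) \<le>
      ?T (\<lambda>x y. ?L * norm (\<Sum>k=1..N. c (fst (y ! k))) powr p + ?R * (\<Sum>k=1..N. norm (mean (take k x))) powr p)"
    unfolding process.tree.decoupled_sum_def
  proof (rule process.tree.T_mono)
    fix x y assume x: "x \<in> words alphabet (Suc N)" and y: "y \<in> words alphabet (Suc N)"
    have 0: "process.tree.e value_at 0 x y = 0"
      by (simp add: process.tree.e_def value_at_def)
    have S: "process.tree.e value_at (Suc k) x y = c (fst (y ! Suc k)) - mean (take (Suc k) x)"
      if "k < N" for k
      using that length_words[OF x] by (simp add: process.tree.e_def value_at_def)
    have "(\<Sum>k<Suc N. process.tree.e value_at k x y) = (\<Sum>k=1..N. c (fst (y ! k)) - mean (take k x))"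
      unfolding sum.lessThan_Suc_shift 0 One_nat_def sum.atLeast1_atMost_eq by (simp add: S)
    also have "\<dots> = (\<Sum>k=1..N. c (fst (y ! k))) - (\<Sum>k=1..N. mean (take k x))"
      by (rule sum_subtractf)
    finally have "norm (\<Sum>k<Suc N. process.tree.e value_at k x y) \<le>
        norm (\<Sum>k=1..N. c (fst (y ! k))) + (\<Sum>k=1..N. norm (mean (take k x)))"
      by (simp only:) (rule order_trans[OF norm_triangle_ineq4 add_left_mono[OF norm_sum]])
    then have "norm (\<Sum>k<Suc N. process.tree.e value_at k x y) powr p \<le>
        (norm (\<Sum>k=1..N. c (fst (y ! k))) + (\<Sum>k=1..N. norm (mean (take k x)))) powr p"
      using p by (intro powr_mono2) auto
    also have "\<dots> \<le> ?L * norm (\<Sum>k=1..N. c (fst (y ! k))) powr p + ?R * (\<Sum>k=1..N. norm (mean (take k x))) powr p"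
      by (intro powr_add_split t p sum_nonneg) auto
    finally show "norm (\<Sum>k<Suc N. process.tree.e value_at k x y) powr p \<le>
        ?L * norm (\<Sum>k=1..N. c (fst (y ! k))) powr p + ?R * (\<Sum>k=1..N. norm (mean (take k x))) powr p" .
  qed
  also have "\<dots> = ?L * ?T (\<lambda>x y. norm (\<Sum>k=1..N. c (fst (y ! k))) powr p) +
      ?R * ?T (\<lambda>x y. (\<Sum>k=1..N. norm (mean (take k x))) powr p)"
    by (simp only: process.tree.T_add process.tree.T_cmult)
  also have "\<dots> \<le> ?L * (\<Sum>u\<in>words {..m} N. norm (\<Sum>k<N. c (u ! k)) powr p *
        (expectation (\<lambda>\<omega>. \<Prod>k=1..N. q k (u ! (k - 1)) \<omega>) + N / K)) +
      ?R * (N powr p * (\<Sum>k=1..N. expectation (\<lambda>\<omega>. w k \<omega> powr p)))"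
    by (intro add_mono mult_left_mono main err) auto
  finally have dec: "process.tree.decoupled_sum value_at p (Suc N) \<le> \<dots>" .
  have "process.tree.path_sum value_at p (Suc N) \<le> D * process.tree.decoupled_sum value_at p (Suc N)"
    by (rule tree[OF process.tree.kernel_tree_axioms value_at_centered]) simp
  also note mult_left_mono[OF dec D]
  finally show ?thesis unfolding path .
qed

end

section \<open>Removing the discretisation\<close>

lemma integrable_norm_sum_powr:
  fixes g :: "nat \<Rightarrow> 'w \<Rightarrow> 'x::banach"
  assumes "finite J" "0 \<le> p" "\<And>k. k \<in> J \<Longrightarrow> strongly_measurable M (g k)"
    "\<And>k. k \<in> J \<Longrightarrow> integrable M (\<lambda>\<omega>. norm (g k \<omega>) powr p)"
  shows "integrable M (\<lambda>\<omega>. norm (\<Sum>k\<in>J. g k \<omega>) powr p)"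
proof (rule Bochner_Integration.integrable_bound)
  show "integrable M (\<lambda>\<omega>. real (card J) powr p * (\<Sum>k\<in>J. norm (g k \<omega>) powr p))"
    using assms by (intro integrable_mult_right Bochner_Integration.integrable_sum) auto
  have "(\<lambda>\<omega>. norm (\<Sum>k\<in>J. g k \<omega>)) \<in> borel_measurable M"
    by (intro strongly_measurable_norm strongly_measurable_sum assms)
  then show "(\<lambda>\<omega>. norm (\<Sum>k\<in>J. g k \<omega>) powr p) \<in> borel_measurable M" by measurable
  show "AE \<omega> in M. norm (norm (\<Sum>k\<in>J. g k \<omega>) powr p) \<le>
      norm (real (card J) powr p * (\<Sum>k\<in>J. norm (g k \<omega>) powr p))"
  proof (rule AE_I2)
    fix \<omega>
    have "norm (\<Sum>k\<in>J. g k \<omega>) powr p \<le> (\<Sum>k\<in>J. norm (g k \<omega>)) powr p"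
      using assms by (intro powr_mono2 norm_sum) auto
    also have "\<dots> \<le> real (card J) powr p * (\<Sum>k\<in>J. norm (g k \<omega>) powr p)"
      using assms by (intro sum_powr_le) auto
    finally show "norm (norm (\<Sum>k\<in>J. g k \<omega>) powr p) \<le>
      norm (real (card J) powr p * (\<Sum>k\<in>J. norm (g k \<omega>) powr p))" by (simp add: sum_nonneg)
  qed
qed

lemma cond_prob_in_range:
  assumes M: "prob_space M" and H: "subalgebra M H" and f: "f \<in> borel_measurable M" and A: "A \<in> sets borel"
  shows "AE \<omega> in M. 0 \<le> cond_prob_in M H f A \<omega> \<and> cond_prob_in M H f A \<omega> \<le> 1"
proof -
  interpret prob_space M by (rule M)
  interpret finite_measure_subalgebra M H by unfold_locales (rule H)
  let ?B = "f -` A \<inter> space M"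
  have B: "?B \<in> sets M" by (rule measurable_sets[OF f A])
  then have int: "integrable M (indicator ?B :: _ \<Rightarrow> real)"
    by (intro integrable_real_indicator) (auto simp: emeasure_eq_measure)
  have "AE \<omega> in M. 0 \<le> real_cond_exp M H (indicator ?B) \<omega>"
    by (rule real_cond_exp_ge_c[OF int]) simp
  moreover have "AE \<omega> in M. real_cond_exp M H (indicator ?B) \<omega> \<le> 1"
    by (rule real_cond_exp_le_c[OF int]) (simp add: indicator_def)
  ultimately show ?thesis unfolding cond_prob_in_def by eventually_elim simp
qed

lemma measure_inter_cond_prob_in:
  assumes M: "prob_space M" and H: "subalgebra M H" and f: "f \<in> borel_measurable M" and A: "A \<in> sets borel"
    and B: "B \<in> sets H"
  shows "measure M {\<omega>\<in>B. f \<omega> \<in> A} = (\<integral>\<omega>. indicator B \<omega> * cond_prob_in M H f A \<omega> \<partial>M)"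
proof -
  interpret prob_space M by (rule M)
  interpret finite_measure_subalgebra M H by unfold_locales (rule H)
  let ?C = "f -` A \<inter> space M"
  have C: "?C \<in> sets M" by (rule measurable_sets[OF f A])
  then have int: "integrable M (indicator ?C :: _ \<Rightarrow> real)"
    by (intro integrable_real_indicator) (auto simp: emeasure_eq_measure)
  have BM: "B \<in> sets M" using B H unfolding subalgebra_def by blast
  have "{\<omega>\<in>B. f \<omega> \<in> A} = B \<inter> ?C" using sets.sets_into_space[OF BM] by auto
  then have "measure M {\<omega>\<in>B. f \<omega> \<in> A} = (\<integral>\<omega>. indicator (B \<inter> ?C) \<omega> \<partial>M)"
    using BM C by (simp add: Int_absorb2 sets.sets_into_space)
  also have "\<dots> = (\<integral>\<omega>\<in>B. indicator ?C \<omega> \<partial>M)"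
    unfolding set_lebesgue_integral_def by (simp add: indicator_inter_arith)
  also have "\<dots> = (\<integral>\<omega>\<in>B. real_cond_exp M H (indicator ?C) \<omega> \<partial>M)"
    by (rule real_cond_exp_intA[OF int B])
  finally show ?thesis unfolding set_lebesgue_integral_def cond_prob_in_def by simp
qed

context
  fixes M :: "'w measure" and F and M' :: "'v measure" and F' and f
    and d :: "nat \<Rightarrow> 'w \<Rightarrow> 'x::banach" and e :: "nat \<Rightarrow> 'v \<Rightarrow> 'x" and p D :: real and N :: nat
  assumes enl: "enlargement M F M' F' f" and dt: "decoupled_tangent M' F' (\<lambda>n \<omega>. d n (f \<omega>)) e"
    and md: "martingale_difference M F d" and Lp: "\<And>n. 1 \<le> n \<Longrightarrow> bochner_Lp M p (d n)"
    and p: "1 \<le> p" and N: "1 \<le> N" and D: "0 \<le> D"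
    and tree: "\<And>(S :: (nat \<times> nat list) set) \<kappa> (v :: (nat \<times> nat list) list \<Rightarrow> 'x) N.
      kernel_tree S \<kappa> \<Longrightarrow> (\<And>h. (\<Sum>a\<in>S. \<kappa> h a *\<^sub>R v (h @ [a])) = 0) \<Longrightarrow> 1 \<le> N \<Longrightarrow>
      kernel_tree.path_sum S \<kappa> v p N \<le> D * kernel_tree.decoupled_sum S \<kappa> v p N"
begin

lemma adapted: "adapted_seq F d"
  using md unfolding martingale_difference_def by blast

lemmas basis = enl_facts[OF enl dt adapted]
lemmas d_meas = d_borel[OF enl dt adapted]
lemmas e_meas = e_strong[OF enl dt adapted]

lemma integral_e_eq_d:
  fixes g :: "'x \<Rightarrow> real"
  assumes n: "1 \<le> n" and g: "g \<in> borel_measurable borel"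
  shows "(\<integral>\<omega>. g (e n \<omega>) \<partial>M') = (\<integral>\<omega>. g (d n \<omega>) \<partial>M)"
    "integrable M' (\<lambda>\<omega>. g (e n \<omega>)) \<longleftrightarrow> integrable M (\<lambda>\<omega>. g (d n \<omega>))"
proof -
  have em: "e n \<in> borel_measurable M'" by (rule strongly_measurable_borel[OF e_meas[OF n]])
  note eq = distr_e_eq_d[OF enl dt adapted n]
  show "(\<integral>\<omega>. g (e n \<omega>) \<partial>M') = (\<integral>\<omega>. g (d n \<omega>) \<partial>M)"
    using integral_distr[OF em g] integral_distr[OF d_meas(2)[OF n] g] eq by simp
  show "integrable M' (\<lambda>\<omega>. g (e n \<omega>)) \<longleftrightarrow> integrable M (\<lambda>\<omega>. g (d n \<omega>))"
    using integrable_distr_eq[OF em g] integrable_distr_eq[OF d_meas(2)[OF n] g] eq by simp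
qed

text \<open>At fixed \<open>\<eta>\<close> the rounding is fixed, and \<open>K\<close> can tend to
  infinity. The factor \<open>(1 - t) powr (1 - p)\<close> arises three times: when \<open>d\<close>
  is replaced by its recentred rounding, when the means are removed from the decoupled values of the
  tree, and when the rounded \<open>e\<close> is compared with \<open>e\<close>.\<close>

lemma approximate_bound:
  fixes t \<eta> :: real
  assumes t: "0 < t" "t < 1" and \<eta>: "0 < \<eta>"
  shows "(\<integral>\<omega>. norm (\<Sum>n=1..N. d n \<omega>) powr p \<partial>M) \<le>
    (1 - t) powr (1 - p) * (D * ((1 - t) powr (1 - p) *
      ((1 - t) powr (1 - p) * (\<integral>\<omega>. norm (\<Sum>n=1..N. e n \<omega>) powr p \<partial>M') + t powr (1 - p) * (N powr p * (N * \<eta>))) +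
      t powr (1 - p) * (N powr p * (N * \<eta>)))) +
    t powr (1 - p) * (N powr p * (2 powr p * (N * (\<eta> + \<eta>))))"
proof -
  let ?L = "(1 - t) powr (1 - p)" and ?R = "t powr (1 - p)"
  interpret PM: prob_space M by (rule stochastic_basisD(1)[OF basis(1)])
  interpret PM': prob_space M' by (rule stochastic_basisD(1)[OF basis(2)])
  have sub: "subalgebra M (F n)" for n by (rule stochastic_basisD(2)[OF basis(1)])
  have Lp': "\<And>k. k \<in> {1..N} \<Longrightarrow> bochner_Lp M p (d k)" using Lp by simp
  obtain m :: nat and c :: "nat \<Rightarrow> 'x" and \<iota> :: "'x \<Rightarrow> nat" where \<iota>: "\<iota> \<in> measurable borel (count_space UNIV)" "\<And>x. \<iota> x \<le> m"
    and near: "\<And>x. norm (c (\<iota> x) - x) \<le> norm x"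
    and close: "\<And>k. k \<in> {1..N} \<Longrightarrow> (\<integral>\<omega>. norm (c (\<iota> (d k \<omega>)) - d k \<omega>) powr p \<partial>M) \<le> \<eta>"
  proof (rule nearest_point_discretization[where g = d and J = "{1..N}" and M = M and p = p and \<eta> = \<eta>])
    show "bochner_Lp M p (d k)" if "k \<in> {1..N}" for k by (rule Lp'[OF that])
    fix m :: nat and c :: "nat \<Rightarrow> 'x" and \<iota> :: "'x \<Rightarrow> nat"
    assume "\<iota> \<in> measurable borel (count_space UNIV)" "\<And>x :: 'x. \<iota> x \<le> m"
      "\<And>x. norm (c (\<iota> x) - x) \<le> norm x"
      "\<And>k. k \<in> {1..N} \<Longrightarrow> (\<integral>\<omega>. norm (c (\<iota> (d k \<omega>)) - d k \<omega>) powr p \<partial>M) \<le> \<eta>"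
    then show thesis by (rule that)
  qed (rule PM.prob_space_axioms p finite_atLeastAtMost \<eta>)+
  have g_meas [measurable]: "(\<lambda>x. norm (c (\<iota> x) - x)) \<in> borel_measurable borel"
    by (rule measurable_compose_countable[OF _ \<iota>(1)])
      (intro borel_measurable_continuous_onI continuous_intros)
  define w where "w k \<omega> = norm (c (\<iota> (d k \<omega>)) - d k \<omega>)" for k \<omega>
  \<comment> \<open>Conditional probabilities lie in \<open>[0, 1]\<close> only almost everywhere;
    clipping makes the bounds hold at every point and leaves integrals unchanged.\<close>
  define q where "q k j \<omega> = min 1 (max 0 (cond_prob_in M (F (k - 1)) (d k) (\<iota> -` {j}) \<omega>))" for k j \<omega>
  have iota_sets: "\<iota> -` {j} \<in> sets borel" for j using measurable_sets[OF \<iota>(1), of "{j}"] by simp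
  have w0: "0 \<le> w k \<omega>" for k \<omega> unfolding w_def by simp
  have dp: "integrable M (\<lambda>\<omega>. norm (d k \<omega>) powr p)" "strongly_measurable M (d k)" if "k \<in> {1..N}" for k
    using Lp'[OF that] unfolding bochner_Lp_def by auto
  have w_meas: "w k \<in> borel_measurable M" if "k \<in> {1..N}" for k
    unfolding w_def using that by (intro measurable_compose[OF d_meas(2) g_meas]) simp
  have wp_int: "integrable M (\<lambda>\<omega>. w k \<omega> powr p)" if k: "k \<in> {1..N}" for k
  proof (rule Bochner_Integration.integrable_bound[OF dp(1)[OF k]])
    show "(\<lambda>\<omega>. w k \<omega> powr p) \<in> borel_measurable M" using w_meas[OF k] by measurable
    show "AE \<omega> in M. norm (w k \<omega> powr p) \<le> norm (norm (d k \<omega>) powr p)"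
      using near p unfolding w_def by (intro AE_I2) (simp add: powr_mono2)
  qed
  have w_int: "integrable M (w k)" if k: "k \<in> {1..N}" for k
  proof (rule Bochner_Integration.integrable_bound[of M "\<lambda>\<omega>. 1 + w k \<omega> powr p"])
    show "integrable M (\<lambda>\<omega>. 1 + w k \<omega> powr p)" using wp_int[OF k] by simp
    show "w k \<in> borel_measurable M" by (rule w_meas[OF k])
    have "w k \<omega> \<le> 1 + w k \<omega> powr p" for \<omega>
    proof (cases "w k \<omega> \<le> 1")
      case False
      then have "w k \<omega> powr 1 \<le> w k \<omega> powr p" using p by (intro powr_mono) auto
      then show ?thesis using False by simp
    qed (simp add: add_increasing2)
    then show "AE \<omega> in M. norm (w k \<omega>) \<le> norm (1 + w k \<omega> powr p)" using w0 by (intro AE_I2) simp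
  qed
  have q_AE: "AE \<omega> in M. q k j \<omega> = cond_prob_in M (F (k - 1)) (d k) (\<iota> -` {j}) \<omega>" if "k \<in> {1..N}" for k j
  proof -
    have "AE \<omega> in M. 0 \<le> cond_prob_in M (F (k - 1)) (d k) (\<iota> -` {j}) \<omega> \<and>
        cond_prob_in M (F (k - 1)) (d k) (\<iota> -` {j}) \<omega> \<le> 1"
      by (rule cond_prob_in_range[OF PM.prob_space_axioms sub d_meas(2) iota_sets]) (use that in simp)
    then show ?thesis unfolding q_def by eventually_elim simp
  qed
  have q_meas: "q k j \<in> borel_measurable (F (k - 1))" for k j
  proof -
    have [measurable]: "cond_prob_in M (F (k - 1)) (d k) (\<iota> -` {j}) \<in> borel_measurable (F (k - 1))"
      unfolding cond_prob_in_def by (rule borel_measurable_cond_exp)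
    show ?thesis unfolding q_def by measurable
  qed
  have cp_meas: "cond_prob_in M H (d k) A \<in> borel_measurable M" for H k A
    unfolding cond_prob_in_def by (rule borel_measurable_cond_exp2)
  define U where "U = (\<integral>\<omega>. norm (\<Sum>n=1..N. c (\<iota> (e n \<omega>))) powr p \<partial>M')"
  \<comment> \<open>\<open>V / K\<close> is the error caused by rounding the conditional
    probabilities; \<open>V\<close> itself does not depend on \<open>K\<close>.\<close>
  define V where "V = (\<Sum>u\<in>words {..m} N. norm (\<Sum>k<N. c (u ! k)) powr p * real N)"
  have U_eq: "(\<Sum>u\<in>words {..m} N. norm (\<Sum>k<N. c (u ! k)) powr p *
      PM.expectation (\<lambda>\<omega>. \<Prod>k=1..N. q k (u ! (k - 1)) \<omega>)) = U"
  proof -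
    have e_disc: "(\<lambda>\<omega>. \<iota> (e (Suc k) \<omega>)) \<in> measurable M' (count_space UNIV)" for k
      by (rule measurable_compose[OF strongly_measurable_borel[OF e_meas] \<iota>(1)]) simp
    \<comment> \<open>The rounded \<open>e\<close> is a finite process on the enlarged space, so its
      moment is a sum over words weighted by path probabilities, and these are given by
      \<open>decoupled_joint_law\<close>.\<close>
    interpret Q: finite_process M' "\<lambda>k \<omega>. \<iota> (e (Suc k) \<omega>)" "{..m}"
      by unfold_locales (use \<iota>(2) e_disc in auto)
    have "U = PM'.expectation (\<lambda>\<omega>. norm (\<Sum>k<N. c (Q.path N \<omega> ! k)) powr p)"
      unfolding U_def One_nat_def sum.atLeast1_atMost_eq
      by (intro Bochner_Integration.integral_cong refl arg_cong[where f = "\<lambda>z. norm z powr p"] sum.cong)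
        (simp add: Q.nth_path)
    also have "\<dots> = (\<Sum>u\<in>words {..m} N. Q.path_prob u * norm (\<Sum>k<N. c (u ! k)) powr p)"
      by (rule Q.expectation_path)
    also have "\<dots> = (\<Sum>u\<in>words {..m} N. norm (\<Sum>k<N. c (u ! k)) powr p *
      PM.expectation (\<lambda>\<omega>. \<Prod>k=1..N. q k (u ! (k - 1)) \<omega>))"
    proof (rule sum.cong[OF refl])
      fix u assume u: "u \<in> words {..m} N"
      have "{\<omega>\<in>space M'. Q.path (length u) \<omega> = u} =
          {\<omega>\<in>space M'. \<forall>k\<in>{1..N}. e k \<omega> \<in> \<iota> -` {u ! (k - 1)}}"
      proof -
        have "(\<forall>k<N. \<iota> (e (Suc k) \<omega>) = u ! k) \<longleftrightarrow> (\<forall>k\<in>{1..N}. e k \<omega> \<in> \<iota> -` {u ! (k - 1)})" for \<omega>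
        proof -
          have "(\<forall>k\<in>{1..N}. P k) \<longleftrightarrow> (\<forall>k<N. P (Suc k))" for P
            by (metis Suc_le_eq Suc_le_mono atLeastAtMost_iff le0 One_nat_def not0_implies_Suc not_one_le_zero)
          then show ?thesis by simp
        qed
        then show ?thesis unfolding length_words[OF u] Q.path_eq_iff[OF length_words[OF u]] by simp
      qed
      then have "Q.path_prob u = PM.expectation (\<lambda>\<omega>. \<Prod>k=1..N. cond_prob_in M (F (k - 1)) (d k) (\<iota> -` {u ! (k - 1)}) \<omega>)"
        unfolding Q.path_prob_def
        using decoupled_joint_law[OF enl dt adapted N, of "\<lambda>k. \<iota> -` {u ! (k - 1)}"] iota_sets by simp
      also have "\<dots> = PM.expectation (\<lambda>\<omega>. \<Prod>k=1..N. q k (u ! (k - 1)) \<omega>)"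
      proof (rule integral_cong_AE)
        have "AE \<omega> in M. \<forall>k\<in>{1..N}. q k (u ! (k - 1)) \<omega> =
            cond_prob_in M (F (k - 1)) (d k) (\<iota> -` {u ! (k - 1)}) \<omega>"
          by (rule AE_finite_allI) (use q_AE in auto)
        then show "AE \<omega> in M. (\<Prod>k=1..N. cond_prob_in M (F (k - 1)) (d k) (\<iota> -` {u ! (k - 1)}) \<omega>) =
            (\<Prod>k=1..N. q k (u ! (k - 1)) \<omega>)"
          by eventually_elim (auto intro!: prod.cong)
      qed (auto intro!: borel_measurable_prod cp_meas measurable_from_subalg[OF sub q_meas])
      finally show "Q.path_prob u * norm (\<Sum>k<N. c (u ! k)) powr p = norm (\<Sum>k<N. c (u ! k)) powr p *
          PM.expectation (\<lambda>\<omega>. \<Prod>k=1..N. q k (u ! (k - 1)) \<omega>)" by simp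
    qed
    finally show ?thesis ..
  qed
  have w_sum: "(\<Sum>k=1..N. PM.expectation (\<lambda>\<omega>. w k \<omega> powr p)) \<le> N * \<eta>"
    using sum_bounded_above[of "{1..N}" "\<lambda>k. PM.expectation (\<lambda>\<omega>. w k \<omega> powr p)" \<eta>] close
    unfolding w_def by simp
  have U_le: "U \<le> ?L * (\<integral>\<omega>. norm (\<Sum>n=1..N. e n \<omega>) powr p \<partial>M') + ?R * (N powr p * (N * \<eta>))"
  proof -
    let ?w = "\<lambda>k \<omega>. norm (c (\<iota> (e k \<omega>)) - e k \<omega>) powr p"
    have gp: "(\<lambda>x. norm (c (\<iota> x) - x) powr p) \<in> borel_measurable borel" by measurable
    have [measurable]: "(\<lambda>x::'x. norm x) \<in> borel_measurable borel"
      by (intro borel_measurable_continuous_onI continuous_intros)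
    have np: "(\<lambda>x::'x. norm x powr p) \<in> borel_measurable borel" by measurable
    have int_e: "integrable M' (\<lambda>\<omega>. norm (\<Sum>n=1..N. e n \<omega>) powr p)"
      using p dp(1) integral_e_eq_d(2)[OF _ np] e_meas
      by (intro integrable_norm_sum_powr) auto
    have int_w: "integrable M' (?w k)" if k: "k \<in> {1..N}" for k
      using integral_e_eq_d(2)[OF _ gp, of k] wp_int[OF k] k unfolding w_def by simp
    have "U \<le> PM'.expectation (\<lambda>\<omega>. ?L * norm (\<Sum>n=1..N. e n \<omega>) powr p + ?R * (N powr p * (\<Sum>k=1..N. ?w k \<omega>)))"
      unfolding U_def
    proof (rule integral_mono')
      show "integrable M' (\<lambda>\<omega>. ?L * norm (\<Sum>n=1..N. e n \<omega>) powr p + ?R * (N powr p * (\<Sum>k=1..N. ?w k \<omega>)))"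
        using int_e int_w by (intro Bochner_Integration.integrable_add integrable_mult_right
            Bochner_Integration.integrable_sum) auto
      fix \<omega>
      have "(\<Sum>n=1..N. c (\<iota> (e n \<omega>))) = (\<Sum>n=1..N. e n \<omega>) + (\<Sum>n=1..N. c (\<iota> (e n \<omega>)) - e n \<omega>)"
        by (simp add: sum_subtractf)
      then have "norm (\<Sum>n=1..N. c (\<iota> (e n \<omega>))) \<le>
          norm (\<Sum>n=1..N. e n \<omega>) + (\<Sum>n=1..N. norm (c (\<iota> (e n \<omega>)) - e n \<omega>))"
        by (simp only:) (rule order_trans[OF norm_triangle_ineq add_left_mono[OF norm_sum]])
      then have "norm (\<Sum>n=1..N. c (\<iota> (e n \<omega>))) powr p \<le>
          (norm (\<Sum>n=1..N. e n \<omega>) + (\<Sum>n=1..N. norm (c (\<iota> (e n \<omega>)) - e n \<omega>))) powr p"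
        using p by (intro powr_mono2) auto
      also have "\<dots> \<le> ?L * norm (\<Sum>n=1..N. e n \<omega>) powr p +
          ?R * (\<Sum>n=1..N. norm (c (\<iota> (e n \<omega>)) - e n \<omega>)) powr p"
        by (intro powr_add_split t p sum_nonneg) auto
      also have "\<dots> \<le> ?L * norm (\<Sum>n=1..N. e n \<omega>) powr p + ?R * (N powr p * (\<Sum>k=1..N. ?w k \<omega>))"
        using p sum_powr_le[of "{1..N}" "\<lambda>n. norm (c (\<iota> (e n \<omega>)) - e n \<omega>)" p]
        by (intro add_left_mono mult_left_mono) auto
      finally show "norm (\<Sum>n=1..N. c (\<iota> (e n \<omega>))) powr p \<le>
          ?L * norm (\<Sum>n=1..N. e n \<omega>) powr p + ?R * (N powr p * (\<Sum>k=1..N. ?w k \<omega>))" .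
    qed (auto intro!: add_nonneg_nonneg mult_nonneg_nonneg sum_nonneg)
    also have "\<dots> = ?L * (\<integral>\<omega>. norm (\<Sum>n=1..N. e n \<omega>) powr p \<partial>M') +
        ?R * (N powr p * (\<Sum>k=1..N. PM'.expectation (?w k)))"
    proof -
      have "integrable M' (\<lambda>\<omega>. \<Sum>k=1..N. ?w k \<omega>)"
        using int_w by (intro Bochner_Integration.integrable_sum) auto
      then show ?thesis
        using int_e Bochner_Integration.integral_sum[of "{1..N}" M' ?w] int_w
        by (subst Bochner_Integration.integral_add) (auto intro!: integrable_mult_right)
    qed
    also have "\<dots> \<le> ?L * (\<integral>\<omega>. norm (\<Sum>n=1..N. e n \<omega>) powr p \<partial>M') + ?R * (N powr p * (N * \<eta>))"
    proof -
      have "PM'.expectation (?w k) = PM.expectation (\<lambda>\<omega>. w k \<omega> powr p)" if "k \<in> {1..N}" for k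
        using integral_e_eq_d(1)[OF _ gp, of k] that unfolding w_def by simp
      then show ?thesis using w_sum by (intro add_left_mono mult_left_mono) auto
    qed
    finally show ?thesis .
  qed
  have bound_K: "(\<integral>\<omega>. norm (\<Sum>n=1..N. d n \<omega>) powr p \<partial>M) \<le>
      ?L * (D * (?L * (U + V / K) + ?R * (N powr p * (N * \<eta>)))) + ?R * (N powr p * (2 powr p * (N * (\<eta> + \<eta>))))"
    if K: "0 < K" for K :: nat
  proof -
    interpret Z: discretization M F "\<lambda>k \<omega>. \<iota> (d k \<omega>)" q c w N m K p
    proof unfold_locales
      show "sets (F l) \<subseteq> sets (F n)" if "l \<le> n" for l n
        by (rule stochastic_basisD(4)[OF basis(1) that])
      show "(\<lambda>\<omega>. \<iota> (d k \<omega>)) \<in> measurable (F k) (count_space UNIV)" if "k \<in> {1..N}" for k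
        using that by (intro measurable_compose[OF d_meas(1) \<iota>(1)]) simp
      show "PM.prob {\<omega>\<in>B. \<iota> (d k \<omega>) = j} = PM.expectation (\<lambda>\<omega>. indicator B \<omega> * q k j \<omega>)"
        if k: "k \<in> {1..N}" and B: "B \<in> sets (F (k - 1))" for k j B
      proof -
        have BM: "B \<in> sets M" using B sub unfolding subalgebra_def by blast
        have "PM.prob {\<omega>\<in>B. \<iota> (d k \<omega>) = j} = PM.prob {\<omega>\<in>B. d k \<omega> \<in> \<iota> -` {j}}" by simp
        also have "\<dots> = PM.expectation (\<lambda>\<omega>. indicator B \<omega> * cond_prob_in M (F (k - 1)) (d k) (\<iota> -` {j}) \<omega>)"
          by (rule measure_inter_cond_prob_in[OF PM.prob_space_axioms sub d_meas(2) iota_sets B]) (use k in simp)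
        also have "\<dots> = PM.expectation (\<lambda>\<omega>. indicator B \<omega> * q k j \<omega>)"
          using q_AE[OF k, of j] BM
          by (intro integral_cong_AE borel_measurable_times borel_measurable_indicator cp_meas
              measurable_from_subalg[OF sub q_meas]) auto
        finally show ?thesis .
      qed
      show "norm (\<Sum>j\<le>m. PM.prob {\<omega>\<in>B. \<iota> (d k \<omega>) = j} *\<^sub>R c j) \<le> PM.expectation (\<lambda>\<omega>. indicator B \<omega> * w k \<omega>)"
        if k: "k \<in> {1..N}" and B: "B \<in> sets (F (k - 1))" for k B
        unfolding w_def
      proof (rule cond_exp_zero_discretization[OF PM.prob_space_axioms sub _ B])
        show "is_cond_exp M (F (k - 1)) (d k) (\<lambda>_. 0)"
          using md k unfolding martingale_difference_def by simp
        show "(\<lambda>\<omega>. \<iota> (d k \<omega>)) \<in> measurable M (count_space UNIV)"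
          using k by (intro measurable_compose[OF d_meas(2) \<iota>(1)]) simp
        show "integrable M (\<lambda>\<omega>. norm (c (\<iota> (d k \<omega>)) - d k \<omega>))"
          using w_int[OF k] unfolding w_def .
      qed (rule \<iota>(2))
    qed (use sub N p K \<iota>(2) q_meas w0 w_int wp_int in \<open>auto simp: q_def\<close>)
    define mh where "mh k \<omega> = Z.mean (Z.process.path k \<omega>)" for k \<omega>
    have mh: "simple_function M (mh k)" for k
      unfolding mh_def by (rule simple_function_compose1[OF Z.process.simple_function_path])
    have mhp: "integrable M (\<lambda>\<omega>. norm (mh k \<omega>) powr p)" for k
      unfolding mh_def by (rule Z.process.integrable_path)
    let ?f = "\<lambda>k \<omega>. c (\<iota> (d k \<omega>)) - mh k \<omega>"
    have "PM.expectation (\<lambda>\<omega>. norm (\<Sum>k=1..N. ?f k \<omega>) powr p) \<le>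
        D * (?L * (\<Sum>u\<in>words {..m} N. norm (\<Sum>k<N. c (u ! k)) powr p *
          (PM.expectation (\<lambda>\<omega>. \<Prod>k=1..N. q k (u ! (k - 1)) \<omega>) + N / K)) +
        ?R * (N powr p * (\<Sum>k=1..N. PM.expectation (\<lambda>\<omega>. w k \<omega> powr p))))"
      unfolding mh_def by (rule Z.discretized_bound[OF t D tree])
    also have "(\<Sum>u\<in>words {..m} N. norm (\<Sum>k<N. c (u ! k)) powr p *
          (PM.expectation (\<lambda>\<omega>. \<Prod>k=1..N. q k (u ! (k - 1)) \<omega>) + N / K)) = U + V / K"
      unfolding U_eq[symmetric] V_def sum_divide_distrib by (simp add: distrib_left sum.distrib)
    also have "D * (?L * (U + V / K) + ?R * (N powr p * (\<Sum>k=1..N. PM.expectation (\<lambda>\<omega>. w k \<omega> powr p)))) \<le>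
        D * (?L * (U + V / K) + ?R * (N powr p * (N * \<eta>)))"
      by (intro mult_left_mono add_left_mono w_sum D) auto
    finally have 1: "PM.expectation (\<lambda>\<omega>. norm (\<Sum>k=1..N. ?f k \<omega>) powr p) \<le>
        D * (?L * (U + V / K) + ?R * (N powr p * (N * \<eta>)))" .
    let ?g = "\<lambda>\<omega>. \<Sum>k=1..N. w k \<omega> powr p + norm (mh k \<omega>) powr p"
    have int_f: "integrable M (\<lambda>\<omega>. norm (\<Sum>k=1..N. ?f k \<omega>) powr p)"
    proof -
      have "simple_function M (?f k)" if "k \<in> {1..N}" for k
      proof -
        have "simple_function M (\<lambda>\<omega>. \<iota> (d k \<omega>))"
          unfolding simple_function_def
        proof (intro conjI ballI)
          show "finite ((\<lambda>\<omega>. \<iota> (d k \<omega>)) ` space M)"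
            by (rule finite_subset[of _ "{..m}"]) (use \<iota>(2) in auto)
          show "(\<lambda>\<omega>. \<iota> (d k \<omega>)) -` {x} \<inter> space M \<in> sets M" for x
            using that by (intro measurable_sets[OF measurable_compose[OF d_meas(2) \<iota>(1)]]) auto
        qed
        from simple_function_compose2[OF this mh, of "\<lambda>j z. c j - z"] show ?thesis .
      qed
      then have "simple_function M (\<lambda>\<omega>. norm (\<Sum>k=1..N. ?f k \<omega>) powr p)"
        by (intro simple_function_compose1[of M _ "\<lambda>z. norm z powr p"] simple_function_sum) auto
      then show ?thesis
        by (intro integrableI_simple_bochner_integrable)
          (auto simp: Bochner_Integration.simple_bochner_integrable.simps PM.emeasure_eq_measure)
    qed
    have int_g: "integrable M ?g" using wp_int mhp by (intro Bochner_Integration.integrable_sum) auto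
    have "(\<integral>\<omega>. norm (\<Sum>n=1..N. d n \<omega>) powr p \<partial>M) \<le>
        PM.expectation (\<lambda>\<omega>. ?L * norm (\<Sum>k=1..N. ?f k \<omega>) powr p + ?R * (N powr p * (2 powr p * ?g \<omega>)))"
    proof (rule integral_mono')
      show "integrable M (\<lambda>\<omega>. ?L * norm (\<Sum>k=1..N. ?f k \<omega>) powr p + ?R * (N powr p * (2 powr p * ?g \<omega>)))"
        using int_f int_g by (intro Bochner_Integration.integrable_add integrable_mult_right)
      fix \<omega>
      \<comment> \<open>Each \<open>d k\<close> deviates from its recentred rounding by the
        conditional mean and the rounding error. Both have p-th moment at most
        \<open>\<eta>\<close>, which is the origin of \<open>\<eta> + \<eta>\<close>.\<close>
      have "(\<Sum>n=1..N. d n \<omega>) = (\<Sum>k=1..N. ?f k \<omega>) + (\<Sum>k=1..N. mh k \<omega> - (c (\<iota> (d k \<omega>)) - d k \<omega>))"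
        by (simp add: sum_subtractf)
      then have "norm (\<Sum>n=1..N. d n \<omega>) \<le>
          norm (\<Sum>k=1..N. ?f k \<omega>) + (\<Sum>k=1..N. norm (mh k \<omega> - (c (\<iota> (d k \<omega>)) - d k \<omega>)))"
        by (simp only:) (rule order_trans[OF norm_triangle_ineq add_left_mono[OF norm_sum]])
      also have "\<dots> \<le> norm (\<Sum>k=1..N. ?f k \<omega>) + (\<Sum>k=1..N. w k \<omega> + norm (mh k \<omega>))"
        unfolding w_def by (intro add_left_mono sum_mono) (metis add.commute norm_triangle_ineq4)
      finally have "norm (\<Sum>n=1..N. d n \<omega>) powr p \<le>
          (norm (\<Sum>k=1..N. ?f k \<omega>) + (\<Sum>k=1..N. w k \<omega> + norm (mh k \<omega>))) powr p"
        using p by (intro powr_mono2) auto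
      also have "\<dots> \<le> ?L * norm (\<Sum>k=1..N. ?f k \<omega>) powr p + ?R * (\<Sum>k=1..N. w k \<omega> + norm (mh k \<omega>)) powr p"
        using w0 by (intro powr_add_split t p sum_nonneg) auto
      also have "(\<Sum>k=1..N. w k \<omega> + norm (mh k \<omega>)) powr p \<le> N powr p * (\<Sum>k=1..N. (w k \<omega> + norm (mh k \<omega>)) powr p)"
        using p w0 sum_powr_le[of "{1..N}" "\<lambda>k. w k \<omega> + norm (mh k \<omega>)" p] by simp
      also have "(\<Sum>k=1..N. (w k \<omega> + norm (mh k \<omega>)) powr p) \<le> 2 powr p * ?g \<omega>"
        unfolding sum_distrib_left by (intro sum_mono powr_add_le w0 p) auto
      finally show "norm (\<Sum>n=1..N. d n \<omega>) powr p \<le>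
          ?L * norm (\<Sum>k=1..N. ?f k \<omega>) powr p + ?R * (N powr p * (2 powr p * ?g \<omega>))"
        by (simp add: mult_left_mono)
    qed (auto intro!: add_nonneg_nonneg mult_nonneg_nonneg sum_nonneg)
    also have "\<dots> = ?L * PM.expectation (\<lambda>\<omega>. norm (\<Sum>k=1..N. ?f k \<omega>) powr p) +
        ?R * (N powr p * (2 powr p * PM.expectation ?g))"
      by (simp only: Bochner_Integration.integral_add[OF integrable_mult_right[OF int_f]
            integrable_mult_right[OF integrable_mult_right[OF integrable_mult_right[OF int_g]]]]
          integral_mult_right_zero)
    also have "\<dots> \<le> ?L * (D * (?L * (U + V / K) + ?R * (N powr p * (N * \<eta>)))) +
        ?R * (N powr p * (2 powr p * (N * (\<eta> + \<eta>))))"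
    proof (intro add_mono mult_left_mono 1)
      have "PM.expectation ?g = (\<Sum>k=1..N. PM.expectation (\<lambda>\<omega>. w k \<omega> powr p) + PM.expectation (\<lambda>\<omega>. norm (mh k \<omega>) powr p))"
        using wp_int mhp by (subst Bochner_Integration.integral_sum) auto
      also have "\<dots> \<le> (\<Sum>k=1..N. \<eta> + \<eta>)"
      proof (intro sum_mono add_mono)
        fix k assume k: "k \<in> {1..N}"
        show *: "PM.expectation (\<lambda>\<omega>. w k \<omega> powr p) \<le> \<eta>" unfolding w_def by (rule close[OF k])
        show "PM.expectation (\<lambda>\<omega>. norm (mh k \<omega>) powr p) \<le> \<eta>"
          unfolding mh_def by (rule order_trans[OF Z.expectation_mean_le[OF k] *])
      qed
      finally show "PM.expectation ?g \<le> N * (\<eta> + \<eta>)" by simp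
    qed auto
    finally show ?thesis .
  qed
  have "(\<lambda>n. ?L * (D * (?L * (U + V * inverse (real (Suc n))) + ?R * (N powr p * (N * \<eta>)))) +
      ?R * (N powr p * (2 powr p * (N * (\<eta> + \<eta>))))) \<longlonglongrightarrow>
      ?L * (D * (?L * (U + V * 0) + ?R * (N powr p * (N * \<eta>)))) + ?R * (N powr p * (2 powr p * (N * (\<eta> + \<eta>))))"
    by (intro tendsto_intros LIMSEQ_inverse_real_of_nat)
  then have "(\<integral>\<omega>. norm (\<Sum>n=1..N. d n \<omega>) powr p \<partial>M) \<le>
      ?L * (D * (?L * (U + V * 0) + ?R * (N powr p * (N * \<eta>)))) + ?R * (N powr p * (2 powr p * (N * (\<eta> + \<eta>))))"
    by (rule LIMSEQ_le_const) (use bound_K[of "Suc _"] in \<open>auto simp: divide_inverse\<close>)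
  also have "\<dots> \<le> ?L * (D * (?L * (?L * (\<integral>\<omega>. norm (\<Sum>n=1..N. e n \<omega>) powr p \<partial>M') + ?R * (N powr p * (N * \<eta>))) +
      ?R * (N powr p * (N * \<eta>)))) + ?R * (N powr p * (2 powr p * (N * (\<eta> + \<eta>))))"
    using U_le D by (intro add_right_mono mult_left_mono) auto
  finally show ?thesis .
qed

text \<open>First \<open>\<eta>\<close> tends to \<open>0\<close>, which removes all error terms
  although their factor \<open>t powr (1 - p)\<close> may be large; only then does \<open>t\<close>
  tend to \<open>0\<close>, and the three factors of the main term tend to \<open>1\<close>.\<close>

lemma powr_bound:
  "(\<integral>\<omega>. norm (\<Sum>n=1..N. d n \<omega>) powr p \<partial>M) \<le> D * (\<integral>\<omega>. norm (\<Sum>n=1..N. e n \<omega>) powr p \<partial>M')"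
proof -
  let ?A = "\<integral>\<omega>. norm (\<Sum>n=1..N. d n \<omega>) powr p \<partial>M"
  let ?B = "\<integral>\<omega>. norm (\<Sum>n=1..N. e n \<omega>) powr p \<partial>M'"
  have step: "?A \<le> (1 - t) powr (1 - p) * (D * ((1 - t) powr (1 - p) * ((1 - t) powr (1 - p) * ?B)))"
    if t: "0 < t" "t < 1" for t
  proof -
    let ?L = "(1 - t) powr (1 - p)" and ?R = "t powr (1 - p)"
    let ?h = "\<lambda>\<eta> :: real. ?L * (D * (?L * (?L * ?B + ?R * (N powr p * (N * \<eta>))) + ?R * (N powr p * (N * \<eta>)))) +
      ?R * (N powr p * (2 powr p * (N * (\<eta> + \<eta>))))"
    have "(\<lambda>n. ?h (inverse (real (Suc n)))) \<longlonglongrightarrow> ?h 0"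
      by (intro tendsto_intros LIMSEQ_inverse_real_of_nat)
    then have "?A \<le> ?h 0"
      by (rule LIMSEQ_le_const) (use approximate_bound[OF t] in auto)
    then show ?thesis by simp
  qed
  let ?t = "\<lambda>n. inverse (real (Suc n)) / 2"
  have "?t \<longlonglongrightarrow> 0 / 2" by (intro tendsto_intros LIMSEQ_inverse_real_of_nat) simp
  then have L: "(\<lambda>n. (1 - ?t n) powr (1 - p)) \<longlonglongrightarrow> (1 - 0 / 2) powr (1 - p)"
    by (intro tendsto_powr tendsto_diff tendsto_const) auto
  have "(\<lambda>n. (1 - ?t n) powr (1 - p) * (D * ((1 - ?t n) powr (1 - p) * ((1 - ?t n) powr (1 - p) * ?B))))
      \<longlonglongrightarrow> (1 - 0 / 2) powr (1 - p) * (D * ((1 - 0 / 2) powr (1 - p) * ((1 - 0 / 2) powr (1 - p) * ?B)))"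
    by (intro tendsto_mult tendsto_const L)
  moreover have "?A \<le> (1 - ?t n) powr (1 - p) * (D * ((1 - ?t n) powr (1 - p) * ((1 - ?t n) powr (1 - p) * ?B)))" for n
  proof (rule step)
    show "?t n < 1" using le_imp_inverse_le[of 1 "real (Suc n)"] by simp
  qed simp
  ultimately have "?A \<le> (1 - 0 / 2) powr (1 - p) * (D * ((1 - 0 / 2) powr (1 - p) * ((1 - 0 / 2) powr (1 - p) * ?B)))"
    by (intro LIMSEQ_le_const) auto
  then show ?thesis by simp
qed

end

text \<open>Trees over one countable alphabet serve all carrier types, because a letter of the
  discretisation is just an index with a list of naturals.\<close>

lemma decoupling_bound_of_tree_bound:
  assumes p: "1 \<le> p" and C: "0 \<le> C"
    and tree: "\<And>(S :: (nat \<times> nat list) set) \<kappa> (v :: (nat \<times> nat list) list \<Rightarrow> 'x::banach) N.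
      kernel_tree S \<kappa> \<Longrightarrow> (\<And>h. (\<Sum>a\<in>S. \<kappa> h a *\<^sub>R v (h @ [a])) = 0) \<Longrightarrow> 1 \<le> N \<Longrightarrow>
      kernel_tree.path_sum S \<kappa> v p N \<le> C powr p * kernel_tree.decoupled_sum S \<kappa> v p N"
  shows "decoupling_bound TYPE('w) TYPE('v) TYPE('x) p C"
  unfolding decoupling_bound_def
proof (intro allI impI)
  fix M :: "'w measure" and F and d :: "nat \<Rightarrow> 'w \<Rightarrow> 'x" and M' :: "'v measure" and F' f e N
  assume md: "martingale_difference M F d" and Lp: "\<forall>n\<ge>1. bochner_Lp M p (d n)"
    and enl: "enlargement M F M' F' f" and dt: "decoupled_tangent M' F' (\<lambda>n \<omega>. d n (f \<omega>)) e"
    and N: "1 \<le> (N :: nat)"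
  let ?A = "\<integral>\<omega>. norm (\<Sum>n=1..N. d n \<omega>) powr p \<partial>M"
  let ?B = "\<integral>\<omega>. norm (\<Sum>n=1..N. e n \<omega>) powr p \<partial>M'"
  have "?A \<le> C powr p * ?B"
    by (rule powr_bound[OF enl dt md Lp[rule_format] p N powr_ge_zero tree])
  moreover have "0 \<le> ?A" "0 \<le> ?B" by (simp_all add: integral_nonneg)
  ultimately have "?A powr (1 / p) \<le> (C powr p * ?B) powr (1 / p)"
    using p by (intro powr_mono2) auto
  also have "\<dots> = (C powr p) powr (1 / p) * ?B powr (1 / p)" by (rule powr_mult)
  also have "(C powr p) powr (1 / p) = C" using C p by (simp add: powr_powr)
  finally show "Lp_norm M p (\<lambda>\<omega>. \<Sum>n=1..N. d n \<omega>) \<le> C * Lp_norm M' p (\<lambda>\<omega>. \<Sum>n=1..N. e n \<omega>)"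
    unfolding Lp_norm_def .
qed

text \<open>A negative constant is only admissible for the zero space: test it on the fair coin \<open>\<plusminus>z\<close>.\<close>

lemma decoupling_bound_negative:
  assumes bound: "decoupling_bound TYPE(real) TYPE(real) TYPE('x::banach) p C" and C: "C < 0"
  shows "z = (0 :: 'x)"
proof (rule ccontr)
  assume z: "z \<noteq> 0"
  interpret kernel_tree "{False, True}" "\<lambda>_ _. 1/2"
    by unfold_locales auto
  let ?v = "\<lambda>h. if last h then z else - z"
  have "path_sum ?v p 1 powr (1 / p) \<le> C * decoupled_sum ?v p 1 powr (1 / p)"
    by (rule path_sum_bound[OF bound]) auto
  also have "\<dots> \<le> 0" using C by (intro mult_nonpos_nonneg) auto
  also have "path_sum ?v p 1 = norm z powr p"
  proof -
    have "norm (if b then z else - z) = norm z" for b by simp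
    then show ?thesis unfolding path_sum_def d_def by (simp add: T_const)
  qed
  finally have "(norm z powr p) powr (1 / p) \<le> 0" .
  then show False using z by simp
qed

theorem proposition2:
  assumes "umd TYPE('x::banach)"
  shows "\<forall>p::real. 1 \<le> p \<longrightarrow>
    (\<exists>C::real. decoupling_bound TYPE(real) TYPE(real) TYPE('x) p C) \<and>
    (\<forall>C::real. decoupling_bound TYPE(real) TYPE(real) TYPE('x) p C \<longrightarrow>
               decoupling_bound TYPE('w) TYPE('v) TYPE('x) p C)"
proof (intro allI impI conjI)
  fix p :: real assume p: "1 \<le> p"
  obtain D where D: "0 \<le> D" and tree: "\<And>(S :: (nat \<times> nat list) set) \<kappa> (v :: (nat \<times> nat list) list \<Rightarrow> 'x) N.
      kernel_tree S \<kappa> \<Longrightarrow> \<forall>h. (\<Sum>a\<in>S. \<kappa> h a *\<^sub>R v (h @ [a])) = 0 \<Longrightarrow>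
      kernel_tree.path_sum S \<kappa> v p N \<le> D * kernel_tree.decoupled_sum S \<kappa> v p N"
    using exists_tree_constant[OF assms p] by blast
  show "\<exists>C::real. decoupling_bound TYPE(real) TYPE(real) TYPE('x) p C"
  proof
    \<comment> \<open>The tree inequality compares p-th moments, hence the root of
      \<open>D\<close>.\<close>
    show "decoupling_bound TYPE(real) TYPE(real) TYPE('x) p (D powr (1 / p))"
    proof (rule decoupling_bound_of_tree_bound[OF p])
      fix S :: "(nat \<times> nat list) set" and \<kappa> and v :: "(nat \<times> nat list) list \<Rightarrow> 'x" and N :: nat
      assume "kernel_tree S \<kappa>" "\<And>h. (\<Sum>a\<in>S. \<kappa> h a *\<^sub>R v (h @ [a])) = 0"
      then have "kernel_tree.path_sum S \<kappa> v p N \<le> D * kernel_tree.decoupled_sum S \<kappa> v p N"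
        by (intro tree) auto
      then show "kernel_tree.path_sum S \<kappa> v p N \<le> (D powr (1 / p)) powr p * kernel_tree.decoupled_sum S \<kappa> v p N"
        using root_root_powr[OF D p] by simp
    qed simp
  qed
next
  fix p C :: real assume p: "1 \<le> p" and bound: "decoupling_bound TYPE(real) TYPE(real) TYPE('x) p C"
  show "decoupling_bound TYPE('w) TYPE('v) TYPE('x) p C"
  \<comment> \<open>A negative \<open>C\<close> forces the space to be trivial, and all norms
    vanish. Otherwise the real-line bound gives the tree inequality with \<open>C powr p\<close>,
    and this gives back the same \<open>C\<close> on arbitrary carriers.\<close>
  proof (cases "C < 0")
    case True
    have w: "Lp_norm M p g = 0" for M :: "'w measure" and g :: "'w \<Rightarrow> 'x"
    proof -
      have "g = (\<lambda>_. 0)" by (rule ext) (rule decoupling_bound_negative[OF bound True])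
      then show ?thesis unfolding Lp_norm_def by simp
    qed
    have v: "Lp_norm M p g = 0" for M :: "'v measure" and g :: "'v \<Rightarrow> 'x"
    proof -
      have "g = (\<lambda>_. 0)" by (rule ext) (rule decoupling_bound_negative[OF bound True])
      then show ?thesis unfolding Lp_norm_def by simp
    qed
    show ?thesis unfolding decoupling_bound_def w v by simp
  next
    case False
    then have C: "0 \<le> C" by simp
    show ?thesis
    proof (rule decoupling_bound_of_tree_bound[OF p C])
      fix S :: "(nat \<times> nat list) set" and \<kappa> and v :: "(nat \<times> nat list) list \<Rightarrow> 'x" and N :: nat
      assume tr: "kernel_tree S \<kappa>" and v: "\<And>h. (\<Sum>a\<in>S. \<kappa> h a *\<^sub>R v (h @ [a])) = 0" and N: "1 \<le> N"
      have nn: "0 \<le> kernel_tree.path_sum S \<kappa> v p N" "0 \<le> kernel_tree.decoupled_sum S \<kappa> v p N"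
        using kernel_tree.T_mono[OF tr, where N = N and f = "\<lambda>_ _. 0"] kernel_tree.T_const[OF tr, of N "0 :: real"]
        unfolding kernel_tree.path_sum_def[OF tr] kernel_tree.decoupled_sum_def[OF tr]
        by (metis (no_types, lifting) powr_ge_zero)+
      show "kernel_tree.path_sum S \<kappa> v p N \<le> C powr p * kernel_tree.decoupled_sum S \<kappa> v p N"
        by (rule le_powr_of_root_le[OF nn C p kernel_tree.path_sum_bound[OF tr bound N v]])
    qed
  qed
qed

end
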